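(* Let $\mathfrak{g}_1,\mathfrak{g}_2$ be Leibniz algebras over a field $\mathbb{F}$, and let $\mathfrak{n}_i$ be an ideal of $\mathfrak{g}_i$ for $i=1,2$. Put $\overline{\mathfrak{n}_i}=\mathfrak{n}_i/[\mathfrak{g}_i,\mathfrak{n}_i]$ and $\overline{\mathfrak{g}_i}=\mathfrak{g}_i/[\mathfrak{g}_i,\mathfrak{g}_i]$, and let $\mathfrak{a}$ be the subalgebra of $(\overline{\mathfrak{n}_1}\ast\overline{\mathfrak{g}_2})\oplus(\overline{\mathfrak{g}_1}\ast\overline{\mathfrak{n}_2})$ generated by the elements $(\bar n_1\ast\bar n_2,-\bar n_1\ast\bar n_2)$ and $(\bar n_2\ast\bar n_1,-\bar n_2\ast\bar n_1)$ with $n_1\in\mathfrak{n}_1$, $n_2\in\mathfrak{n}_2$ (the bar denotes the class in the appropriate quotient in each case). Then $$HL_2(\mathfrak{g}_1\oplus\mathfrak{g}_2,\mathfrak{n}_1\oplus\mathfrak{n}_2)\cong HL_2(\mathfrak{g}_1,\mathfrak{n}_1)\oplus HL_2(\mathfrak{g}_2,\mathfrak{n}_2)\oplus\frac{(\overline{\mathfrak{n}_1}\ast\overline{\mathfrak{g}_2})\oplus(\overline{\mathfrak{g}_1}\ast\overline{\mathfrak{n}_2})}{\mathfrak{a}}.$$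
   Context: A (right) Leibniz algebra over a field $\mathbb{F}$ is a vector space with a bilinear bracket satisfying $[x,[y,z]]=[[x,y],z]-[[x,z],y]$. A pair $(\mathfrak{g},\mathfrak{n})$ of Leibniz algebras is a Leibniz algebra $\mathfrak g$ with a two-sided ideal $\mathfrak n$; $[\mathfrak{g},\mathfrak{n}]$ is the subspace spanned by all $[x,n]$ and $[n,x]$, $x\in\mathfrak g$, $n\in\mathfrak n$. Relative homology. Let $CL_n(\mathfrak g)=\mathfrak g^{\otimes n}$, $n\ge 0$, with boundary $\partial_n(x_1\otimes\cdots\otimes x_n)=\sum_{1\le i<j\le n}(-1)^j x_1\otimes\cdots\otimes[x_i,x_j]\otimes\cdots\otimes\widehat{x_j}\otimes\cdots\otimes x_n$ (here $[x_i,x_j]$ is in position $i$). Its homology is $HL_*(\mathfrak g)$. The projection $\mathfrak g\to\mathfrak g/\mathfrak n$ induces a chain map $\pi_*:CL_*(\mathfrak g)\to CL_*(\mathfrak g/\mathfrak n)$; let $M_*$ be its mapping cone, $M_n=CL_{n-1}(\mathfrak g)\oplus CL_n(\mathfrak g/\mathfrak n)$, $\delta_n(a,b)=(-\partial_{n-1}(a),\bar\partial_n(b)+\pi_{n-1}(a))$. Then $HL_n(\mathfrak g,\mathfrak n):=H_{n+1}(M_*,\delta_* )$, regarded as an abelian Leibniz algebra (a vector space). Tensor product. For vector spaces $V,W$ regarded as abelian Leibniz algebras acting trivially on each other, the non-abelian tensor product $V\ast W$ is the abelian Leibniz algebra $(V\otimes_{\mathbb F}W)\oplus(W\otimes_{\mathbb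 F}V)$, where $v\ast w$ denotes $v\otimes w$ in the first summand and $w\ast v$ denotes $w\otimes v$ in the second. In $(\bar n_1\ast\bar n_2,-\bar n_1\ast\bar n_2)$ the first entry lies in $\overline{\mathfrak n_1}\ast\overline{\mathfrak g_2}$ ($\bar n_1$ the class in $\overline{\mathfrak n_1}$, $\bar n_2$ the class in $\overline{\mathfrak g_2}$) and the second entry lies in $\overline{\mathfrak g_1}\ast\overline{\mathfrak n_2}$; similarly for the other generators. *)

theory Defs
  imports "HOL.Hull" "HOL-Algebra.Module" "HOL-Algebra.QuotRing" "HOL-Algebra.Chinese_Remainder"
begin

section \<open>Leibniz algebras\<close>

text \<open>
  A (right) Leibniz algebra is a vector space whose bracket is stored in the \<^const>\<open>mult\<close> field
  of the module record (as the product is in the library's locale \<^locale>\<open>algebra\<close>), so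
  \<open>x \<otimes>\<^bsub>L\<^esub> y\<close> is to be read as \<open>[x, y]\<close>.  The field \<^const>\<open>one\<close> of the record is meaningless here
  and is never used.  A vector space regarded as an abelian Leibniz algebra has bracket
  constantly zero.
\<close>

locale leibniz_algebra = field F + module F L for F (structure) and L (structure) +
  assumes bracket_closed:
      "\<lbrakk>x \<in> carrier L; y \<in> carrier L\<rbrakk> \<Longrightarrow> x \<otimes>\<^bsub>L\<^esub> y \<in> carrier L"
    and bracket_add_left:
      "\<lbrakk>x \<in> carrier L; y \<in> carrier L; z \<in> carrier L\<rbrakk>
        \<Longrightarrow> (x \<oplus>\<^bsub>L\<^esub> y) \<otimes>\<^bsub>L\<^esub> z = x \<otimes>\<^bsub>L\<^esub> z \<oplus>\<^bsub>L\<^esub> y \<otimes>\<^bsub>L\<^esub> z"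
    and bracket_add_right:
      "\<lbrakk>x \<in> carrier L; y \<in> carrier L; z \<in> carrier L\<rbrakk>
        \<Longrightarrow> x \<otimes>\<^bsub>L\<^esub> (y \<oplus>\<^bsub>L\<^esub> z) = x \<otimes>\<^bsub>L\<^esub> y \<oplus>\<^bsub>L\<^esub> x \<otimes>\<^bsub>L\<^esub> z"
    and bracket_smult_left:
      "\<lbrakk>c \<in> carrier F; x \<in> carrier L; y \<in> carrier L\<rbrakk>
        \<Longrightarrow> (c \<odot>\<^bsub>L\<^esub> x) \<otimes>\<^bsub>L\<^esub> y = c \<odot>\<^bsub>L\<^esub> (x \<otimes>\<^bsub>L\<^esub> y)"
    and bracket_smult_right:
      "\<lbrakk>c \<in> carrier F; x \<in> carrier L; y \<in> carrier L\<rbrakk>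
        \<Longrightarrow> x \<otimes>\<^bsub>L\<^esub> (c \<odot>\<^bsub>L\<^esub> y) = c \<odot>\<^bsub>L\<^esub> (x \<otimes>\<^bsub>L\<^esub> y)"
    and leibniz_identity:
      "\<lbrakk>x \<in> carrier L; y \<in> carrier L; z \<in> carrier L\<rbrakk>
        \<Longrightarrow> x \<otimes>\<^bsub>L\<^esub> (y \<otimes>\<^bsub>L\<^esub> z) = ((x \<otimes>\<^bsub>L\<^esub> y) \<otimes>\<^bsub>L\<^esub> z) \<ominus>\<^bsub>L\<^esub> ((x \<otimes>\<^bsub>L\<^esub> z) \<otimes>\<^bsub>L\<^esub> y)"

definition leibniz_subalgebra ::
    "('f, 'r) ring_scheme \<Rightarrow> ('f, 'v, 'm) module_scheme \<Rightarrow> 'v set \<Rightarrow> bool"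
  where "leibniz_subalgebra F L H \<longleftrightarrow>
    submodule H F L \<and> (\<forall>x\<in>H. \<forall>y\<in>H. x \<otimes>\<^bsub>L\<^esub> y \<in> H)"

definition leibniz_ideal ::
    "('f, 'r) ring_scheme \<Rightarrow> ('f, 'v, 'm) module_scheme \<Rightarrow> 'v set \<Rightarrow> bool"
  where "leibniz_ideal F L N \<longleftrightarrow>
    submodule N F L \<and> (\<forall>x\<in>carrier L. \<forall>n\<in>N. x \<otimes>\<^bsub>L\<^esub> n \<in> N \<and> n \<otimes>\<^bsub>L\<^esub> x \<in> N)"

definition linear_span ::
    "('f, 'r) ring_scheme \<Rightarrow> ('f, 'v, 'm) module_scheme \<Rightarrow> 'v set \<Rightarrow> 'v set"
  where "linear_span F V S = (\<lambda>H. submodule H F V) hull S"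

definition generated_subalgebra ::
    "('f, 'r) ring_scheme \<Rightarrow> ('f, 'v, 'm) module_scheme \<Rightarrow> 'v set \<Rightarrow> 'v set"
  where "generated_subalgebra F L S = leibniz_subalgebra F L hull S"

definition commutator ::
    "('f, 'r) ring_scheme \<Rightarrow> ('f, 'v, 'm) module_scheme \<Rightarrow> 'v set \<Rightarrow> 'v set"
  where "commutator F L N =
    linear_span F L (\<Union>x\<in>carrier L. \<Union>n\<in>N. {x \<otimes>\<^bsub>L\<^esub> n, n \<otimes>\<^bsub>L\<^esub> x})"

definition leibniz_hom ::
    "('f, 'r) ring_scheme \<Rightarrow> ('f, 'v, 'm) module_scheme \<Rightarrow> ('f, 'w, 'n) module_scheme
      \<Rightarrow> ('v \<Rightarrow> 'w) set"
  where "leibniz_hom F L M = {\<phi> \<in> carrier L \<rightarrow> carrier M.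
    (\<forall>x\<in>carrier L. \<forall>y\<in>carrier L. \<phi> (x \<oplus>\<^bsub>L\<^esub> y) = \<phi> x \<oplus>\<^bsub>M\<^esub> \<phi> y) \<and>
    (\<forall>c\<in>carrier F. \<forall>x\<in>carrier L. \<phi> (c \<odot>\<^bsub>L\<^esub> x) = c \<odot>\<^bsub>M\<^esub> \<phi> x) \<and>
    (\<forall>x\<in>carrier L. \<forall>y\<in>carrier L. \<phi> (x \<otimes>\<^bsub>L\<^esub> y) = \<phi> x \<otimes>\<^bsub>M\<^esub> \<phi> y)}"

definition leibniz_isomorphic ::
    "('f, 'r) ring_scheme \<Rightarrow> ('f, 'v, 'm) module_scheme \<Rightarrow> ('f, 'w, 'n) module_scheme \<Rightarrow> bool"
  where "leibniz_isomorphic F L M \<longleftrightarrow>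
    (\<exists>\<phi> \<in> leibniz_hom F L M. bij_betw \<phi> (carrier L) (carrier M))"

text \<open>
  The quotient and the direct sum extend the library's ring constructions by scalar
  multiplication.
\<close>

definition quotient_alg ::
    "('f, 'v, 'm) module_scheme \<Rightarrow> 'v set \<Rightarrow> ('f, 'v set) module"
  where "quotient_alg L N =
    ring.extend (L Quot N) (module.fields (\<lambda>c K. \<Union>x\<in>K. N +>\<^bsub>L\<^esub> (c \<odot>\<^bsub>L\<^esub> x)))"

definition direct_sum ::
    "('f, 'v, 'm) module_scheme \<Rightarrow> ('f, 'w, 'n) module_scheme \<Rightarrow> ('f, 'v \<times> 'w) module"
    (infixr \<open>\<boxplus>\<close> 65)
  where "L \<boxplus> M =
    ring.extend (RDirProd L M) (module.fields (\<lambda>c (x, y). (c \<odot>\<^bsub>L\<^esub> x, c \<odot>\<^bsub>M\<^esub> y)))"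


section \<open>Tensor products and tensor powers\<close>

definition free_module ::
    "('f, 'r) ring_scheme \<Rightarrow> 's set \<Rightarrow> ('f, 's \<Rightarrow> 'f) module"
  where "free_module F S =
    \<lparr>carrier = {f. (\<forall>s. f s \<in> carrier F) \<and> (\<forall>s. s \<notin> S \<longrightarrow> f s = \<zero>\<^bsub>F\<^esub>) \<and> finite {s. f s \<noteq> \<zero>\<^bsub>F\<^esub>}},
     mult = (\<lambda>f g s. \<zero>\<^bsub>F\<^esub>),
     one = (\<lambda>s. \<zero>\<^bsub>F\<^esub>),
     zero = (\<lambda>s. \<zero>\<^bsub>F\<^esub>),
     add = (\<lambda>f g s. f s \<oplus>\<^bsub>F\<^esub> g s),
     smult = (\<lambda>c f s. c \<otimes>\<^bsub>F\<^esub> f s)\<rparr>"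

definition free_gen :: "('f, 'r) ring_scheme \<Rightarrow> 's \<Rightarrow> 's \<Rightarrow> 'f"
  where "free_gen F s = (\<lambda>t. if t = s then \<one>\<^bsub>F\<^esub> else \<zero>\<^bsub>F\<^esub>)"

definition tensor_rels ::
    "('f, 'r) ring_scheme \<Rightarrow> ('f, 'v, 'm) module_scheme \<Rightarrow> ('f, 'w, 'n) module_scheme
      \<Rightarrow> ('v \<times> 'w \<Rightarrow> 'f) set"
  where "tensor_rels F V W =
    (let A = free_module F (carrier V \<times> carrier W); e = free_gen F in
     linear_span F A
      ({e (v \<oplus>\<^bsub>V\<^esub> v', w) \<ominus>\<^bsub>A\<^esub> (e (v, w) \<oplus>\<^bsub>A\<^esub> e (v', w)) | v v' w.
          v \<in> carrier V \<and> v' \<in> carrier V \<and> w \<in> carrier W} \<union>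
       {e (v, w \<oplus>\<^bsub>W\<^esub> w') \<ominus>\<^bsub>A\<^esub> (e (v, w) \<oplus>\<^bsub>A\<^esub> e (v, w')) | v w w'.
          v \<in> carrier V \<and> w \<in> carrier W \<and> w' \<in> carrier W} \<union>
       {e (c \<odot>\<^bsub>V\<^esub> v, w) \<ominus>\<^bsub>A\<^esub> (c \<odot>\<^bsub>A\<^esub> e (v, w)) | c v w.
          c \<in> carrier F \<and> v \<in> carrier V \<and> w \<in> carrier W} \<union>
       {e (v, c \<odot>\<^bsub>W\<^esub> w) \<ominus>\<^bsub>A\<^esub> (c \<odot>\<^bsub>A\<^esub> e (v, w)) | c v w.
          c \<in> carrier F \<and> v \<in> carrier V \<and> w \<in> carrier W}))"

definition tensor ::
    "('f, 'r) ring_scheme \<Rightarrow> ('f, 'v, 'm) module_scheme \<Rightarrow> ('f, 'w, 'n) module_scheme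
      \<Rightarrow> ('f, ('v \<times> 'w \<Rightarrow> 'f) set) module"
  where "tensor F V W =
    quotient_alg (free_module F (carrier V \<times> carrier W)) (tensor_rels F V W)"

definition pure_tensor ::
    "('f, 'r) ring_scheme \<Rightarrow> ('f, 'v, 'm) module_scheme \<Rightarrow> ('f, 'w, 'n) module_scheme
      \<Rightarrow> 'v \<Rightarrow> 'w \<Rightarrow> ('v \<times> 'w \<Rightarrow> 'f) set"
  where "pure_tensor F V W v w =
    tensor_rels F V W +>\<^bsub>free_module F (carrier V \<times> carrier W)\<^esub> free_gen F (v, w)"

text \<open>
  The \<open>n\<close>-th tensor power is the free module on the words of length \<open>n\<close> modulo
  multilinearity.  The degree is an integer: in negative degrees there are no words, so the
  tensor power is the zero space, and in degree \<open>0\<close> it is the ground field.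
\<close>

definition tpow_words :: "('f, 'v, 'm) module_scheme \<Rightarrow> int \<Rightarrow> 'v list set"
  where "tpow_words V n = {xs. set xs \<subseteq> carrier V \<and> int (length xs) = n}"

definition tpow_rels ::
    "('f, 'r) ring_scheme \<Rightarrow> ('f, 'v, 'm) module_scheme \<Rightarrow> int \<Rightarrow> ('v list \<Rightarrow> 'f) set"
  where "tpow_rels F V n =
    (let A = free_module F (tpow_words V n); e = free_gen F in
     linear_span F A
      ({e (xs @ (x \<oplus>\<^bsub>V\<^esub> y) # ys) \<ominus>\<^bsub>A\<^esub> (e (xs @ x # ys) \<oplus>\<^bsub>A\<^esub> e (xs @ y # ys)) | xs x y ys.
          xs @ x # ys \<in> tpow_words V n \<and> y \<in> carrier V} \<union>
       {e (xs @ (c \<odot>\<^bsub>V\<^esub> x) # ys) \<ominus>\<^bsub>A\<^esub> (c \<odot>\<^bsub>A\<^esub> e (xs @ x # ys)) | xs c x ys.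
          xs @ x # ys \<in> tpow_words V n \<and> c \<in> carrier F}))"

definition tpow ::
    "('f, 'r) ring_scheme \<Rightarrow> ('f, 'v, 'm) module_scheme \<Rightarrow> int
      \<Rightarrow> ('f, ('v list \<Rightarrow> 'f) set) module"
  where "tpow F V n = quotient_alg (free_module F (tpow_words V n)) (tpow_rels F V n)"

definition tpow_pure ::
    "('f, 'r) ring_scheme \<Rightarrow> ('f, 'v, 'm) module_scheme \<Rightarrow> 'v list \<Rightarrow> ('v list \<Rightarrow> 'f) set"
  where "tpow_pure F V xs =
    tpow_rels F V (int (length xs)) +>\<^bsub>free_module F (tpow_words V (int (length xs)))\<^esub> free_gen F xs"

text \<open>
  The linear map from a tensor power to \<open>M\<close> whose value on the pure tensor of a word \<open>xs\<close>
  is \<open>h xs\<close>.  For multilinear \<open>h\<close>, the linear extension of \<open>h\<close> to the free module is constant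
  on each coset \<open>K\<close>, and this constant is the value at \<open>K\<close>.
\<close>

definition tpow_lift ::
    "('f, 'w, 'n) module_scheme \<Rightarrow> ('f, 'r) ring_scheme \<Rightarrow> ('v list \<Rightarrow> 'w)
      \<Rightarrow> ('v list \<Rightarrow> 'f) set \<Rightarrow> 'w"
  where "tpow_lift M F h K =
    the_elem ((\<lambda>f. \<Oplus>\<^bsub>M\<^esub>xs\<in>{xs. f xs \<noteq> \<zero>\<^bsub>F\<^esub>}. f xs \<odot>\<^bsub>M\<^esub> h xs) ` K)"


section \<open>Relative Leibniz homology\<close>

abbreviation CL ::
    "('f, 'r) ring_scheme \<Rightarrow> ('f, 'v, 'm) module_scheme \<Rightarrow> int
      \<Rightarrow> ('f, ('v list \<Rightarrow> 'f) set) module"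
  where "CL \<equiv> tpow"

text \<open>
  The word with entry \<open>[x\<^sub>i, x\<^sub>j]\<close> in position \<open>i\<close> and with \<open>x\<^sub>j\<close> omitted.  Positions are
  counted from \<open>0\<close>, whence the sign \<open>(-1)\<^sup>j\<^sup>+\<^sup>1\<close> in the boundary.
\<close>

definition bracket_word ::
    "('f, 'v, 'm) module_scheme \<Rightarrow> 'v list \<Rightarrow> nat \<Rightarrow> nat \<Rightarrow> 'v list"
  where "bracket_word L xs i j =
    (let ys = xs[i := xs ! i \<otimes>\<^bsub>L\<^esub> xs ! j] in take j ys @ drop (Suc j) ys)"

definition CL_boundary ::
    "('f, 'r) ring_scheme \<Rightarrow> ('f, 'v, 'm) module_scheme \<Rightarrow> int
      \<Rightarrow> ('v list \<Rightarrow> 'f) set \<Rightarrow> ('v list \<Rightarrow> 'f) set"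
  where "CL_boundary F L n = tpow_lift (CL F L (n - 1)) F
    (\<lambda>xs. \<Oplus>\<^bsub>CL F L (n - 1)\<^esub>j\<in>{..<length xs}. \<Oplus>\<^bsub>CL F L (n - 1)\<^esub>i\<in>{..<j}.
      ((\<ominus>\<^bsub>F\<^esub> \<one>\<^bsub>F\<^esub>) [^]\<^bsub>F\<^esub> Suc j) \<odot>\<^bsub>CL F L (n - 1)\<^esub> tpow_pure F L (bracket_word L xs i j))"

definition CL_proj ::
    "('f, 'r) ring_scheme \<Rightarrow> ('f, 'v, 'm) module_scheme \<Rightarrow> 'v set \<Rightarrow> int
      \<Rightarrow> ('v list \<Rightarrow> 'f) set \<Rightarrow> ('v set list \<Rightarrow> 'f) set"
  where "CL_proj F L N n = tpow_lift (CL F (quotient_alg L N) n) F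
    (\<lambda>xs. tpow_pure F (quotient_alg L N) (map (\<lambda>x. N +>\<^bsub>L\<^esub> x) xs))"

definition cone ::
    "('f, 'r) ring_scheme \<Rightarrow> ('f, 'v, 'm) module_scheme \<Rightarrow> 'v set \<Rightarrow> int
      \<Rightarrow> ('f, ('v list \<Rightarrow> 'f) set \<times> ('v set list \<Rightarrow> 'f) set) module"
  where "cone F L N n = CL F L (n - 1) \<boxplus> CL F (quotient_alg L N) n"

definition cone_boundary ::
    "('f, 'r) ring_scheme \<Rightarrow> ('f, 'v, 'm) module_scheme \<Rightarrow> 'v set \<Rightarrow> int
      \<Rightarrow> ('v list \<Rightarrow> 'f) set \<times> ('v set list \<Rightarrow> 'f) set
      \<Rightarrow> ('v list \<Rightarrow> 'f) set \<times> ('v set list \<Rightarrow> 'f) set"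
  where "cone_boundary F L N n = (\<lambda>(a, b).
    (\<ominus>\<^bsub>CL F L (n - 2)\<^esub> CL_boundary F L (n - 1) a,
     CL_boundary F (quotient_alg L N) n b \<oplus>\<^bsub>CL F (quotient_alg L N) (n - 1)\<^esub> CL_proj F L N (n - 1) a))"

definition chain_homology ::
    "(int \<Rightarrow> ('f, 'v) module) \<Rightarrow> (int \<Rightarrow> 'v \<Rightarrow> 'v) \<Rightarrow> int \<Rightarrow> ('f, 'v set) module"
  where "chain_homology C d n =
    quotient_alg (C n\<lparr>carrier := {z \<in> carrier (C n). d n z = \<zero>\<^bsub>C (n - 1)\<^esub>}\<rparr>)
      (d (n + 1) ` carrier (C (n + 1)))"

definition HL_rel ::
    "('f, 'r) ring_scheme \<Rightarrow> int \<Rightarrow> ('f, 'v, 'm) module_scheme \<Rightarrow> 'v set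
      \<Rightarrow> ('f, (('v list \<Rightarrow> 'f) set \<times> ('v set list \<Rightarrow> 'f) set) set) module"
  where "HL_rel F n L N = chain_homology (cone F L N) (cone_boundary F L N) (n + 1)"


section \<open>The non-abelian tensor product and the subalgebra \<open>\<aa>\<close>\<close>

text \<open>
  Only the case of abelian Leibniz algebras acting trivially on each other is covered.
\<close>

definition nonabelian_tensor ::
    "('f, 'r) ring_scheme \<Rightarrow> ('f, 'v, 'm) module_scheme \<Rightarrow> ('f, 'w, 'n) module_scheme
      \<Rightarrow> ('f, ('v \<times> 'w \<Rightarrow> 'f) set \<times> ('w \<times> 'v \<Rightarrow> 'f) set) module"
  where "nonabelian_tensor F V W = tensor F V W \<boxplus> tensor F W V"

text \<open>
  \<open>star_left F V W v w\<close> is \<open>v * w\<close> and \<open>star_right F V W w v\<close> is \<open>w * v\<close>; both are elements of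
  \<open>V * W\<close>, where \<open>v \<in> V\<close> and \<open>w \<in> W\<close>.
\<close>

definition star_left ::
    "('f, 'r) ring_scheme \<Rightarrow> ('f, 'v, 'm) module_scheme \<Rightarrow> ('f, 'w, 'n) module_scheme
      \<Rightarrow> 'v \<Rightarrow> 'w \<Rightarrow> ('v \<times> 'w \<Rightarrow> 'f) set \<times> ('w \<times> 'v \<Rightarrow> 'f) set"
  where "star_left F V W v w = (pure_tensor F V W v w, \<zero>\<^bsub>tensor F W V\<^esub>)"

definition star_right ::
    "('f, 'r) ring_scheme \<Rightarrow> ('f, 'v, 'm) module_scheme \<Rightarrow> ('f, 'w, 'n) module_scheme
      \<Rightarrow> 'w \<Rightarrow> 'v \<Rightarrow> ('v \<times> 'w \<Rightarrow> 'f) set \<times> ('w \<times> 'v \<Rightarrow> 'f) set"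
  where "star_right F V W w v = (\<zero>\<^bsub>tensor F V W\<^esub>, pure_tensor F W V w v)"

definition ideal_bar ::
    "('f, 'r) ring_scheme \<Rightarrow> ('f, 'v, 'm) module_scheme \<Rightarrow> 'v set \<Rightarrow> ('f, 'v set) module"
  where "ideal_bar F L N = quotient_alg (L\<lparr>carrier := N\<rparr>) (commutator F L N)"

definition alg_bar ::
    "('f, 'r) ring_scheme \<Rightarrow> ('f, 'v, 'm) module_scheme \<Rightarrow> ('f, 'v set) module"
  where "alg_bar F L = quotient_alg L (commutator F L (carrier L))"

definition ideal_class ::
    "('f, 'r) ring_scheme \<Rightarrow> ('f, 'v, 'm) module_scheme \<Rightarrow> 'v set \<Rightarrow> 'v \<Rightarrow> 'v set"
  where "ideal_class F L N x = commutator F L N +>\<^bsub>L\<^esub> x"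

definition alg_class ::
    "('f, 'r) ring_scheme \<Rightarrow> ('f, 'v, 'm) module_scheme \<Rightarrow> 'v \<Rightarrow> 'v set"
  where "alg_class F L x = commutator F L (carrier L) +>\<^bsub>L\<^esub> x"

definition cross_sum ::
    "('f, 'r) ring_scheme \<Rightarrow> ('f, 'a, 'm) module_scheme \<Rightarrow> 'a set
      \<Rightarrow> ('f, 'b, 'n) module_scheme \<Rightarrow> 'b set
      \<Rightarrow> ('f, (('a set \<times> 'b set \<Rightarrow> 'f) set \<times> ('b set \<times> 'a set \<Rightarrow> 'f) set) \<times>
              (('a set \<times> 'b set \<Rightarrow> 'f) set \<times> ('b set \<times> 'a set \<Rightarrow> 'f) set)) module"
  where "cross_sum F L\<^sub>1 N\<^sub>1 L\<^sub>2 N\<^sub>2 =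
    nonabelian_tensor F (ideal_bar F L\<^sub>1 N\<^sub>1) (alg_bar F L\<^sub>2) \<boxplus>
    nonabelian_tensor F (alg_bar F L\<^sub>1) (ideal_bar F L\<^sub>2 N\<^sub>2)"

definition cross_subalgebra ::
    "('f, 'r) ring_scheme \<Rightarrow> ('f, 'a, 'm) module_scheme \<Rightarrow> 'a set
      \<Rightarrow> ('f, 'b, 'n) module_scheme \<Rightarrow> 'b set
      \<Rightarrow> ((('a set \<times> 'b set \<Rightarrow> 'f) set \<times> ('b set \<times> 'a set \<Rightarrow> 'f) set) \<times>
          (('a set \<times> 'b set \<Rightarrow> 'f) set \<times> ('b set \<times> 'a set \<Rightarrow> 'f) set)) set"
  where "cross_subalgebra F L\<^sub>1 N\<^sub>1 L\<^sub>2 N\<^sub>2 =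
    (let I\<^sub>1 = ideal_bar F L\<^sub>1 N\<^sub>1; I\<^sub>2 = ideal_bar F L\<^sub>2 N\<^sub>2;
         A\<^sub>1 = alg_bar F L\<^sub>1; A\<^sub>2 = alg_bar F L\<^sub>2;
         neg = (\<lambda>t. \<ominus>\<^bsub>nonabelian_tensor F A\<^sub>1 I\<^sub>2\<^esub> t) in
     generated_subalgebra F (cross_sum F L\<^sub>1 N\<^sub>1 L\<^sub>2 N\<^sub>2)
      (\<Union>n\<^sub>1\<in>N\<^sub>1. \<Union>n\<^sub>2\<in>N\<^sub>2.
        {(star_left F I\<^sub>1 A\<^sub>2 (ideal_class F L\<^sub>1 N\<^sub>1 n\<^sub>1) (alg_class F L\<^sub>2 n\<^sub>2),
          neg (star_left F A\<^sub>1 I\<^sub>2 (alg_class F L\<^sub>1 n\<^sub>1) (ideal_class F L\<^sub>2 N\<^sub>2 n\<^sub>2))),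
         (star_right F I\<^sub>1 A\<^sub>2 (alg_class F L\<^sub>2 n\<^sub>2) (ideal_class F L\<^sub>1 N\<^sub>1 n\<^sub>1),
          neg (star_right F A\<^sub>1 I\<^sub>2 (ideal_class F L\<^sub>2 N\<^sub>2 n\<^sub>2) (alg_class F L\<^sub>1 n\<^sub>1)))}))"

end

theory Submission
  imports Defs
begin

text \<open>
  Write \<open>C\<^sub>n(g)\<close> for the \<open>n\<close>-th tensor power of \<open>g\<close> and \<open>\<pi>\<^sub>n : C\<^sub>n(g) \<rightarrow> C\<^sub>n(g/n)\<close> for the projection.

  The projection is surjective, so its mapping cone computes the homology of its kernel:
  \<open>HL\<^sub>2(g, n)\<close> is \<open>{a \<in> C\<^sub>2(g). \<partial> a = 0, \<pi> a = 0}\<close> modulo \<open>\<partial> (ker \<pi>\<^sub>3)\<close> (\<open>HL_rel_2_iso_kernel\<close>).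
  The kernel of \<open>\<pi>\<^sub>n\<close> is handled by one principle (\<open>vanishes_on_CL_proj_kernel\<close>): a linear map that
  kills all words with an entry in \<open>n\<close> kills \<open>ker \<pi>\<^sub>n\<close>.

  Now let \<open>g = g\<^sub>1 \<oplus> g\<^sub>2\<close> and \<open>n = n\<^sub>1 \<oplus> n\<^sub>2\<close>.  Then \<open>C\<^sub>2(g)\<close> is the sum of \<open>C\<^sub>2(g\<^sub>1)\<close>, \<open>C\<^sub>2(g\<^sub>2)\<close> and the two mixed
  spaces \<open>g\<^sub>1 \<otimes> g\<^sub>2\<close> and \<open>g\<^sub>2 \<otimes> g\<^sub>1\<close>.  The first two summands give \<open>HL\<^sub>2(g\<^sub>i, n\<^sub>i)\<close>.  On the mixed spaces \<open>\<partial>\<close> is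
  zero, as brackets between the two algebras are zero, so there the cycles are the kernel
  \<open>n\<^sub>1 \<otimes> g\<^sub>2 + g\<^sub>1 \<otimes> n\<^sub>2\<close> of \<open>\<pi>\<close>.  The boundary of a mixed word of length three is, up to sign,
  \<open>[x, x'] \<otimes> y\<close> or \<open>x \<otimes> [y, y']\<close>; with one of the three entries in \<open>n\<close> these span
  \<open>[g\<^sub>1, n\<^sub>1] \<otimes> g\<^sub>2 + [g\<^sub>1, g\<^sub>1] \<otimes> n\<^sub>2 + n\<^sub>1 \<otimes> [g\<^sub>2, g\<^sub>2] + g\<^sub>1 \<otimes> [g\<^sub>2, n\<^sub>2]\<close>, exactly what is divided out in passing
  to the quotients in the cross term.  Finally, over a field \<open>n\<^sub>1 \<otimes> g\<^sub>2\<close> and \<open>g\<^sub>1 \<otimes> n\<^sub>2\<close> intersect in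
  \<open>n\<^sub>1 \<otimes> n\<^sub>2\<close>, so their sum is the direct sum modulo the antidiagonal copy of \<open>n\<^sub>1 \<otimes> n\<^sub>2\<close>, which is the
  subalgebra divided out in the statement.

  The intersection is never computed.  The cross term is described by its universal property
  (\<open>cross_quotient_universal\<close>): a pairing of \<open>g\<^sub>1\<close> with \<open>g\<^sub>2\<close> and one of \<open>g\<^sub>2\<close> with \<open>g\<^sub>1\<close> that vanish on the
  four products above define a linear map out of it.  Its own universal pairings, given at first on
  \<open>n\<^sub>1 \<times> g\<^sub>2\<close> and on \<open>g\<^sub>1 \<times> n\<^sub>2\<close>, extend to all of \<open>g\<^sub>1 \<times> g\<^sub>2\<close> by means of linear retractions of \<open>g\<^sub>i\<close> onto \<open>n\<^sub>i\<close>
  (\<open>bilinear_extension\<close>).  The extension yields a linear map from \<open>C\<^sub>2(g)\<close> to the cross term, which together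
  with the two projections of \<open>g\<close> gives the isomorphism (\<open>HL2_kernel_direct_sum\<close>).  Both sides carry
  the zero bracket, so a linear isomorphism is enough.
\<close>

section \<open>Linear maps and submodules\<close>

text \<open>
  Registered with the method \<open>algebra\<close>, whose term ordering puts \<open>x\<close> next to \<open>\<ominus> x\<close>, so that it
  cancels opposite terms in long sums.
\<close>

lemmas (in abelian_group) abelian_group_simprules
  [algebra ab_group "zero G" "add G" "a_inv G" "a_minus G"] =
  a_closed zero_closed a_inv_closed minus_closed a_assoc l_zero l_neg a_comm minus_eq
  r_zero r_neg r_neg2 r_neg1 minus_add minus_minus minus_zero a_lcomm

lemma (in abelian_group) minus_eq_zero_iff:
  assumes "x \<in> carrier G" "y \<in> carrier G"
  shows "x \<ominus> y = \<zero> \<longleftrightarrow> x = y"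
proof
  assume "x \<ominus> y = \<zero>"
  then have "\<ominus> (\<ominus> y) = x" using assms by (intro minus_equality) (auto simp: a_minus_def)
  then show "x = y" using assms by simp
qed (use assms in \<open>simp add: a_minus_def r_neg\<close>)

definition linear_maps ::
    "('f, 'r) ring_scheme \<Rightarrow> ('f, 'v, 'm) module_scheme \<Rightarrow> ('f, 'w, 'n) module_scheme
      \<Rightarrow> ('v \<Rightarrow> 'w) set"
  where "linear_maps F V W = {f \<in> carrier V \<rightarrow> carrier W.
    (\<forall>x\<in>carrier V. \<forall>y\<in>carrier V. f (x \<oplus>\<^bsub>V\<^esub> y) = f x \<oplus>\<^bsub>W\<^esub> f y) \<and>
    (\<forall>c\<in>carrier F. \<forall>x\<in>carrier V. f (c \<odot>\<^bsub>V\<^esub> x) = c \<odot>\<^bsub>W\<^esub> f x)}"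

lemma linear_mapsI:
  assumes "\<And>x. x \<in> carrier V \<Longrightarrow> f x \<in> carrier W"
    and "\<And>x y. \<lbrakk>x \<in> carrier V; y \<in> carrier V\<rbrakk> \<Longrightarrow> f (x \<oplus>\<^bsub>V\<^esub> y) = f x \<oplus>\<^bsub>W\<^esub> f y"
    and "\<And>c x. \<lbrakk>c \<in> carrier F; x \<in> carrier V\<rbrakk> \<Longrightarrow> f (c \<odot>\<^bsub>V\<^esub> x) = c \<odot>\<^bsub>W\<^esub> f x"
  shows "f \<in> linear_maps F V W"
  using assms unfolding linear_maps_def by auto

lemma linear_mapsD:
  assumes "f \<in> linear_maps F V W"
  shows "x \<in> carrier V \<Longrightarrow> f x \<in> carrier W"
    and "\<lbrakk>x \<in> carrier V; y \<in> carrier V\<rbrakk> \<Longrightarrow> f (x \<oplus>\<^bsub>V\<^esub> y) = f x \<oplus>\<^bsub>W\<^esub> f y"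
    and "\<lbrakk>c \<in> carrier F; x \<in> carrier V\<rbrakk> \<Longrightarrow> f (c \<odot>\<^bsub>V\<^esub> x) = c \<odot>\<^bsub>W\<^esub> f x"
  using assms unfolding linear_maps_def by auto

text \<open>
  Negation is a scalar multiplication, so preservation of sums and scalar multiples already
  controls negatives and differences.
\<close>

lemma module_minus_smult:
  assumes "module F V" "x \<in> carrier V"
  shows "\<ominus>\<^bsub>V\<^esub> x = (\<ominus>\<^bsub>F\<^esub> \<one>\<^bsub>F\<^esub>) \<odot>\<^bsub>V\<^esub> x"
proof -
  interpret V: module F V by fact
  show ?thesis using assms V.smult_l_minus[of "\<one>\<^bsub>F\<^esub>" x] by simp
qed

lemma linear_maps_zero_neg:
  assumes f: "f \<in> linear_maps F V W" and V: "module F V" and W: "module F W"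
  shows "f \<zero>\<^bsub>V\<^esub> = \<zero>\<^bsub>W\<^esub>"
    and "x \<in> carrier V \<Longrightarrow> f (\<ominus>\<^bsub>V\<^esub> x) = \<ominus>\<^bsub>W\<^esub> f x"
    and "\<lbrakk>x \<in> carrier V; y \<in> carrier V\<rbrakk> \<Longrightarrow> f (x \<ominus>\<^bsub>V\<^esub> y) = f x \<ominus>\<^bsub>W\<^esub> f y"
proof -
  interpret V: module F V by fact
  interpret W: module F W by fact
  note D = linear_mapsD[OF f]
  show 0: "f \<zero>\<^bsub>V\<^esub> = \<zero>\<^bsub>W\<^esub>" using D(3)[of "\<zero>\<^bsub>F\<^esub>" "\<zero>\<^bsub>V\<^esub>"] D(1) by simp
  show 1: "f (\<ominus>\<^bsub>V\<^esub> x) = \<ominus>\<^bsub>W\<^esub> f x" if "x \<in> carrier V" for x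
    using that D by (simp add: module_minus_smult[OF V] module_minus_smult[OF W])
  show "\<lbrakk>x \<in> carrier V; y \<in> carrier V\<rbrakk> \<Longrightarrow> f (x \<ominus>\<^bsub>V\<^esub> y) = f x \<ominus>\<^bsub>W\<^esub> f y"
    using D 1 by (simp add: a_minus_def)
qed

lemma linear_maps_comp:
  assumes "f \<in> linear_maps F V W" "g \<in> linear_maps F W U"
  shows "(\<lambda>x. g (f x)) \<in> linear_maps F V U"
  using assms by (intro linear_mapsI) (auto simp: linear_mapsD)

lemma linear_maps_cong:
  assumes "f \<in> linear_maps F V W" "module F V" "\<And>x. x \<in> carrier V \<Longrightarrow> f x = g x"
  shows "g \<in> linear_maps F V W"
proof -
  interpret V: module F V by fact
  show ?thesis
    using assms(1) by (intro linear_mapsI) (auto simp: linear_mapsD assms(3)[symmetric])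
qed

lemma linear_maps_add:
  assumes "f \<in> linear_maps F V W" "g \<in> linear_maps F V W" "module F W"
  shows "(\<lambda>x. f x \<oplus>\<^bsub>W\<^esub> g x) \<in> linear_maps F V W"
proof -
  interpret W: module F W by fact
  show ?thesis
    using linear_mapsD[OF assms(1)] linear_mapsD[OF assms(2)]
    by (intro linear_mapsI) (auto simp: W.a_ac W.smult_r_distr)
qed

lemma linear_maps_uminus:
  assumes "f \<in> linear_maps F V W" "module F W"
  shows "(\<lambda>x. \<ominus>\<^bsub>W\<^esub> f x) \<in> linear_maps F V W"
proof -
  interpret W: module F W by fact
  show ?thesis
    using linear_mapsD[OF assms(1)]
    by (intro linear_mapsI) (auto simp: W.minus_add W.smult_r_minus W.a_ac)
qed

lemma linear_maps_minus:
  assumes "f \<in> linear_maps F V W" "g \<in> linear_maps F V W" "module F W"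
  shows "(\<lambda>x. f x \<ominus>\<^bsub>W\<^esub> g x) \<in> linear_maps F V W"
  unfolding a_minus_def by (intro linear_maps_add linear_maps_uminus assms)

lemma linear_maps_smult:
  assumes "f \<in> linear_maps F V W" "module F W" "c \<in> carrier F"
  shows "(\<lambda>x. c \<odot>\<^bsub>W\<^esub> f x) \<in> linear_maps F V W"
proof -
  interpret W: module F W by fact
  show ?thesis
    using linear_mapsD[OF assms(1)] assms(3)
    by (intro linear_mapsI) (auto simp: W.smult_r_distr W.smult_assoc1[symmetric] W.R.m_comm)
qed

lemma linear_maps_zero:
  assumes "module F W"
  shows "(\<lambda>x. \<zero>\<^bsub>W\<^esub>) \<in> linear_maps F V W"
proof -
  interpret W: module F W by fact
  show ?thesis by (intro linear_mapsI) auto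
qed

lemma linear_maps_id: "(\<lambda>x. x) \<in> linear_maps F V V"
  by (intro linear_mapsI) auto

lemma submodule_criterion:
  assumes "module F V" "H \<subseteq> carrier V" "\<zero>\<^bsub>V\<^esub> \<in> H"
    "\<And>a b. \<lbrakk>a \<in> H; b \<in> H\<rbrakk> \<Longrightarrow> a \<oplus>\<^bsub>V\<^esub> b \<in> H"
    "\<And>c a. \<lbrakk>c \<in> carrier F; a \<in> H\<rbrakk> \<Longrightarrow> c \<odot>\<^bsub>V\<^esub> a \<in> H"
  shows "submodule H F V"
proof -
  interpret V: module F V by fact
  show ?thesis
    using assms by (intro V.submoduleI) (auto simp: module_minus_smult[OF assms(1)] subset_eq)
qed

lemma submoduleD:
  assumes "submodule H F V"
  shows "H \<subseteq> carrier V" "\<zero>\<^bsub>V\<^esub> \<in> H"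
    "\<And>a b. \<lbrakk>a \<in> H; b \<in> H\<rbrakk> \<Longrightarrow> a \<oplus>\<^bsub>V\<^esub> b \<in> H"
    "\<And>c a. \<lbrakk>c \<in> carrier F; a \<in> H\<rbrakk> \<Longrightarrow> c \<odot>\<^bsub>V\<^esub> a \<in> H"
    "\<And>a. a \<in> H \<Longrightarrow> \<ominus>\<^bsub>V\<^esub> a \<in> H"
    "\<And>a b. \<lbrakk>a \<in> H; b \<in> H\<rbrakk> \<Longrightarrow> a \<ominus>\<^bsub>V\<^esub> b \<in> H"
proof -
  interpret H: submodule H F V by fact
  interpret A: additive_subgroup H V by (rule additive_subgroupI) (rule H.subgroup_axioms)
  show "H \<subseteq> carrier V" "\<zero>\<^bsub>V\<^esub> \<in> H" using A.a_subset by auto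
  show "\<And>a b. \<lbrakk>a \<in> H; b \<in> H\<rbrakk> \<Longrightarrow> a \<oplus>\<^bsub>V\<^esub> b \<in> H" by auto
  show "\<And>c a. \<lbrakk>c \<in> carrier F; a \<in> H\<rbrakk> \<Longrightarrow> c \<odot>\<^bsub>V\<^esub> a \<in> H" by auto
  show "\<And>a. a \<in> H \<Longrightarrow> \<ominus>\<^bsub>V\<^esub> a \<in> H" by auto
  show "\<And>a b. \<lbrakk>a \<in> H; b \<in> H\<rbrakk> \<Longrightarrow> a \<ominus>\<^bsub>V\<^esub> b \<in> H" by (auto simp: a_minus_def)
qed

lemma submodule_imp_additive_subgroup: "submodule H F V \<Longrightarrow> additive_subgroup H V"
  by (simp add: additive_subgroup_def submodule.axioms(1))

lemma submodule_imp_abelian_subgroup: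
  assumes "module F V" "submodule N F V"
  shows "abelian_subgroup N V"
  using submodule_imp_additive_subgroup[OF assms(2)] module.axioms(2)[OF assms(1)]
  by (rule abelian_subgroupI3)

lemma submodule_Inter:
  assumes "module F V" "\<And>H. H \<in> A \<Longrightarrow> submodule H F V" "A \<noteq> {}"
  shows "submodule (\<Inter>A) F V"
proof (rule submodule_criterion[OF assms(1)])
  note D = submoduleD[OF assms(2)]
  show "\<Inter>A \<subseteq> carrier V" using assms(3) D(1) by blast
  show "\<zero>\<^bsub>V\<^esub> \<in> \<Inter>A" using D(2) by blast
  show "a \<oplus>\<^bsub>V\<^esub> b \<in> \<Inter>A" if "a \<in> \<Inter>A" "b \<in> \<Inter>A" for a b using that D(3) by blast
  show "c \<odot>\<^bsub>V\<^esub> a \<in> \<Inter>A" if "c \<in> carrier F" "a \<in> \<Inter>A" for a c using that D(4) by blast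
qed

lemma submodule_preimage:
  assumes "f \<in> linear_maps F V W" "module F V" "module F W" "submodule H F W"
  shows "submodule {x \<in> carrier V. f x \<in> H} F V"
proof -
  interpret V: module F V by fact
  show ?thesis
    using submoduleD[OF assms(4)] linear_maps_zero_neg(1)[OF assms(1-3)]
    by (intro submodule_criterion[OF assms(2)]) (auto simp: linear_mapsD[OF assms(1)])
qed

lemma submodule_image:
  assumes "f \<in> linear_maps F V W" "module F V" "module F W" "submodule H F V"
  shows "submodule (f ` H) F W"
proof (rule submodule_criterion[OF assms(3)])
  note H = submoduleD[OF assms(4)]
  note f = linear_mapsD[OF assms(1)]
  show "f ` H \<subseteq> carrier W" using H f by auto
  show "\<zero>\<^bsub>W\<^esub> \<in> f ` H" using linear_maps_zero_neg(1)[OF assms(1-3)] H(2) by force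
  show "a \<oplus>\<^bsub>W\<^esub> b \<in> f ` H" if "a \<in> f ` H" "b \<in> f ` H" for a b
    using that H(1,3) f(2) by (auto simp: image_iff subset_eq) metis
  show "c \<odot>\<^bsub>W\<^esub> a \<in> f ` H" if "c \<in> carrier F" "a \<in> f ` H" for a c
    using that H(1,4) f(3) by (auto simp: image_iff subset_eq) metis
qed

lemma submodule_zero: "module F V \<Longrightarrow> submodule {\<zero>\<^bsub>V\<^esub>} F V"
proof -
  assume V: "module F V"
  interpret V: module F V by fact
  show ?thesis by (intro submodule_criterion[OF V]) auto
qed

lemma submodule_kernel:
  assumes "f \<in> linear_maps F V W" "module F V" "module F W"
  shows "submodule {x \<in> carrier V. f x = \<zero>\<^bsub>W\<^esub>} F V"
  using submodule_preimage[OF assms submodule_zero[OF assms(3)]] by simp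

lemma submodule_equalizer:
  assumes "f \<in> linear_maps F V W" "g \<in> linear_maps F V W" "module F V" "module F W"
  shows "submodule {x \<in> carrier V. f x = g x} F V"
proof -
  interpret V: module F V by fact
  interpret W: module F W by fact
  show ?thesis
    using linear_mapsD[OF assms(1)] linear_mapsD[OF assms(2)]
      linear_maps_zero_neg(1)[OF assms(1,3,4)] linear_maps_zero_neg(1)[OF assms(2,3,4)]
    by (intro submodule_criterion) (auto simp: assms)
qed

lemma module_restrict:
  assumes "module F V" "submodule H F V"
  shows "module F (V\<lparr>carrier := H\<rparr>)"
  using submodule.submodule_is_module[OF assms(2,1)] .

lemma submodule_restrict:
  assumes "module F V" "submodule H F V" "submodule N F V" "N \<subseteq> H"
  shows "submodule N F (V\<lparr>carrier := H\<rparr>)"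
  using assms by (intro submodule_criterion[OF module_restrict[OF assms(1,2)]]) (auto dest: submoduleD)

lemma linear_span_submodule:
  assumes "module F V" "S \<subseteq> carrier V"
  shows "submodule (linear_span F V S) F V"
  unfolding linear_span_def hull_def
  using assms module.carrier_is_submodule[OF assms(1)]
  by (intro submodule_Inter) auto

lemma linear_span_superset: "S \<subseteq> linear_span F V S"
  unfolding linear_span_def by (rule hull_subset)

lemma linear_span_minimal: "\<lbrakk>S \<subseteq> H; submodule H F V\<rbrakk> \<Longrightarrow> linear_span F V S \<subseteq> H"
  unfolding linear_span_def by (rule hull_minimal)

lemma linear_map_vanishes_on_span:
  assumes "f \<in> linear_maps F V W" "module F V" "module F W" "S \<subseteq> carrier V"
    "\<And>x. x \<in> S \<Longrightarrow> f x = \<zero>\<^bsub>W\<^esub>" "x \<in> linear_span F V S"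
  shows "f x = \<zero>\<^bsub>W\<^esub>"
  using linear_span_minimal[OF _ submodule_kernel[OF assms(1-3)], of S] assms(4-6) by auto

section \<open>Quotients and direct sums\<close>

lemma coset_eq_iff:
  assumes V: "module F V" and N: "submodule N F V" and x: "x \<in> carrier V" and y: "y \<in> carrier V"
  shows "N +>\<^bsub>V\<^esub> x = N +>\<^bsub>V\<^esub> y \<longleftrightarrow> x \<ominus>\<^bsub>V\<^esub> y \<in> N"
proof -
  interpret V: module F V by fact
  interpret N: abelian_subgroup N V
    by (rule submodule_imp_abelian_subgroup) fact+
  show ?thesis
    using N.a_rcos_module[OF y x] N.a_rcos_self[OF x] V.a_repr_independence[OF _ y N.a_subgroup]
    unfolding a_minus_def by blast
qed

lemma coset_eq_self_iff:
  assumes V: "module F V" and N: "submodule N F V" and x: "x \<in> carrier V"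
  shows "N +>\<^bsub>V\<^esub> x = N \<longleftrightarrow> x \<in> N"
proof -
  interpret V: module F V by fact
  show ?thesis
    using V.a_coset_join1[OF _ x] V.a_coset_join2[OF x] submodule.axioms(1)[OF N] by blast
qed

lemma mem_coset_iff:
  assumes V: "module F V" and N: "submodule N F V" and x: "x \<in> carrier V"
  shows "y \<in> N +>\<^bsub>V\<^esub> x \<longleftrightarrow> y \<in> carrier V \<and> N +>\<^bsub>V\<^esub> y = N +>\<^bsub>V\<^esub> x"
proof -
  interpret V: module F V by fact
  interpret N: abelian_subgroup N V
    by (rule submodule_imp_abelian_subgroup) fact+
  show ?thesis
    using x N.a_rcos_self V.a_repr_independence[OF _ _ N.a_subgroup] V.a_r_coset_subset_G[OF N.a_subset]
    by blast
qed

lemma quotient_alg_simps: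
  "carrier (quotient_alg V N) = (\<lambda>x. N +>\<^bsub>V\<^esub> x) ` carrier V"
  "\<zero>\<^bsub>quotient_alg V N\<^esub> = N"
  by (auto simp: quotient_alg_def FactRing_def ring.defs module.defs A_RCOSETS_def')

lemma quotient_alg_add:
  assumes "module F V" "submodule N F V" "x \<in> carrier V" "y \<in> carrier V"
  shows "(N +>\<^bsub>V\<^esub> x) \<oplus>\<^bsub>quotient_alg V N\<^esub> (N +>\<^bsub>V\<^esub> y) = N +>\<^bsub>V\<^esub> (x \<oplus>\<^bsub>V\<^esub> y)"
proof -
  interpret V: module F V by fact
  interpret N: abelian_subgroup N V
    by (rule submodule_imp_abelian_subgroup) fact+
  show ?thesis
    using N.a_rcos_sum assms by (simp add: quotient_alg_def FactRing_def ring.defs module.defs)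
qed

lemma quotient_alg_smult:
  assumes V: "module F V" and N: "submodule N F V" and c: "c \<in> carrier F" and x: "x \<in> carrier V"
  shows "c \<odot>\<^bsub>quotient_alg V N\<^esub> (N +>\<^bsub>V\<^esub> x) = N +>\<^bsub>V\<^esub> (c \<odot>\<^bsub>V\<^esub> x)"
proof -
  interpret V: module F V by fact
  have const: "N +>\<^bsub>V\<^esub> (c \<odot>\<^bsub>V\<^esub> y) = N +>\<^bsub>V\<^esub> (c \<odot>\<^bsub>V\<^esub> x)" if "y \<in> N +>\<^bsub>V\<^esub> x" for y
  proof -
    have y: "y \<in> carrier V" "y \<ominus>\<^bsub>V\<^esub> x \<in> N"
      using that mem_coset_iff[OF V N x] coset_eq_iff[OF V N _ x] by auto
    have "c \<odot>\<^bsub>V\<^esub> y \<ominus>\<^bsub>V\<^esub> c \<odot>\<^bsub>V\<^esub> x = c \<odot>\<^bsub>V\<^esub> (y \<ominus>\<^bsub>V\<^esub> x)"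
      using c x y(1) by (simp add: a_minus_def V.smult_r_distr V.smult_r_minus)
    then show ?thesis using c x y submoduleD(4)[OF N] coset_eq_iff[OF V N] by auto
  qed
  have "x \<in> N +>\<^bsub>V\<^esub> x" using mem_coset_iff[OF V N x] x by simp
  then have ne: "N +>\<^bsub>V\<^esub> x \<noteq> {}" by blast
  have "(\<Union>y\<in>N +>\<^bsub>V\<^esub> x. N +>\<^bsub>V\<^esub> (c \<odot>\<^bsub>V\<^esub> y)) = N +>\<^bsub>V\<^esub> (c \<odot>\<^bsub>V\<^esub> x)"
    by (rule SUP_eq_const[OF ne const])
  then show ?thesis
    by (simp add: quotient_alg_def FactRing_def ring.defs module.defs)
qed

lemma module_quotient_alg:
  assumes V: "module F V" and N: "submodule N F V"
  shows "module F (quotient_alg V N)"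
proof -
  interpret V: module F V by fact
  have ag: "abelian_group (quotient_alg V N)"
  proof (rule abelian_groupI, goal_cases)
    case (6 x)
    then obtain y where y: "x = N +>\<^bsub>V\<^esub> y" "y \<in> carrier V" by (auto simp: quotient_alg_simps)
    then have "(N +>\<^bsub>V\<^esub> (\<ominus>\<^bsub>V\<^esub> y)) \<oplus>\<^bsub>quotient_alg V N\<^esub> x = N"
      using coset_eq_self_iff[OF V N] submoduleD(2)[OF N]
      by (simp add: quotient_alg_add[OF V N] V.l_neg)
    then show ?case using y by (auto simp: quotient_alg_simps)
  next
    case (5 x)
    then obtain y where y: "x = N +>\<^bsub>V\<^esub> y" "y \<in> carrier V" by (auto simp: quotient_alg_simps)
    have "N = N +>\<^bsub>V\<^esub> \<zero>\<^bsub>V\<^esub>" using coset_eq_self_iff[OF V N V.zero_closed] submoduleD(2)[OF N] by metis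
    then show ?case using y quotient_alg_add[OF V N, of "\<zero>\<^bsub>V\<^esub>" y] by (auto simp: quotient_alg_simps)
  next
    case 2
    have "N = N +>\<^bsub>V\<^esub> \<zero>\<^bsub>V\<^esub>" using coset_eq_self_iff[OF V N V.zero_closed] submoduleD(2)[OF N] by metis
    then show ?case by (auto simp: quotient_alg_simps)
  qed (auto simp: quotient_alg_simps quotient_alg_add[OF V N] V.a_ac)
  show ?thesis
    by (intro moduleI ag V.R.is_cring)
      (auto simp: quotient_alg_simps quotient_alg_add[OF V N] quotient_alg_smult[OF V N]
        V.smult_l_distr V.smult_r_distr V.smult_assoc1)
qed

lemma coset_in_quotient: "x \<in> carrier V \<Longrightarrow> N +>\<^bsub>V\<^esub> x \<in> carrier (quotient_alg V N)"
  by (simp add: quotient_alg_simps)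

lemma coset_linear:
  assumes "module F V" "submodule N F V"
  shows "(\<lambda>x. N +>\<^bsub>V\<^esub> x) \<in> linear_maps F V (quotient_alg V N)"
  by (intro linear_mapsI) (auto simp: quotient_alg_simps quotient_alg_add[OF assms] quotient_alg_smult[OF assms])

text \<open>
  A linear map that kills \<open>N\<close> is constant on each coset of \<open>N\<close>.  The induced map is written with
  \<^const>\<open>the_elem\<close>, the form in which \<^const>\<open>tpow_lift\<close> is given.
\<close>

lemma quotient_lift:
  assumes V: "module F V" and N: "submodule N F V" and W: "module F W"
    and f: "f \<in> linear_maps F V W" and f0: "\<And>x. x \<in> N \<Longrightarrow> f x = \<zero>\<^bsub>W\<^esub>"
  defines "g \<equiv> \<lambda>K. the_elem (f ` K)"
  shows "g \<in> linear_maps F (quotient_alg V N) W"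
    and "\<And>x. x \<in> carrier V \<Longrightarrow> g (N +>\<^bsub>V\<^esub> x) = f x"
proof -
  interpret V: module F V by fact
  interpret W: module F W by fact
  note D = linear_mapsD[OF f]
  show *: "g (N +>\<^bsub>V\<^esub> x) = f x" if x: "x \<in> carrier V" for x
  proof -
    have fx: "f y = f x" if "y \<in> N +>\<^bsub>V\<^esub> x" for y
    proof -
      have y: "y \<in> carrier V" "y \<ominus>\<^bsub>V\<^esub> x \<in> N"
        using that mem_coset_iff[OF V N x] coset_eq_iff[OF V N _ x] by blast+
      have "f y \<ominus>\<^bsub>W\<^esub> f x = \<zero>\<^bsub>W\<^esub>"
        using f0[OF y(2)] linear_maps_zero_neg(3)[OF f V W y(1) x] by simp
      then show ?thesis using W.minus_eq_zero_iff D(1)[OF x] D(1)[OF y(1)] by simp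
    qed
    have "x \<in> N +>\<^bsub>V\<^esub> x" using mem_coset_iff[OF V N x] x by simp
    moreover have "f ` (N +>\<^bsub>V\<^esub> x) = (\<lambda>_. f x) ` (N +>\<^bsub>V\<^esub> x)"
      using fx by (rule image_cong[OF refl])
    ultimately have "f ` (N +>\<^bsub>V\<^esub> x) = {f x}" using image_constant by metis
    then show ?thesis by (simp add: g_def)
  qed
  show "g \<in> linear_maps F (quotient_alg V N) W"
    by (intro linear_mapsI)
      (auto simp: quotient_alg_simps quotient_alg_add[OF V N] quotient_alg_smult[OF V N] * D)
qed

lemma direct_sum_simps:
  "carrier (V \<boxplus> W) = carrier V \<times> carrier W"
  "\<zero>\<^bsub>V \<boxplus> W\<^esub> = (\<zero>\<^bsub>V\<^esub>, \<zero>\<^bsub>W\<^esub>)"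
  "(x, y) \<oplus>\<^bsub>V \<boxplus> W\<^esub> (x', y') = (x \<oplus>\<^bsub>V\<^esub> x', y \<oplus>\<^bsub>W\<^esub> y')"
  "c \<odot>\<^bsub>V \<boxplus> W\<^esub> (x, y) = (c \<odot>\<^bsub>V\<^esub> x, c \<odot>\<^bsub>W\<^esub> y)"
  "(x, y) \<otimes>\<^bsub>V \<boxplus> W\<^esub> (x', y') = (x \<otimes>\<^bsub>V\<^esub> x', y \<otimes>\<^bsub>W\<^esub> y')"
  by (auto simp: direct_sum_def RDirProd_def DirProd_def ring.defs module.defs monoid.defs)

lemma module_direct_sum:
  assumes "module F V" "module F W"
  shows "module F (V \<boxplus> W)"
proof -
  interpret V: module F V by fact
  interpret W: module F W by fact
  have "abelian_group (V \<boxplus> W)"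
  proof (rule abelian_groupI, goal_cases)
    case (6 x)
    then show ?case
      by (cases x) (auto simp: direct_sum_simps intro!: exI[of _ "\<ominus>\<^bsub>V\<^esub> fst x"] exI[of _ "\<ominus>\<^bsub>W\<^esub> snd x"] V.l_neg W.l_neg)
  qed (auto simp: direct_sum_simps V.a_ac W.a_ac)
  then show ?thesis
    by (intro moduleI V.R.is_cring)
      (auto simp: direct_sum_simps V.smult_l_distr V.smult_r_distr V.smult_assoc1
        W.smult_l_distr W.smult_r_distr W.smult_assoc1)
qed

lemma direct_sum_uminus:
  assumes "module F V" "module F W" "x \<in> carrier V" "y \<in> carrier W"
  shows "\<ominus>\<^bsub>V \<boxplus> W\<^esub> (x, y) = (\<ominus>\<^bsub>V\<^esub> x, \<ominus>\<^bsub>W\<^esub> y)"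
  using assms by (simp add: module_minus_smult[of F] module_direct_sum direct_sum_simps)

lemma direct_sum_minus:
  assumes "module F V" "module F W" "x \<in> carrier V" "y \<in> carrier W" "x' \<in> carrier V" "y' \<in> carrier W"
  shows "(x, y) \<ominus>\<^bsub>V \<boxplus> W\<^esub> (x', y') = (x \<ominus>\<^bsub>V\<^esub> x', y \<ominus>\<^bsub>W\<^esub> y')"
  using assms by (simp add: a_minus_def direct_sum_uminus direct_sum_simps)

lemma linear_maps_Pair:
  assumes "f \<in> linear_maps F U V" "g \<in> linear_maps F U W"
  shows "(\<lambda>x. (f x, g x)) \<in> linear_maps F U (V \<boxplus> W)"
  using assms by (intro linear_mapsI) (auto simp: direct_sum_simps linear_mapsD)

lemma linear_maps_fst: "fst \<in> linear_maps F (V \<boxplus> W) V"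
  by (intro linear_mapsI) (auto simp: direct_sum_simps)

lemma linear_maps_snd: "snd \<in> linear_maps F (V \<boxplus> W) W"
  by (intro linear_mapsI) (auto simp: direct_sum_simps)

section \<open>Free modules\<close>

lemma free_module_simps:
  "carrier (free_module F S) = {f. (\<forall>s. f s \<in> carrier F) \<and> (\<forall>s. s \<notin> S \<longrightarrow> f s = \<zero>\<^bsub>F\<^esub>) \<and> finite {s. f s \<noteq> \<zero>\<^bsub>F\<^esub>}}"
  "f \<oplus>\<^bsub>free_module F S\<^esub> g = (\<lambda>s. f s \<oplus>\<^bsub>F\<^esub> g s)"
  "c \<odot>\<^bsub>free_module F S\<^esub> f = (\<lambda>s. c \<otimes>\<^bsub>F\<^esub> f s)"
  "\<zero>\<^bsub>free_module F S\<^esub> = (\<lambda>s. \<zero>\<^bsub>F\<^esub>)"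
  "f \<otimes>\<^bsub>free_module F S\<^esub> g = (\<lambda>s. \<zero>\<^bsub>F\<^esub>)"
  by (auto simp: free_module_def)

lemma module_free_module:
  assumes "cring F"
  shows "module F (free_module F S)"
proof -
  interpret F: cring F by fact
  have fin: "finite {s. f s \<oplus>\<^bsub>F\<^esub> g s \<noteq> \<zero>\<^bsub>F\<^esub>}"
    if "finite {s. f s \<noteq> \<zero>\<^bsub>F\<^esub>}" "finite {s. g s \<noteq> \<zero>\<^bsub>F\<^esub>}" for f g
    by (rule finite_subset[OF _ finite_UnI[OF that]]) auto
  have "abelian_group (free_module F S)"
  proof (rule abelian_groupI, goal_cases)
    case (6 f)
    then show ?case
      by (intro bexI[of _ "\<lambda>s. \<ominus>\<^bsub>F\<^esub> f s"])
        (auto simp: free_module_simps F.l_neg elim!: finite_subset[rotated])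
  qed (auto simp: free_module_simps F.a_ac fin)
  moreover have fin2: "finite {s. c \<otimes>\<^bsub>F\<^esub> f s \<noteq> \<zero>\<^bsub>F\<^esub>}"
    if "finite {s. f s \<noteq> \<zero>\<^bsub>F\<^esub>}" "c \<in> carrier F" for f c
    by (rule finite_subset[OF _ that(1)]) (auto simp: that)
  ultimately show ?thesis
    by (intro moduleI assms)
      (auto simp: free_module_simps fin2 F.l_distr F.r_distr F.m_assoc)
qed

lemma free_gen_in_carrier:
  assumes "cring F" "s \<in> S"
  shows "free_gen F s \<in> carrier (free_module F S)"
proof -
  interpret F: cring F by fact
  show ?thesis using assms by (auto simp: free_module_simps free_gen_def)
qed

text \<open>
  By induction on a finite set that contains the support: a function is the sum of its value at one
  point times a generator and of the function with this value erased.
\<close>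

lemma free_module_spanned:
  assumes F: "cring F" and H: "submodule H F (free_module F S)" "\<And>s. s \<in> S \<Longrightarrow> free_gen F s \<in> H"
  shows "carrier (free_module F S) \<subseteq> H"
proof
  interpret F: cring F by fact
  note D = submoduleD[OF H(1)]
  fix f assume f: "f \<in> carrier (free_module F S)"
  have "finite T \<Longrightarrow> f \<in> carrier (free_module F S) \<Longrightarrow> {s. f s \<noteq> \<zero>\<^bsub>F\<^esub>} \<subseteq> T \<Longrightarrow> f \<in> H" for T
  proof (induction T arbitrary: f rule: finite_induct)
    case empty
    then have "f = \<zero>\<^bsub>free_module F S\<^esub>" by (auto simp: free_module_simps)
    then show ?case using D(2) by simp
  next
    case (insert t T)
    let ?g = "f(t := \<zero>\<^bsub>F\<^esub>)"
    have "finite {s. ?g s \<noteq> \<zero>\<^bsub>F\<^esub>}"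
      by (rule finite_subset[of _ "{s. f s \<noteq> \<zero>\<^bsub>F\<^esub>}"])
        (use insert.prems(1) in \<open>auto simp: free_module_simps split: if_splits\<close>)
    then have "?g \<in> carrier (free_module F S)"
      using insert.prems(1) by (auto simp: free_module_simps)
    moreover have "{s. ?g s \<noteq> \<zero>\<^bsub>F\<^esub>} \<subseteq> T"
      using insert.prems(2) by (auto split: if_splits)
    ultimately have g: "?g \<in> H" by (rule insert.IH)
    show ?case
    proof (cases "t \<in> S")
      case True
      have "f = f t \<odot>\<^bsub>free_module F S\<^esub> free_gen F t \<oplus>\<^bsub>free_module F S\<^esub> ?g"
        using insert.prems(1) by (auto simp: free_module_simps free_gen_def fun_eq_iff)
      moreover have "f t \<in> carrier F" using insert.prems(1) by (auto simp: free_module_simps)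
      ultimately show ?thesis using g D(3,4) H(2)[OF True] by metis
    next
      case False
      then have "?g = f" using insert.prems(1) by (auto simp: free_module_simps)
      then show ?thesis using g by simp
    qed
  qed
  then show "f \<in> H" using f by (auto simp: free_module_simps)
qed

text \<open>
  The universal property of the free module.  The sum over the support may be taken over any larger
  finite set, which allows the supports of two functions to be compared inside their union.
\<close>

lemma free_module_lift:
  assumes W: "module F W" and h_Pi: "h \<in> S \<rightarrow> carrier W"
  defines "g \<equiv> \<lambda>f. \<Oplus>\<^bsub>W\<^esub>s\<in>{s. f s \<noteq> \<zero>\<^bsub>F\<^esub>}. f s \<odot>\<^bsub>W\<^esub> h s"
  shows "g \<in> linear_maps F (free_module F S) W"
    and "\<And>s. s \<in> S \<Longrightarrow> g (free_gen F s) = h s"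
proof -
  interpret W: module F W by fact
  have h: "h s \<in> carrier W" if "s \<in> S" for s using h_Pi that by auto
  have cl: "f s \<odot>\<^bsub>W\<^esub> h s \<in> carrier W" if "f \<in> carrier (free_module F S)" "s \<in> S" for f s
    using that h by (auto simp: free_module_simps)
  have supp: "g f = (\<Oplus>\<^bsub>W\<^esub>s\<in>T. f s \<odot>\<^bsub>W\<^esub> h s)"
    if "f \<in> carrier (free_module F S)" "{s. f s \<noteq> \<zero>\<^bsub>F\<^esub>} \<subseteq> T" "finite T" "T \<subseteq> S" for f T
    unfolding g_def
    using that cl h by (intro W.add.finprod_mono_neutral_cong_left) auto
  have sub: "{s. f s \<noteq> \<zero>\<^bsub>F\<^esub>} \<subseteq> S" "finite {s. f s \<noteq> \<zero>\<^bsub>F\<^esub>}" if "f \<in> carrier (free_module F S)" for f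
    using that by (auto simp: free_module_simps)
  have M: "module F (free_module F S)" by (rule module_free_module) (rule W.R.is_cring)
  interpret M: module F "free_module F S" by fact
  show "g \<in> linear_maps F (free_module F S) W"
  proof (rule linear_mapsI)
    fix f assume f: "f \<in> carrier (free_module F S)"
    show "g f \<in> carrier W" unfolding g_def
      using cl[OF f] sub[OF f] by (intro W.finsum_closed) auto
    fix c assume c: "c \<in> carrier F"
    let ?T = "{s. f s \<noteq> \<zero>\<^bsub>F\<^esub>}"
    have "g (c \<odot>\<^bsub>free_module F S\<^esub> f) = (\<Oplus>\<^bsub>W\<^esub>s\<in>?T. (c \<odot>\<^bsub>free_module F S\<^esub> f) s \<odot>\<^bsub>W\<^esub> h s)"
      using c f sub[OF f] M.smult_closed[OF c f] by (intro supp) (auto simp: free_module_simps)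
    also have "\<dots> = (\<Oplus>\<^bsub>W\<^esub>s\<in>?T. c \<odot>\<^bsub>W\<^esub> (f s \<odot>\<^bsub>W\<^esub> h s))"
      using c f h sub(1)[OF f] cl
      by (intro W.finsum_cong') (auto simp: free_module_simps W.smult_assoc1 subset_eq)
    also have "\<dots> = c \<odot>\<^bsub>W\<^esub> g f" unfolding g_def
      using c cl[OF f] sub[OF f] by (subst W.finsum_smult_ldistr) auto
    finally show "g (c \<odot>\<^bsub>free_module F S\<^esub> f) = c \<odot>\<^bsub>W\<^esub> g f" .
  next
    fix f f' assume f: "f \<in> carrier (free_module F S)" and f': "f' \<in> carrier (free_module F S)"
    let ?T = "{s. f s \<noteq> \<zero>\<^bsub>F\<^esub>} \<union> {s. f' s \<noteq> \<zero>\<^bsub>F\<^esub>}"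
    have T: "finite ?T" "?T \<subseteq> S" using sub f f' by auto
    have "g (f \<oplus>\<^bsub>free_module F S\<^esub> f') = (\<Oplus>\<^bsub>W\<^esub>s\<in>?T. (f \<oplus>\<^bsub>free_module F S\<^esub> f') s \<odot>\<^bsub>W\<^esub> h s)"
      using T by (intro supp M.a_closed f f') (use f f' in \<open>auto simp: free_module_simps\<close>)
    also have "\<dots> = (\<Oplus>\<^bsub>W\<^esub>s\<in>?T. f s \<odot>\<^bsub>W\<^esub> h s \<oplus>\<^bsub>W\<^esub> f' s \<odot>\<^bsub>W\<^esub> h s)"
    proof (intro W.finsum_cong' refl)
      show "(\<lambda>s. f s \<odot>\<^bsub>W\<^esub> h s \<oplus>\<^bsub>W\<^esub> f' s \<odot>\<^bsub>W\<^esub> h s) \<in> ?T \<rightarrow> carrier W"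
        using cl[OF f] cl[OF f'] T(2) by blast
      fix s assume "s \<in> ?T"
      then have "h s \<in> carrier W" "f s \<in> carrier F" "f' s \<in> carrier F"
        using h T(2) f f' by (auto simp: free_module_simps)
      then show "(f \<oplus>\<^bsub>free_module F S\<^esub> f') s \<odot>\<^bsub>W\<^esub> h s = f s \<odot>\<^bsub>W\<^esub> h s \<oplus>\<^bsub>W\<^esub> f' s \<odot>\<^bsub>W\<^esub> h s"
        by (simp add: free_module_simps W.smult_l_distr)
    qed
    also have "\<dots> = (\<Oplus>\<^bsub>W\<^esub>s\<in>?T. f s \<odot>\<^bsub>W\<^esub> h s) \<oplus>\<^bsub>W\<^esub> (\<Oplus>\<^bsub>W\<^esub>s\<in>?T. f' s \<odot>\<^bsub>W\<^esub> h s)"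
      by (intro W.finsum_addf Pi_I cl f f') (use T in blast)+
    also have "\<dots> = g f \<oplus>\<^bsub>W\<^esub> g f'" using supp[OF f Un_upper1 T] supp[OF f' Un_upper2 T] by (simp only:)
    finally show "g (f \<oplus>\<^bsub>free_module F S\<^esub> f') = g f \<oplus>\<^bsub>W\<^esub> g f'" .
  qed
  show "g (free_gen F s) = h s" if s: "s \<in> S" for s
  \<comment> \<open>Over the zero ring the generators are zero, but so is every module.\<close>
  proof (cases "\<one>\<^bsub>F\<^esub> = \<zero>\<^bsub>F\<^esub>")
    case True
    have "h s = \<one>\<^bsub>F\<^esub> \<odot>\<^bsub>W\<^esub> h s" using h[OF s] by simp
    also have "\<dots> = \<zero>\<^bsub>W\<^esub>" using h[OF s] True by simp
    finally show ?thesis using True by (simp add: g_def free_gen_def)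
  next
    case False
    then have "{t. free_gen F s t \<noteq> \<zero>\<^bsub>F\<^esub>} = {s}" by (auto simp: free_gen_def)
    then show ?thesis using h s by (simp add: g_def free_gen_def)
  qed
qed

section \<open>Modules given by generators and relations\<close>

lemma module_is_cring: "module F V \<Longrightarrow> cring F"
  by (rule module.axioms(1))

text \<open>
  Tensor products and tensor powers are both quotients of a free module by the span of a set of
  relators.  What follows is proved once for all such quotients.
\<close>

lemma
  assumes F: "cring F" and R: "R \<subseteq> carrier (free_module F S)"
  defines "P \<equiv> quotient_alg (free_module F S) (linear_span F (free_module F S) R)"
    and "gen \<equiv> \<lambda>s. linear_span F (free_module F S) R +>\<^bsub>free_module F S\<^esub> free_gen F s"
  shows module_presented: "module F P"
    and presented_gen_closed: "\<And>s. s \<in> S \<Longrightarrow> gen s \<in> carrier P"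
    and presented_spanned: "\<And>H. \<lbrakk>submodule H F P; \<And>s. s \<in> S \<Longrightarrow> gen s \<in> H\<rbrakk> \<Longrightarrow> carrier P \<subseteq> H"
    and presented_coset_linear:
      "(\<lambda>x. linear_span F (free_module F S) R +>\<^bsub>free_module F S\<^esub> x) \<in> linear_maps F (free_module F S) P"
    and presented_rel: "\<And>r. r \<in> R \<Longrightarrow>
      linear_span F (free_module F S) R +>\<^bsub>free_module F S\<^esub> r = \<zero>\<^bsub>P\<^esub>"
proof -
  have A: "module F (free_module F S)" using F by (rule module_free_module)
  have N: "submodule (linear_span F (free_module F S) R) F (free_module F S)"
    using A R by (rule linear_span_submodule)
  show P: "module F P" unfolding P_def by (rule module_quotient_alg[OF A N])
  show "gen s \<in> carrier P" if "s \<in> S" for s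
    unfolding gen_def P_def by (intro coset_in_quotient free_gen_in_carrier F that)
  show L: "(\<lambda>x. linear_span F (free_module F S) R +>\<^bsub>free_module F S\<^esub> x) \<in> linear_maps F (free_module F S) P"
    unfolding P_def by (rule coset_linear[OF A N])
  show "linear_span F (free_module F S) R +>\<^bsub>free_module F S\<^esub> r = \<zero>\<^bsub>P\<^esub>" if "r \<in> R" for r
    using coset_eq_self_iff[OF A N, of r] that R linear_span_superset[of R F "free_module F S"]
    by (auto simp: P_def quotient_alg_simps)
  show "carrier P \<subseteq> H" if "submodule H F P" "\<And>s. s \<in> S \<Longrightarrow> gen s \<in> H" for H
  proof -
    let ?q = "\<lambda>x. linear_span F (free_module F S) R +>\<^bsub>free_module F S\<^esub> x"
    have "carrier (free_module F S) \<subseteq> {x \<in> carrier (free_module F S). ?q x \<in> H}"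
      by (rule free_module_spanned[OF F submodule_preimage[OF L A P that(1)]])
        (use that(2) free_gen_in_carrier[OF F] in \<open>simp add: gen_def\<close>)
    then show ?thesis by (auto simp: P_def quotient_alg_simps)
  qed
qed

text \<open>
  The relators are combinations of generators, so they can be evaluated under any linear extension
  of \<open>h\<close>.  For this reason the hypothesis on the relators speaks of every such extension instead of
  the formula for it.
\<close>

lemma presented_lift:
  assumes W: "module F W" and R: "R \<subseteq> carrier (free_module F S)"
    and h: "h \<in> S \<rightarrow> carrier W"
    and rel: "\<forall>g\<in>linear_maps F (free_module F S) W. (\<forall>s\<in>S. g (free_gen F s) = h s) \<longrightarrow> (\<forall>r\<in>R. g r = \<zero>\<^bsub>W\<^esub>)"
  defines "N \<equiv> linear_span F (free_module F S) R"
    and "g \<equiv> \<lambda>K. the_elem ((\<lambda>f. \<Oplus>\<^bsub>W\<^esub>s\<in>{s. f s \<noteq> \<zero>\<^bsub>F\<^esub>}. f s \<odot>\<^bsub>W\<^esub> h s) ` K)"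
  shows "g \<in> linear_maps F (quotient_alg (free_module F S) N) W"
    and "\<And>s. s \<in> S \<Longrightarrow> g (N +>\<^bsub>free_module F S\<^esub> free_gen F s) = h s"
proof -
  note F = module_is_cring[OF W]
  have A: "module F (free_module F S)" using F by (rule module_free_module)
  have N: "submodule N F (free_module F S)"
    unfolding N_def using A R by (rule linear_span_submodule)
  note L = free_module_lift[OF W h]
  have 0: "(\<Oplus>\<^bsub>W\<^esub>s\<in>{s. f s \<noteq> \<zero>\<^bsub>F\<^esub>}. f s \<odot>\<^bsub>W\<^esub> h s) = \<zero>\<^bsub>W\<^esub>" if "f \<in> N" for f
    by (rule linear_map_vanishes_on_span[OF L(1) A W R rel[rule_format, OF L]]) (use that in \<open>simp_all add: N_def\<close>)
  show "g \<in> linear_maps F (quotient_alg (free_module F S) N) W"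
    unfolding g_def by (rule quotient_lift(1)[OF A N W L(1) 0])
  show "g (N +>\<^bsub>free_module F S\<^esub> free_gen F s) = h s" if "s \<in> S" for s
    unfolding g_def using quotient_lift(2)[OF A N W L(1) 0 free_gen_in_carrier[OF F that]] L(2)[OF that]
    by simp
qed

section \<open>Tensor products\<close>

definition bilinear_maps ::
    "('f, 'r) ring_scheme \<Rightarrow> ('f, 'v, 'm) module_scheme \<Rightarrow> ('f, 'w, 'n) module_scheme
      \<Rightarrow> ('f, 'u, 'k) module_scheme \<Rightarrow> ('v \<Rightarrow> 'w \<Rightarrow> 'u) set"
  where "bilinear_maps F V W U = {f.
    (\<forall>w\<in>carrier W. (\<lambda>v. f v w) \<in> linear_maps F V U) \<and> (\<forall>v\<in>carrier V. f v \<in> linear_maps F W U)}"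

lemma bilinear_mapsI:
  assumes "\<And>w. w \<in> carrier W \<Longrightarrow> (\<lambda>v. f v w) \<in> linear_maps F V U"
    and "\<And>v. v \<in> carrier V \<Longrightarrow> (\<lambda>w. f v w) \<in> linear_maps F W U"
  shows "f \<in> bilinear_maps F V W U"
  using assms by (simp add: bilinear_maps_def)

lemma bilinear_mapsD:
  assumes "f \<in> bilinear_maps F V W U"
  shows "w \<in> carrier W \<Longrightarrow> (\<lambda>v. f v w) \<in> linear_maps F V U"
    and "v \<in> carrier V \<Longrightarrow> (\<lambda>w. f v w) \<in> linear_maps F W U"
    and "\<lbrakk>v \<in> carrier V; w \<in> carrier W\<rbrakk> \<Longrightarrow> f v w \<in> carrier U"
  using assms by (auto simp: bilinear_maps_def linear_mapsD)

text \<open>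
  The set whose span is \<^const>\<open>tensor_rels\<close>: a linear map on the free module need only be tested on it.
\<close>

definition tensor_relators ::
    "('f, 'r) ring_scheme \<Rightarrow> ('f, 'v, 'm) module_scheme \<Rightarrow> ('f, 'w, 'n) module_scheme
      \<Rightarrow> ('v \<times> 'w \<Rightarrow> 'f) set"
  where "tensor_relators F V W =
    (let A = free_module F (carrier V \<times> carrier W); e = free_gen F in
      ({e (v \<oplus>\<^bsub>V\<^esub> v', w) \<ominus>\<^bsub>A\<^esub> (e (v, w) \<oplus>\<^bsub>A\<^esub> e (v', w)) | v v' w.
          v \<in> carrier V \<and> v' \<in> carrier V \<and> w \<in> carrier W} \<union>
       {e (v, w \<oplus>\<^bsub>W\<^esub> w') \<ominus>\<^bsub>A\<^esub> (e (v, w) \<oplus>\<^bsub>A\<^esub> e (v, w')) | v w w'.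
          v \<in> carrier V \<and> w \<in> carrier W \<and> w' \<in> carrier W} \<union>
       {e (c \<odot>\<^bsub>V\<^esub> v, w) \<ominus>\<^bsub>A\<^esub> (c \<odot>\<^bsub>A\<^esub> e (v, w)) | c v w.
          c \<in> carrier F \<and> v \<in> carrier V \<and> w \<in> carrier W} \<union>
       {e (v, c \<odot>\<^bsub>W\<^esub> w) \<ominus>\<^bsub>A\<^esub> (c \<odot>\<^bsub>A\<^esub> e (v, w)) | c v w.
          c \<in> carrier F \<and> v \<in> carrier V \<and> w \<in> carrier W}))"

lemma tensor_rels_eq_span:
  "tensor_rels F V W = linear_span F (free_module F (carrier V \<times> carrier W)) (tensor_relators F V W)"
  by (simp add: tensor_rels_def tensor_relators_def Let_def)

context
  fixes F :: "('f, 'r) ring_scheme" and V :: "('f, 'v, 'm) module_scheme"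
    and W :: "('f, 'w, 'n) module_scheme"
  assumes V: "module F V" and W: "module F W"
begin

interpretation V: module F V by (rule V)
interpretation W: module F W by (rule W)
interpretation A: module F "free_module F (carrier V \<times> carrier W)"
  by (rule module_free_module) (rule V.R.is_cring)

lemma tensor_relators_subset: "tensor_relators F V W \<subseteq> carrier (free_module F (carrier V \<times> carrier W))"
proof -
  have [simp]: "free_gen F (v, w) \<in> carrier (free_module F (carrier V \<times> carrier W))"
    if "v \<in> carrier V" "w \<in> carrier W" for v w
    using that by (intro free_gen_in_carrier V.R.is_cring) auto
  show ?thesis by (auto simp: tensor_relators_def Let_def)
qed

lemma module_tensor: "module F (tensor F V W)"
  unfolding tensor_def tensor_rels_eq_span
  by (rule module_presented[OF V.R.is_cring tensor_relators_subset])

lemma tensor_spanned: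
  assumes "submodule H F (tensor F V W)"
    "\<And>v w. \<lbrakk>v \<in> carrier V; w \<in> carrier W\<rbrakk> \<Longrightarrow> pure_tensor F V W v w \<in> H"
  shows "carrier (tensor F V W) \<subseteq> H"
  using presented_spanned[OF V.R.is_cring tensor_relators_subset] assms
  unfolding tensor_def pure_tensor_def tensor_rels_eq_span by blast

lemma pure_tensor_bilinear: "pure_tensor F V W \<in> bilinear_maps F V W (tensor F V W)"
proof -
  let ?A = "free_module F (carrier V \<times> carrier W)"
  let ?q = "\<lambda>x. linear_span F ?A (tensor_relators F V W) +>\<^bsub>?A\<^esub> x"
  note C = V.R.is_cring tensor_relators_subset
  have q: "?q \<in> linear_maps F ?A (tensor F V W)"
    unfolding tensor_def tensor_rels_eq_span by (rule presented_coset_linear[OF C])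
  have pt: "pure_tensor F V W v w = ?q (free_gen F (v, w))" for v w
    by (simp add: pure_tensor_def tensor_rels_eq_span)
  interpret T: module F "tensor F V W" by (rule module_tensor)
  have e [simp]: "free_gen F (v, w) \<in> carrier (free_module F (carrier V \<times> carrier W))"
    if "v \<in> carrier V" "w \<in> carrier W" for v w
    using that by (intro free_gen_in_carrier V.R.is_cring) auto
  have closed: "?q (free_gen F (v, w)) \<in> carrier (tensor F V W)" if "v \<in> carrier V" "w \<in> carrier W" for v w
    using that by (intro linear_mapsD(1)[OF q]) simp
  have eq: "?q a = ?q b" if "a \<in> carrier ?A" "b \<in> carrier ?A" "a \<ominus>\<^bsub>?A\<^esub> b \<in> tensor_relators F V W" for a b
  proof -
    have "?q (a \<ominus>\<^bsub>?A\<^esub> b) = \<zero>\<^bsub>tensor F V W\<^esub>"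
      unfolding tensor_def tensor_rels_eq_span by (rule presented_rel[OF C that(3)])
    then have "?q a \<ominus>\<^bsub>tensor F V W\<^esub> ?q b = \<zero>\<^bsub>tensor F V W\<^esub>"
      using linear_maps_zero_neg(3)[OF q A.module_axioms T.module_axioms that(1,2)] by simp
    then show ?thesis
      using linear_mapsD(1)[OF q that(1)] linear_mapsD(1)[OF q that(2)]
      by (simp add: T.minus_eq_zero_iff)
  qed
  show ?thesis
  proof (intro bilinear_mapsI linear_mapsI, unfold pt)
    fix v w v' assume v: "v \<in> carrier V" "v' \<in> carrier V" "w \<in> carrier W"
    have "?q (free_gen F (v \<oplus>\<^bsub>V\<^esub> v', w)) = ?q (free_gen F (v, w) \<oplus>\<^bsub>?A\<^esub> free_gen F (v', w))"
      by (rule eq) (use v in \<open>auto simp: tensor_relators_def Let_def\<close>)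
    then show "?q (free_gen F (v \<oplus>\<^bsub>V\<^esub> v', w)) = ?q (free_gen F (v, w)) \<oplus>\<^bsub>tensor F V W\<^esub> ?q (free_gen F (v', w))"
      using linear_mapsD(2)[OF q] v by simp
  next
    fix v w w' assume v: "v \<in> carrier V" "w \<in> carrier W" "w' \<in> carrier W"
    have "?q (free_gen F (v, w \<oplus>\<^bsub>W\<^esub> w')) = ?q (free_gen F (v, w) \<oplus>\<^bsub>?A\<^esub> free_gen F (v, w'))"
      by (rule eq) (use v in \<open>auto simp: tensor_relators_def Let_def\<close>)
    then show "?q (free_gen F (v, w \<oplus>\<^bsub>W\<^esub> w')) = ?q (free_gen F (v, w)) \<oplus>\<^bsub>tensor F V W\<^esub> ?q (free_gen F (v, w'))"
      using linear_mapsD(2)[OF q] v by simp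
  next
    fix v w c assume v: "v \<in> carrier V" "w \<in> carrier W" "c \<in> carrier F"
    have "?q (free_gen F (c \<odot>\<^bsub>V\<^esub> v, w)) = ?q (c \<odot>\<^bsub>?A\<^esub> free_gen F (v, w))"
      by (rule eq) (use v in \<open>auto simp: tensor_relators_def Let_def\<close>)
    then show "?q (free_gen F (c \<odot>\<^bsub>V\<^esub> v, w)) = c \<odot>\<^bsub>tensor F V W\<^esub> ?q (free_gen F (v, w))"
      using linear_mapsD(3)[OF q] v by simp
    have "?q (free_gen F (v, c \<odot>\<^bsub>W\<^esub> w)) = ?q (c \<odot>\<^bsub>?A\<^esub> free_gen F (v, w))"
      by (rule eq) (use v in \<open>auto simp: tensor_relators_def Let_def\<close>)
    then show "?q (free_gen F (v, c \<odot>\<^bsub>W\<^esub> w)) = c \<odot>\<^bsub>tensor F V W\<^esub> ?q (free_gen F (v, w))"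
      using linear_mapsD(3)[OF q] v by simp
  qed (use closed in auto)
qed

lemma tensor_lift:
  assumes U: "module F U" and f: "f \<in> bilinear_maps F V W U"
  obtains g where "g \<in> linear_maps F (tensor F V W) U"
    "\<And>v w. \<lbrakk>v \<in> carrier V; w \<in> carrier W\<rbrakk> \<Longrightarrow> g (pure_tensor F V W v w) = f v w"
proof -
  interpret U: module F U by (rule U)
  let ?A = "free_module F (carrier V \<times> carrier W)"
  note f1 = linear_mapsD[OF bilinear_mapsD(1)[OF f]] and f2 = linear_mapsD[OF bilinear_mapsD(2)[OF f]]
  have e [simp]: "free_gen F (v, w) \<in> carrier (free_module F (carrier V \<times> carrier W))"
    if "v \<in> carrier V" "w \<in> carrier W" for v w
    using that by (intro free_gen_in_carrier V.R.is_cring) auto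
  have rel: "g r = \<zero>\<^bsub>U\<^esub>" if g: "g \<in> linear_maps F ?A U"
    "\<And>s. s \<in> carrier V \<times> carrier W \<Longrightarrow> g (free_gen F s) = (case s of (v, w) \<Rightarrow> f v w)"
    "r \<in> tensor_relators F V W" for g r
  proof -
    have ge: "g (free_gen F (v, w)) = f v w" if "v \<in> carrier V" "w \<in> carrier W" for v w
      using g(2)[of "(v, w)"] that by simp
    show ?thesis
      using g(3) linear_maps_zero_neg(3)[OF g(1) A.module_axioms U] linear_mapsD[OF g(1)]
      by (auto simp: tensor_relators_def Let_def ge f1 f2 U.minus_eq_zero_iff)
  qed
  have c: "(\<lambda>(v, w). f v w) \<in> carrier V \<times> carrier W \<rightarrow> carrier U"
    using f1(1) by auto
  have rel': "\<forall>g\<in>linear_maps F ?A U.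
      (\<forall>s\<in>carrier V \<times> carrier W. g (free_gen F s) = (case s of (v, w) \<Rightarrow> f v w)) \<longrightarrow>
      (\<forall>r\<in>tensor_relators F V W. g r = \<zero>\<^bsub>U\<^esub>)"
    using rel by blast
  note L = presented_lift[OF U tensor_relators_subset c rel']
  show ?thesis
  proof (rule that, unfold tensor_def pure_tensor_def tensor_rels_eq_span)
    fix v w assume "v \<in> carrier V" "w \<in> carrier W"
    then have "(v, w) \<in> carrier V \<times> carrier W" by simp
    from L(2)[OF this] show "the_elem ((\<lambda>fa. \<Oplus>\<^bsub>U\<^esub>s\<in>{s. fa s \<noteq> \<zero>\<^bsub>F\<^esub>}. fa s \<odot>\<^bsub>U\<^esub> (case s of (v, w) \<Rightarrow> f v w)) `
          (linear_span F ?A (tensor_relators F V W) +>\<^bsub>?A\<^esub> free_gen F (v, w))) = f v w"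
      by simp
  qed (rule L(1))
qed

end

section \<open>Tensor powers\<close>

text \<open>
  Linearity in each slot is expressed by freezing the letters before and after it.  In degree \<open>0\<close>
  there is no slot, and the first condition is what makes the value lie in \<open>W\<close>.
\<close>

definition multilinear_maps ::
    "('f, 'r) ring_scheme \<Rightarrow> ('f, 'v, 'm) module_scheme \<Rightarrow> int \<Rightarrow> ('f, 'w, 'n) module_scheme
      \<Rightarrow> ('v list \<Rightarrow> 'w) set"
  where "multilinear_maps F V n W = {h \<in> tpow_words V n \<rightarrow> carrier W.
    \<forall>xs ys. set xs \<subseteq> carrier V \<and> set ys \<subseteq> carrier V \<and> int (length xs + length ys + 1) = n
      \<longrightarrow> (\<lambda>x. h (xs @ x # ys)) \<in> linear_maps F V W}"

lemma multilinear_mapsD: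
  assumes "h \<in> multilinear_maps F V n W"
  shows "xs \<in> tpow_words V n \<Longrightarrow> h xs \<in> carrier W"
    and "\<lbrakk>set xs \<subseteq> carrier V; set ys \<subseteq> carrier V; int (length xs + length ys + 1) = n\<rbrakk>
      \<Longrightarrow> (\<lambda>x. h (xs @ x # ys)) \<in> linear_maps F V W"
  using assms by (auto simp: multilinear_maps_def)

definition tpow_relators ::
    "('f, 'r) ring_scheme \<Rightarrow> ('f, 'v, 'm) module_scheme \<Rightarrow> int \<Rightarrow> ('v list \<Rightarrow> 'f) set"
  where "tpow_relators F V n =
    (let A = free_module F (tpow_words V n); e = free_gen F in
      ({e (xs @ (x \<oplus>\<^bsub>V\<^esub> y) # ys) \<ominus>\<^bsub>A\<^esub> (e (xs @ x # ys) \<oplus>\<^bsub>A\<^esub> e (xs @ y # ys)) | xs x y ys.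
          xs @ x # ys \<in> tpow_words V n \<and> y \<in> carrier V} \<union>
       {e (xs @ (c \<odot>\<^bsub>V\<^esub> x) # ys) \<ominus>\<^bsub>A\<^esub> (c \<odot>\<^bsub>A\<^esub> e (xs @ x # ys)) | xs c x ys.
          xs @ x # ys \<in> tpow_words V n \<and> c \<in> carrier F}))"

lemma tpow_rels_eq_span:
  "tpow_rels F V n = linear_span F (free_module F (tpow_words V n)) (tpow_relators F V n)"
  by (simp add: tpow_rels_def tpow_relators_def Let_def)

lemma mem_tpow_words: "xs \<in> tpow_words V n \<longleftrightarrow> set xs \<subseteq> carrier V \<and> int (length xs) = n"
  by (simp add: tpow_words_def)

context
  fixes F :: "('f, 'r) ring_scheme" and V :: "('f, 'v, 'm) module_scheme"
  assumes V: "module F V"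
begin

interpretation V: module F V by (rule V)

private lemma A: "module F (free_module F (tpow_words V n))"
  by (rule module_free_module) (rule V.R.is_cring)

private lemma e: "xs \<in> tpow_words V n \<Longrightarrow> free_gen F xs \<in> carrier (free_module F (tpow_words V n))"
  by (intro free_gen_in_carrier V.R.is_cring) auto

lemma tpow_relators_subset: "tpow_relators F V n \<subseteq> carrier (free_module F (tpow_words V n))"
proof -
  interpret A: module F "free_module F (tpow_words V n)" by (rule A)
  show ?thesis
    by (auto simp: tpow_relators_def Let_def intro!: A.minus_closed A.M.a_closed A.smult_closed e)
      (auto simp: mem_tpow_words)
qed

lemma module_tpow: "module F (tpow F V n)"
  unfolding tpow_def tpow_rels_eq_span
  by (rule module_presented[OF V.R.is_cring tpow_relators_subset])

lemma tpow_pure_eq: "xs \<in> tpow_words V n \<Longrightarrow> tpow_pure F V xs =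
    linear_span F (free_module F (tpow_words V n)) (tpow_relators F V n) +>\<^bsub>free_module F (tpow_words V n)\<^esub> free_gen F xs"
  by (simp add: tpow_pure_def tpow_rels_eq_span mem_tpow_words)

lemma tpow_spanned:
  assumes "submodule H F (tpow F V n)" "\<And>xs. xs \<in> tpow_words V n \<Longrightarrow> tpow_pure F V xs \<in> H"
  shows "carrier (tpow F V n) \<subseteq> H"
  using presented_spanned[OF V.R.is_cring tpow_relators_subset, of H n] assms
  unfolding tpow_def tpow_rels_eq_span by (simp add: tpow_pure_eq)

text \<open>
  A linear map on a tensor power is determined by its values on pure tensors.
\<close>

lemma tpow_maps_eqI:
  assumes "module F W" "f \<in> linear_maps F (tpow F V n) W" "g \<in> linear_maps F (tpow F V n) W"
    "\<And>xs. xs \<in> tpow_words V n \<Longrightarrow> f (tpow_pure F V xs) = g (tpow_pure F V xs)"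
    "t \<in> carrier (tpow F V n)"
  shows "f t = g t"
proof -
  have "tpow_pure F V xs \<in> carrier (tpow F V n)" if "xs \<in> tpow_words V n" for xs
    unfolding tpow_def tpow_rels_eq_span tpow_pure_eq[OF that]
    by (rule presented_gen_closed[OF V.R.is_cring tpow_relators_subset that])
  then show ?thesis
    using tpow_spanned[OF submodule_equalizer[OF assms(2,3) module_tpow assms(1)]] assms(4,5) by auto
qed

lemma tpow_pure_multilinear: "tpow_pure F V \<in> multilinear_maps F V n (tpow F V n)"
proof -
  let ?A = "free_module F (tpow_words V n)"
  let ?q = "\<lambda>x. linear_span F ?A (tpow_relators F V n) +>\<^bsub>?A\<^esub> x"
  note C = V.R.is_cring tpow_relators_subset
  interpret A: module F ?A by (rule A)
  interpret T: module F "tpow F V n" by (rule module_tpow)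
  have q: "?q \<in> linear_maps F ?A (tpow F V n)"
    unfolding tpow_def tpow_rels_eq_span by (rule presented_coset_linear[OF C])
  have closed: "tpow_pure F V xs \<in> carrier (tpow F V n)" if "xs \<in> tpow_words V n" for xs
    unfolding tpow_pure_eq[OF that] by (rule linear_mapsD(1)[OF q e[OF that]])
  have eq: "?q a = ?q b" if "a \<in> carrier ?A" "b \<in> carrier ?A" "a \<ominus>\<^bsub>?A\<^esub> b \<in> tpow_relators F V n" for a b
  proof -
    have "?q (a \<ominus>\<^bsub>?A\<^esub> b) = \<zero>\<^bsub>tpow F V n\<^esub>"
      unfolding tpow_def tpow_rels_eq_span by (rule presented_rel[OF C that(3)])
    then have "?q a \<ominus>\<^bsub>tpow F V n\<^esub> ?q b = \<zero>\<^bsub>tpow F V n\<^esub>"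
      using linear_maps_zero_neg(3)[OF q A.module_axioms T.module_axioms that(1,2)] by simp
    then show ?thesis
      using linear_mapsD(1)[OF q that(1)] linear_mapsD(1)[OF q that(2)]
      by (simp add: T.minus_eq_zero_iff)
  qed
  have "(\<lambda>x. tpow_pure F V (xs @ x # ys)) \<in> linear_maps F V (tpow F V n)"
    if xy: "set xs \<subseteq> carrier V" "set ys \<subseteq> carrier V" "int (length xs + length ys + 1) = n" for xs ys
  proof (rule linear_mapsI)
    have w: "xs @ x # ys \<in> tpow_words V n" if "x \<in> carrier V" for x
      using xy that by (auto simp: mem_tpow_words)
    show "tpow_pure F V (xs @ x # ys) \<in> carrier (tpow F V n)" if "x \<in> carrier V" for x
      using w[OF that] by (rule closed)
    fix x assume x: "x \<in> carrier V"
    show "tpow_pure F V (xs @ (x \<oplus>\<^bsub>V\<^esub> y) # ys) =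
        tpow_pure F V (xs @ x # ys) \<oplus>\<^bsub>tpow F V n\<^esub> tpow_pure F V (xs @ y # ys)" if y: "y \<in> carrier V" for y
    proof -
      have "?q (free_gen F (xs @ (x \<oplus>\<^bsub>V\<^esub> y) # ys)) =
          ?q (free_gen F (xs @ x # ys) \<oplus>\<^bsub>?A\<^esub> free_gen F (xs @ y # ys))"
        using x y w[OF x] by (intro eq A.a_closed e w V.a_closed) (auto simp: tpow_relators_def Let_def)
      then show ?thesis
        using linear_mapsD(2)[OF q e[OF w[OF x]] e[OF w[OF y]]] tpow_pure_eq[OF w] x y by simp
    qed
    show "tpow_pure F V (xs @ (c \<odot>\<^bsub>V\<^esub> x) # ys) = c \<odot>\<^bsub>tpow F V n\<^esub> tpow_pure F V (xs @ x # ys)"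
      if c: "c \<in> carrier F" for c
    proof -
      have "?q (free_gen F (xs @ (c \<odot>\<^bsub>V\<^esub> x) # ys)) = ?q (c \<odot>\<^bsub>?A\<^esub> free_gen F (xs @ x # ys))"
        using x c w[OF x] by (intro eq A.smult_closed e w V.smult_closed) (auto simp: tpow_relators_def Let_def)
      then show ?thesis
        using linear_mapsD(3)[OF q c e[OF w[OF x]]] tpow_pure_eq[OF w] x c by simp
    qed
  qed
  then show ?thesis unfolding multilinear_maps_def using closed by auto
qed

lemma tpow_pure_closed: "xs \<in> tpow_words V n \<Longrightarrow> tpow_pure F V xs \<in> carrier (tpow F V n)"
  by (rule multilinear_mapsD(1)[OF tpow_pure_multilinear])

lemma tpow_lift:
  assumes W: "module F W" and h: "h \<in> multilinear_maps F V n W"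
  shows "tpow_lift W F h \<in> linear_maps F (tpow F V n) W"
    and "\<And>xs. xs \<in> tpow_words V n \<Longrightarrow> tpow_lift W F h (tpow_pure F V xs) = h xs"
proof -
  interpret W: module F W by (rule W)
  let ?A = "free_module F (tpow_words V n)"
  interpret A: module F ?A by (rule A)
  have h1: "h \<in> tpow_words V n \<rightarrow> carrier W" using h by (simp add: multilinear_maps_def)
  have rel: "g r = \<zero>\<^bsub>W\<^esub>" if g: "g \<in> linear_maps F ?A W"
    "\<And>xs. xs \<in> tpow_words V n \<Longrightarrow> g (free_gen F xs) = h xs"
    "r \<in> tpow_relators F V n" for g r
  proof -
    have diff: "g (a \<ominus>\<^bsub>?A\<^esub> b) = \<zero>\<^bsub>W\<^esub>" if "a \<in> carrier ?A" "b \<in> carrier ?A" "g a = g b" for a b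
      using linear_maps_zero_neg(3)[OF g(1) A W that(1,2)] linear_mapsD(1)[OF g(1)] that
      by (simp add: W.minus_eq_zero_iff)
    consider xs x y ys where
        "r = free_gen F (xs @ (x \<oplus>\<^bsub>V\<^esub> y) # ys) \<ominus>\<^bsub>?A\<^esub> (free_gen F (xs @ x # ys) \<oplus>\<^bsub>?A\<^esub> free_gen F (xs @ y # ys))"
        "xs @ x # ys \<in> tpow_words V n" "y \<in> carrier V"
      | xs c x ys where
        "r = free_gen F (xs @ (c \<odot>\<^bsub>V\<^esub> x) # ys) \<ominus>\<^bsub>?A\<^esub> (c \<odot>\<^bsub>?A\<^esub> free_gen F (xs @ x # ys))"
        "xs @ x # ys \<in> tpow_words V n" "c \<in> carrier F"
      using g(3) by (auto simp: tpow_relators_def Let_def)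
    then show ?thesis
    proof cases
      case 1
      have w: "xs @ z # ys \<in> tpow_words V n" if "z \<in> carrier V" for z
        using 1(2) that by (simp add: mem_tpow_words)
      have L: "(\<lambda>z. h (xs @ z # ys)) \<in> linear_maps F V W" and x: "x \<in> carrier V"
        using 1(2) by (auto simp: mem_tpow_words intro: multilinear_mapsD(2)[OF h])
      show ?thesis unfolding 1(1)
        using x 1(3) linear_mapsD(2)[OF L] linear_mapsD(2)[OF g(1)]
        by (intro diff A.a_closed e w V.a_closed) (simp_all add: e g(2) w)
    next
      case 2
      have w: "xs @ z # ys \<in> tpow_words V n" if "z \<in> carrier V" for z
        using 2(2) that by (simp add: mem_tpow_words)
      have L: "(\<lambda>z. h (xs @ z # ys)) \<in> linear_maps F V W" and x: "x \<in> carrier V"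
        using 2(2) by (auto simp: mem_tpow_words intro: multilinear_mapsD(2)[OF h])
      show ?thesis unfolding 2(1)
        using x 2(3) linear_mapsD(3)[OF L] linear_mapsD(3)[OF g(1)]
        by (intro diff A.smult_closed e w V.smult_closed) (simp_all add: e g(2) w)
    qed
  qed
  then have rel': "\<forall>g\<in>linear_maps F ?A W. (\<forall>s\<in>tpow_words V n. g (free_gen F s) = h s) \<longrightarrow>
      (\<forall>r\<in>tpow_relators F V n. g r = \<zero>\<^bsub>W\<^esub>)" by blast
  note L = presented_lift[OF W tpow_relators_subset h1 rel']
  have tl: "tpow_lift W F h = (\<lambda>K. the_elem ((\<lambda>f. \<Oplus>\<^bsub>W\<^esub>s\<in>{s. f s \<noteq> \<zero>\<^bsub>F\<^esub>}. f s \<odot>\<^bsub>W\<^esub> h s) ` K))"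
    by (rule ext) (simp add: tpow_lift_def)
  show "tpow_lift W F h \<in> linear_maps F (tpow F V n) W"
    unfolding tl tpow_def tpow_rels_eq_span by (rule L(1))
  show "tpow_lift W F h (tpow_pure F V xs) = h xs" if "xs \<in> tpow_words V n" for xs
    unfolding tl tpow_pure_eq[OF that] by (rule L(2)[OF that])
qed

end

section \<open>Leibniz algebras: quotients, sums, homomorphisms\<close>

lemma leibniz_algebra_module: "leibniz_algebra F L \<Longrightarrow> module F L"
  by (simp add: leibniz_algebra_def)

text \<open>
  The product of two cosets is defined as a union over all representatives; it is a single coset as
  soon as the class of the product does not depend on them.
\<close>

lemma quotient_alg_mult:
  assumes V: "module F V" and N: "submodule N F V" and x: "x \<in> carrier V" and y: "y \<in> carrier V"
    and cong: "\<And>a b. \<lbrakk>a \<in> carrier V; b \<in> carrier V; a \<ominus>\<^bsub>V\<^esub> x \<in> N; b \<ominus>\<^bsub>V\<^esub> y \<in> N\<rbrakk>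
      \<Longrightarrow> N +>\<^bsub>V\<^esub> (a \<otimes>\<^bsub>V\<^esub> b) = N +>\<^bsub>V\<^esub> (x \<otimes>\<^bsub>V\<^esub> y)"
  shows "(N +>\<^bsub>V\<^esub> x) \<otimes>\<^bsub>quotient_alg V N\<^esub> (N +>\<^bsub>V\<^esub> y) = N +>\<^bsub>V\<^esub> (x \<otimes>\<^bsub>V\<^esub> y)"
proof -
  have ne: "N +>\<^bsub>V\<^esub> z \<noteq> {}" if "z \<in> carrier V" for z
    using mem_coset_iff[OF V N that, of z] that by blast
  have D: "a \<in> carrier V \<and> a \<ominus>\<^bsub>V\<^esub> z \<in> N" if "a \<in> N +>\<^bsub>V\<^esub> z" "z \<in> carrier V" for a z
    using mem_coset_iff[OF V N that(2), of a] coset_eq_iff[OF V N _ that(2), of a] that(1) by blast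
  have "(\<Union>a\<in>N +>\<^bsub>V\<^esub> x. \<Union>b\<in>N +>\<^bsub>V\<^esub> y. N +>\<^bsub>V\<^esub> (a \<otimes>\<^bsub>V\<^esub> b)) = N +>\<^bsub>V\<^esub> (x \<otimes>\<^bsub>V\<^esub> y)"
  proof (rule SUP_eq_const[OF ne[OF x]], rule SUP_eq_const[OF ne[OF y]])
    fix a b assume "a \<in> N +>\<^bsub>V\<^esub> x" "b \<in> N +>\<^bsub>V\<^esub> y"
    then show "N +>\<^bsub>V\<^esub> (a \<otimes>\<^bsub>V\<^esub> b) = N +>\<^bsub>V\<^esub> (x \<otimes>\<^bsub>V\<^esub> y)"
      using D[OF _ x, of a] D[OF _ y, of b] cong by blast
  qed
  then show ?thesis
    by (simp add: quotient_alg_def FactRing_def ring.defs module.defs rcoset_mult_def)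
qed

lemma leibniz_ideal_quotient_mult:
  assumes L: "leibniz_algebra F L" and N: "leibniz_ideal F L N" and x: "x \<in> carrier L" and y: "y \<in> carrier L"
  shows "(N +>\<^bsub>L\<^esub> x) \<otimes>\<^bsub>quotient_alg L N\<^esub> (N +>\<^bsub>L\<^esub> y) = N +>\<^bsub>L\<^esub> (x \<otimes>\<^bsub>L\<^esub> y)"
proof -
  interpret L: leibniz_algebra F L by (rule L)
  have S: "submodule N F L" and I: "\<And>x n. \<lbrakk>x \<in> carrier L; n \<in> N\<rbrakk> \<Longrightarrow> x \<otimes>\<^bsub>L\<^esub> n \<in> N \<and> n \<otimes>\<^bsub>L\<^esub> x \<in> N"
    using N by (auto simp: leibniz_ideal_def)
  note M = L.module_axioms
  show ?thesis
  proof (rule quotient_alg_mult[OF M S x y])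
    fix a b assume ab: "a \<in> carrier L" "b \<in> carrier L" "a \<ominus>\<^bsub>L\<^esub> x \<in> N" "b \<ominus>\<^bsub>L\<^esub> y \<in> N"
    have a: "a = (a \<ominus>\<^bsub>L\<^esub> x) \<oplus>\<^bsub>L\<^esub> x" and b: "b = (b \<ominus>\<^bsub>L\<^esub> y) \<oplus>\<^bsub>L\<^esub> y"
      using ab x y by (simp_all add: a_minus_def L.M.a_assoc L.M.l_neg)
    have c: "a \<ominus>\<^bsub>L\<^esub> x \<in> carrier L" "b \<ominus>\<^bsub>L\<^esub> y \<in> carrier L" using ab x y by simp_all
    have "a \<otimes>\<^bsub>L\<^esub> b = ((a \<ominus>\<^bsub>L\<^esub> x) \<oplus>\<^bsub>L\<^esub> x) \<otimes>\<^bsub>L\<^esub> b" using a by simp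
    also have "\<dots> = (a \<ominus>\<^bsub>L\<^esub> x) \<otimes>\<^bsub>L\<^esub> b \<oplus>\<^bsub>L\<^esub> x \<otimes>\<^bsub>L\<^esub> b"
      by (rule L.bracket_add_left[OF c(1) x ab(2)])
    also have "x \<otimes>\<^bsub>L\<^esub> b = x \<otimes>\<^bsub>L\<^esub> ((b \<ominus>\<^bsub>L\<^esub> y) \<oplus>\<^bsub>L\<^esub> y)" using b by simp
    also have "\<dots> = x \<otimes>\<^bsub>L\<^esub> (b \<ominus>\<^bsub>L\<^esub> y) \<oplus>\<^bsub>L\<^esub> x \<otimes>\<^bsub>L\<^esub> y"
      by (rule L.bracket_add_right[OF x c(2) y])
    finally have "a \<otimes>\<^bsub>L\<^esub> b \<ominus>\<^bsub>L\<^esub> x \<otimes>\<^bsub>L\<^esub> y = (a \<ominus>\<^bsub>L\<^esub> x) \<otimes>\<^bsub>L\<^esub> b \<oplus>\<^bsub>L\<^esub> x \<otimes>\<^bsub>L\<^esub> (b \<ominus>\<^bsub>L\<^esub> y)"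
      using x y ab c
      by (simp add: a_minus_def L.M.a_assoc L.M.r_neg L.bracket_closed del: L.M.minus_closed)
    moreover have "\<dots> \<in> N"
      using I x y ab c submoduleD(3)[OF S] by simp
    ultimately show "N +>\<^bsub>L\<^esub> (a \<otimes>\<^bsub>L\<^esub> b) = N +>\<^bsub>L\<^esub> (x \<otimes>\<^bsub>L\<^esub> y)"
      using coset_eq_iff[OF M S] x y ab L.bracket_closed by simp
  qed
qed

lemma leibniz_algebra_quotient:
  assumes L: "leibniz_algebra F L" and N: "leibniz_ideal F L N"
  shows "leibniz_algebra F (quotient_alg L N)"
proof -
  interpret L: leibniz_algebra F L by (rule L)
  have S: "submodule N F L" using N by (simp add: leibniz_ideal_def)
  note M = L.module_axioms
  note q = quotient_alg_add[OF M S] quotient_alg_smult[OF M S] leibniz_ideal_quotient_mult[OF L N]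
  have Q: "module F (quotient_alg L N)" by (rule module_quotient_alg[OF M S])
  show ?thesis
  proof (intro leibniz_algebra.intro leibniz_algebra_axioms.intro)
    show "field F" by (rule L.field_axioms)
    fix x y z
    assume "x \<in> carrier (quotient_alg L N)" "y \<in> carrier (quotient_alg L N)" "z \<in> carrier (quotient_alg L N)"
    then obtain x' y' z' where
      *: "x = N +>\<^bsub>L\<^esub> x'" "y = N +>\<^bsub>L\<^esub> y'" "z = N +>\<^bsub>L\<^esub> z'" "x' \<in> carrier L" "y' \<in> carrier L" "z' \<in> carrier L"
      by (auto simp: quotient_alg_simps)
    then show "x \<otimes>\<^bsub>quotient_alg L N\<^esub> (y \<otimes>\<^bsub>quotient_alg L N\<^esub> z) =
       (x \<otimes>\<^bsub>quotient_alg L N\<^esub> y) \<otimes>\<^bsub>quotient_alg L N\<^esub> z \<ominus>\<^bsub>quotient_alg L N\<^esub>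
       (x \<otimes>\<^bsub>quotient_alg L N\<^esub> z) \<otimes>\<^bsub>quotient_alg L N\<^esub> y"
      using linear_maps_zero_neg(3)[OF coset_linear[OF M S] M Q]
      by (simp add: q L.bracket_closed L.leibniz_identity)
  qed (auto simp: quotient_alg_simps q L.bracket_closed L.bracket_add_left L.bracket_add_right
      L.bracket_smult_left L.bracket_smult_right Q)
qed

lemma leibniz_algebra_direct_sum:
  assumes L: "leibniz_algebra F L" and M: "leibniz_algebra F M"
  shows "leibniz_algebra F (L \<boxplus> M)"
proof -
  interpret L: leibniz_algebra F L by (rule L)
  interpret M: leibniz_algebra F M by (rule M)
  show ?thesis
    by (intro leibniz_algebra.intro leibniz_algebra_axioms.intro)
      (auto simp: direct_sum_simps direct_sum_minus[OF L.module_axioms M.module_axioms]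
        L.bracket_closed L.bracket_add_left L.bracket_add_right L.bracket_smult_left L.bracket_smult_right
        M.bracket_closed M.bracket_add_left M.bracket_add_right M.bracket_smult_left M.bracket_smult_right
        L.leibniz_identity M.leibniz_identity L.field_axioms module_direct_sum[OF L.module_axioms M.module_axioms])
qed

lemma leibniz_ideal_direct_sum:
  assumes L: "leibniz_algebra F L" and M: "leibniz_algebra F M"
    and I: "leibniz_ideal F L I" and J: "leibniz_ideal F M J"
  shows "leibniz_ideal F (L \<boxplus> M) (I \<times> J)"
proof -
  have I': "submodule I F L" and J': "submodule J F M" using I J by (auto simp: leibniz_ideal_def)
  have "submodule (I \<times> J) F (L \<boxplus> M)"
    using submoduleD[OF I'] submoduleD[OF J']
    by (intro submodule_criterion module_direct_sum leibniz_algebra_module L M) (auto simp: direct_sum_simps)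
  then show ?thesis using I J by (auto simp: leibniz_ideal_def direct_sum_simps)
qed

lemma leibniz_hom_iff:
  "f \<in> leibniz_hom F L M \<longleftrightarrow> f \<in> linear_maps F L M \<and>
    (\<forall>x\<in>carrier L. \<forall>y\<in>carrier L. f (x \<otimes>\<^bsub>L\<^esub> y) = f x \<otimes>\<^bsub>M\<^esub> f y)"
  by (auto simp: leibniz_hom_def linear_maps_def)

lemma coset_leibniz_hom:
  assumes "leibniz_algebra F L" and "leibniz_ideal F L N"
  shows "(\<lambda>x. N +>\<^bsub>L\<^esub> x) \<in> leibniz_hom F L (quotient_alg L N)"
  unfolding leibniz_hom_iff
  using coset_linear[OF leibniz_algebra_module[OF assms(1)]] leibniz_ideal_quotient_mult[OF assms] assms(2)
  by (simp add: leibniz_ideal_def)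

section \<open>Tensor powers of linear maps\<close>

definition tpow_map ::
    "('f, 'r) ring_scheme \<Rightarrow> ('f, 'w, 'n) module_scheme \<Rightarrow> int \<Rightarrow> ('v \<Rightarrow> 'w)
      \<Rightarrow> ('v list \<Rightarrow> 'f) set \<Rightarrow> ('w list \<Rightarrow> 'f) set"
  where "tpow_map F W n f = tpow_lift (tpow F W n) F (\<lambda>xs. tpow_pure F W (map f xs))"

lemma CL_proj_eq_tpow_map: "CL_proj F L N n = tpow_map F (quotient_alg L N) n (\<lambda>x. N +>\<^bsub>L\<^esub> x)"
  by (simp add: CL_proj_def tpow_map_def)

lemma map_tpow_words:
  assumes "f \<in> linear_maps F V W" "xs \<in> tpow_words V n"
  shows "map f xs \<in> tpow_words W n"
  using assms by (auto simp: mem_tpow_words linear_mapsD)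

lemma tpow_map:
  assumes V: "module F V" and W: "module F W" and f: "f \<in> linear_maps F V W"
  shows "tpow_map F W n f \<in> linear_maps F (tpow F V n) (tpow F W n)"
    and "\<And>xs. xs \<in> tpow_words V n \<Longrightarrow> tpow_map F W n f (tpow_pure F V xs) = tpow_pure F W (map f xs)"
proof -
  have "(\<lambda>x. tpow_pure F W (map f xs @ f x # map f ys)) \<in> linear_maps F V (tpow F W n)"
    if "set xs \<subseteq> carrier V" "set ys \<subseteq> carrier V" "int (length xs + length ys + 1) = n" for xs ys
    using that linear_mapsD(1)[OF f]
    by (intro linear_maps_comp[OF f] multilinear_mapsD(2)[OF tpow_pure_multilinear[OF W]]) auto
  then have h: "(\<lambda>xs. tpow_pure F W (map f xs)) \<in> multilinear_maps F V n (tpow F W n)"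
    by (auto simp: multilinear_maps_def intro!: tpow_pure_closed[OF W] map_tpow_words[OF f])
  show "tpow_map F W n f \<in> linear_maps F (tpow F V n) (tpow F W n)"
    unfolding tpow_map_def by (rule tpow_lift(1)[OF V module_tpow[OF W] h])
  show "tpow_map F W n f (tpow_pure F V xs) = tpow_pure F W (map f xs)" if "xs \<in> tpow_words V n" for xs
    unfolding tpow_map_def by (rule tpow_lift(2)[OF V module_tpow[OF W] h that])
qed

text \<open>
  Pure tensors are lifted letter by letter.
\<close>

lemma tpow_map_surj:
  assumes V: "module F V" and W: "module F W" and f: "f \<in> linear_maps F V W"
    and surj: "carrier W \<subseteq> f ` carrier V" and t: "t \<in> carrier (tpow F W n)"
  obtains s where "s \<in> carrier (tpow F V n)" "tpow_map F W n f s = t"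
proof -
  interpret T: module F "tpow F V n" by (rule module_tpow[OF V])
  have "carrier (tpow F W n) \<subseteq> tpow_map F W n f ` carrier (tpow F V n)"
  proof (rule tpow_spanned[OF W submodule_image[OF tpow_map(1)[OF V W f] module_tpow[OF V] module_tpow[OF W]]])
    show "submodule (carrier (tpow F V n)) F (tpow F V n)" by (rule T.carrier_is_submodule)
    fix ys assume ys: "ys \<in> tpow_words W n"
    define xs where "xs = map (\<lambda>y. SOME x. x \<in> carrier V \<and> f x = y) ys"
    have pick: "(SOME x. x \<in> carrier V \<and> f x = y) \<in> carrier V \<and> f (SOME x. x \<in> carrier V \<and> f x = y) = y"
      if "y \<in> carrier W" for y
      by (rule someI_ex) (use surj that in auto)
    have "map f xs = ys" "xs \<in> tpow_words V n"
      using pick ys by (auto simp: xs_def mem_tpow_words subset_eq intro!: map_idI)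
    then show "tpow_pure F W ys \<in> tpow_map F W n f ` carrier (tpow F V n)"
      using tpow_map(2)[OF V W f] tpow_pure_closed[OF V] by (metis imageI)
  qed
  then show ?thesis using that t by blast
qed

text \<open>
  The dual form of the statement that the kernel of the projection is spanned by the words with an
  entry in \<open>N\<close>.  Changing a letter by an element of \<open>N\<close> does not change the value of \<open>T\<close>, so \<open>T\<close> depends
  only on the classes of the letters and factors through the projection.
\<close>

lemma vanishes_on_CL_proj_kernel:
  assumes V: "module F V" and N: "submodule N F V" and W: "module F W"
    and T: "T \<in> linear_maps F (tpow F V n) W"
    and T0: "\<And>xs. \<lbrakk>xs \<in> tpow_words V n; set xs \<inter> N \<noteq> {}\<rbrakk> \<Longrightarrow> T (tpow_pure F V xs) = \<zero>\<^bsub>W\<^esub>"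
    and t: "t \<in> carrier (tpow F V n)" "CL_proj F V N n t = \<zero>\<^bsub>tpow F (quotient_alg V N) n\<^esub>"
  shows "T t = \<zero>\<^bsub>W\<^esub>"
proof -
  interpret V: module F V by (rule V)
  interpret W: module F W by (rule W)
  let ?Q = "quotient_alg V N" and ?q = "\<lambda>x. N +>\<^bsub>V\<^esub> x"
  have Q: "module F ?Q" by (rule module_quotient_alg[OF V N])
  interpret Q: module F ?Q by (rule Q)
  have q: "?q \<in> linear_maps F V ?Q" by (rule coset_linear[OF V N])
  have slot: "(\<lambda>x. T (tpow_pure F V (ps @ x # xs))) \<in> linear_maps F V W"
    if "set ps \<subseteq> carrier V" "set xs \<subseteq> carrier V" "int (length ps + length xs + 1) = n" for ps xs
    by (rule linear_maps_comp[OF multilinear_mapsD(2)[OF tpow_pure_multilinear[OF V] that] T])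
  have step: "T (tpow_pure F V (ps @ x # xs)) = T (tpow_pure F V (ps @ y # xs))"
    if "set ps \<subseteq> carrier V" "set xs \<subseteq> carrier V" "int (length ps + length xs + 1) = n"
      "x \<in> carrier V" "y \<in> carrier V" "?q x = ?q y" for ps xs x y
  proof -
    have "x \<ominus>\<^bsub>V\<^esub> y \<in> N" using that(4-6) coset_eq_iff[OF V N] by simp
    then have "T (tpow_pure F V (ps @ (x \<ominus>\<^bsub>V\<^esub> y) # xs)) = \<zero>\<^bsub>W\<^esub>"
      using that by (intro T0) (auto simp: mem_tpow_words)
    then show ?thesis
      using linear_maps_zero_neg(3)[OF slot[OF that(1-3)] V W that(4,5)]
        linear_mapsD(1)[OF slot[OF that(1-3)]] that(4,5) by (simp add: W.minus_eq_zero_iff)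
  qed
  have words: "T (tpow_pure F V (ps @ xs)) = T (tpow_pure F V (ps @ ys))"
    if "set ps \<subseteq> carrier V" "set xs \<subseteq> carrier V" "set ys \<subseteq> carrier V" "int (length ps + length xs) = n"
      "map ?q xs = map ?q ys" for ps xs ys
    using that
  proof (induction xs arbitrary: ps ys)
    case Nil
    then show ?case by simp
  next
    case (Cons x xs)
    then obtain y ys' where ys: "ys = y # ys'" by (cases ys) auto
    have "T (tpow_pure F V (ps @ x # xs)) = T (tpow_pure F V (ps @ y # xs))"
      using Cons.prems ys by (intro step) auto
    also have "\<dots> = T (tpow_pure F V ((ps @ [y]) @ ys'))"
      using Cons.IH[of "ps @ [y]" ys'] Cons.prems ys by auto
    finally show ?case by (simp add: ys)
  qed
  \<comment> \<open>The representatives need not depend linearly on the classes: that \<open>h\<close> is multilinear follows from the linearity of \<open>T\<close> in each letter.\<close>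
  define r where "r = (\<lambda>k. SOME x. x \<in> carrier V \<and> ?q x = k)"
  have r: "r k \<in> carrier V" "?q (r k) = k" if "k \<in> carrier ?Q" for k
  proof -
    have "r k \<in> carrier V \<and> ?q (r k) = k"
      unfolding r_def by (rule someI_ex) (use that in \<open>auto simp: quotient_alg_simps\<close>)
    then show "r k \<in> carrier V" "?q (r k) = k" by auto
  qed
  have qr: "map ?q (map r ks) = ks" if "set ks \<subseteq> carrier ?Q" for ks
    using that r(2) by (auto intro!: map_idI)
  have rset: "set (map r ks) \<subseteq> carrier V" if "set ks \<subseteq> carrier ?Q" for ks
    using that r(1) by auto
  define h where "h = (\<lambda>ks. T (tpow_pure F V (map r ks)))"
  have hq: "h ks = T (tpow_pure F V xs)" if "set xs \<subseteq> carrier V" "int (length xs) = n" "ks = map ?q xs" for xs ks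
  proof -
    have ks: "set ks \<subseteq> carrier ?Q" using that by (auto simp: quotient_alg_simps)
    show ?thesis
      unfolding h_def using words[of "[]" "map r ks" xs] rset[OF ks] qr[OF ks] that by simp
  qed
  have h: "h \<in> multilinear_maps F ?Q n W"
    unfolding multilinear_maps_def
  proof (intro CollectI conjI allI impI Pi_I)
    show "h ks \<in> carrier W" if "ks \<in> tpow_words ?Q n" for ks
      unfolding h_def using that rset[of ks]
      by (intro linear_mapsD(1)[OF T] tpow_pure_closed[OF V]) (auto simp: mem_tpow_words)
    fix ks ls assume "set ks \<subseteq> carrier ?Q \<and> set ls \<subseteq> carrier ?Q \<and> int (length ks + length ls + 1) = n"
    then have kl: "set ks \<subseteq> carrier ?Q" "set ls \<subseteq> carrier ?Q" "int (length ks + length ls + 1) = n" by auto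
    let ?f = "\<lambda>x. T (tpow_pure F V (map r ks @ x # map r ls))"
    have f: "?f \<in> linear_maps F V W"
      by (rule slot[OF rset[OF kl(1)] rset[OF kl(2)]]) (use kl in simp)
    have hf: "h (ks @ ?q x # ls) = ?f x" if "x \<in> carrier V" for x
      using that kl rset[OF kl(1)] rset[OF kl(2)]
      by (intro hq) (simp_all add: qr[simplified] del: set_map)
    show "(\<lambda>k. h (ks @ k # ls)) \<in> linear_maps F ?Q W"
    proof (rule linear_mapsI)
      show "h (ks @ k # ls) \<in> carrier W" if "k \<in> carrier ?Q" for k
        using that hf linear_mapsD(1)[OF f] by (auto simp: quotient_alg_simps)
      show "h (ks @ (k \<oplus>\<^bsub>?Q\<^esub> l) # ls) = h (ks @ k # ls) \<oplus>\<^bsub>W\<^esub> h (ks @ l # ls)"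
        if "k \<in> carrier ?Q" "l \<in> carrier ?Q" for k l
        using that hf linear_mapsD(2)[OF f] by (auto simp: quotient_alg_simps quotient_alg_add[OF V N])
      show "h (ks @ (c \<odot>\<^bsub>?Q\<^esub> k) # ls) = c \<odot>\<^bsub>W\<^esub> h (ks @ k # ls)" if "c \<in> carrier F" "k \<in> carrier ?Q" for c k
        using that hf linear_mapsD(3)[OF f] by (auto simp: quotient_alg_simps quotient_alg_smult[OF V N])
    qed
  qed
  note h' = tpow_lift[OF Q W h]
  have P: "CL_proj F V N n \<in> linear_maps F (tpow F V n) (tpow F ?Q n)"
    unfolding CL_proj_eq_tpow_map by (rule tpow_map(1)[OF V Q q])
  have "T t = tpow_lift W F h (CL_proj F V N n t)"
  proof (rule tpow_maps_eqI[OF V W T linear_maps_comp[OF P h'(1)] _ t(1)])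
    fix xs assume xs: "xs \<in> tpow_words V n"
    then show "T (tpow_pure F V xs) = tpow_lift W F h (CL_proj F V N n (tpow_pure F V xs))"
      unfolding CL_proj_eq_tpow_map tpow_map(2)[OF V Q q xs] h'(2)[OF map_tpow_words[OF q xs]]
      using hq[of xs "map ?q xs"] by (simp add: mem_tpow_words)
  qed
  also have "\<dots> = \<zero>\<^bsub>W\<^esub>"
    unfolding t(2) by (rule linear_maps_zero_neg(1)[OF h'(1) module_tpow[OF Q] W])
  finally show ?thesis .
qed

section \<open>The boundary\<close>

lemma bracket_word_append:
  "bracket_word L (as @ u # bs @ v # cs) (length as) (Suc (length as + length bs)) = as @ (u \<otimes>\<^bsub>L\<^esub> v) # bs @ cs"
  by (simp add: bracket_word_def nth_append list_update_append)

lemma bracket_word_eqI: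
  assumes "w = as @ u # bs @ v # cs" "length as = i" "Suc (i + length bs) = j"
  shows "bracket_word L w i j = as @ (u \<otimes>\<^bsub>L\<^esub> v) # bs @ cs"
  using bracket_word_append[of L as u bs v cs] assms by simp

lemma split_list_at:
  assumes "i < length w"
  obtains as u bs where "w = as @ u # bs" "length as = i"
  using id_take_nth_drop[OF assms] assms by (metis length_take min.absorb4)

lemma split_list_at2:
  assumes "i < j" "j < length w"
  obtains as u bs v cs where "w = as @ u # bs @ v # cs" "length as = i" "j = Suc (length as + length bs)"
proof -
  obtain as u w' where 1: "w = as @ u # w'" "length as = i"
    using split_list_at[of i w] assms by auto
  then have "j - Suc i < length w'" using assms by simp
  then obtain bs v cs where 2: "w' = bs @ v # cs" "length bs = j - Suc i"
    by (rule split_list_at)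
  show ?thesis by (rule that[of as u bs v cs]) (use 1 2 assms in auto)
qed

lemma bracket_word_map:
  assumes "f \<in> leibniz_hom F L M" "set w \<subseteq> carrier L" "i < j" "j < length w"
  shows "map f (bracket_word L w i j) = bracket_word M (map f w) i j"
proof -
  obtain as u bs v cs where w: "w = as @ u # bs @ v # cs" "length as = i" "j = Suc (length as + length bs)"
    using split_list_at2[OF assms(3,4)] .
  have "f (u \<otimes>\<^bsub>L\<^esub> v) = f u \<otimes>\<^bsub>M\<^esub> f v"
    using assms(1,2) w by (simp add: leibniz_hom_iff)
  then show ?thesis
    using bracket_word_append[of M "map f as" "f u" "map f bs" "f v" "map f cs"] w
      bracket_word_append[of L as u bs v cs]
    by simp
qed

text \<open>
  As a function of one letter \<open>x\<close>, the word with \<open>[x\<^sub>i, x\<^sub>j]\<close> in position \<open>i\<close> has one slot that varies, and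
  there stands \<open>x\<close>, \<open>[x, v]\<close> or \<open>[u, x]\<close>, depending on where \<open>x\<close> lies relative to \<open>i\<close> and \<open>j\<close>.  Each of
  them is linear in \<open>x\<close>, which is why the boundary is well defined on tensor powers.
\<close>

lemma bracket_word_slot:
  assumes L: "leibniz_algebra F L" and xs: "set xs \<subseteq> carrier L" and ys: "set ys \<subseteq> carrier L"
    and ij: "i < j" "j \<le> length xs + length ys"
  obtains as bs g where "g \<in> linear_maps F L L" "set as \<subseteq> carrier L" "set bs \<subseteq> carrier L"
    "length as + length bs + 1 = length xs + length ys"
    "\<And>x. x \<in> carrier L \<Longrightarrow> bracket_word L (xs @ x # ys) i j = as @ g x # bs"
proof -
  interpret L: leibniz_algebra F L by (rule L)
  have l: "(\<lambda>x. x \<otimes>\<^bsub>L\<^esub> v) \<in> linear_maps F L L" and r: "(\<lambda>x. v \<otimes>\<^bsub>L\<^esub> x) \<in> linear_maps F L L"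
    if "v \<in> carrier L" for v
    using that
    by (auto intro!: linear_mapsI simp: L.bracket_closed L.bracket_add_left L.bracket_add_right
        L.bracket_smult_left L.bracket_smult_right)
  consider "length xs < i" | "length xs = i" | "i < length xs" "length xs < j" | "length xs = j"
    | "j < length xs" by linarith
  then show ?thesis
  proof cases
    case 1
    define i' j' where "i' = i - Suc (length xs)" and "j' = j - Suc (length xs)"
    have "i' < j'" "j' < length ys" using 1 ij by (auto simp: i'_def j'_def)
    then obtain as u bs v cs where w: "ys = as @ u # bs @ v # cs" "length as = i'"
      "j' = Suc (length as + length bs)"
      by (rule split_list_at2)
    then have uv: "u \<in> carrier L" "v \<in> carrier L" using ys by auto
    show ?thesis
    proof (rule that[OF linear_maps_id, of xs "as @ (u \<otimes>\<^bsub>L\<^esub> v) # bs @ cs"])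
      show "bracket_word L (xs @ x # ys) i j = xs @ x # as @ (u \<otimes>\<^bsub>L\<^esub> v) # bs @ cs" for x
        using w 1 ij
        by (subst bracket_word_eqI[of _ "xs @ x # as" u bs v cs]) (auto simp: i'_def j'_def)
    qed (use w(1) xs ys L.bracket_closed[OF uv] in auto)
  next
    case 2
    have "j - Suc i < length ys" using 2 ij by simp
    then obtain bs v cs where w: "ys = bs @ v # cs" "length bs = j - Suc i"
      by (rule split_list_at)
    have v: "v \<in> carrier L" using w ys by auto
    show ?thesis
    proof (rule that[OF l[OF v], of xs "bs @ cs"])
      show "bracket_word L (xs @ x # ys) i j = xs @ (x \<otimes>\<^bsub>L\<^esub> v) # bs @ cs" for x
        using w 2 ij by (intro bracket_word_eqI) auto
    qed (use w(1) xs ys in auto)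
  next
    case 3
    obtain as u bs where w: "xs = as @ u # bs" "length as = i" using 3(1) by (rule split_list_at)
    have "j - Suc (length xs) < length ys" using 3 ij by simp
    then obtain cs v ds where w': "ys = cs @ v # ds" "length cs = j - Suc (length xs)"
      by (rule split_list_at)
    have uv: "u \<in> carrier L" "v \<in> carrier L" using xs ys w(1) w'(1) by auto
    show ?thesis
    proof (rule that[OF linear_maps_id, of "as @ (u \<otimes>\<^bsub>L\<^esub> v) # bs" "cs @ ds"])
      show "bracket_word L (xs @ x # ys) i j = (as @ (u \<otimes>\<^bsub>L\<^esub> v) # bs) @ x # cs @ ds" for x
        using w w' 3 ij
        by (subst bracket_word_eqI[of _ as u "bs @ x # cs" v ds]) auto
    qed (use w(1) w'(1) xs ys L.bracket_closed[OF uv] in auto)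
  next
    case 4
    have "i < length xs" using 4 ij by simp
    then obtain as u bs where w: "xs = as @ u # bs" "length as = i" by (rule split_list_at)
    have u: "u \<in> carrier L" using w xs by auto
    show ?thesis
    proof (rule that[OF r[OF u], of as "bs @ ys"])
      show "bracket_word L (xs @ x # ys) i j = as @ (u \<otimes>\<^bsub>L\<^esub> x) # bs @ ys" for x
        using w 4 ij by (intro bracket_word_eqI) auto
    qed (use w(1) xs ys in auto)
  next
    case 5
    obtain as u bs v cs where w: "xs = as @ u # bs @ v # cs" "length as = i"
      "j = Suc (length as + length bs)"
      using ij(1) 5 by (rule split_list_at2)
    have uv: "u \<in> carrier L" "v \<in> carrier L" using xs w(1) by auto
    show ?thesis
    proof (rule that[OF linear_maps_id, of "as @ (u \<otimes>\<^bsub>L\<^esub> v) # bs @ cs" ys])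
      show "bracket_word L (xs @ x # ys) i j = (as @ (u \<otimes>\<^bsub>L\<^esub> v) # bs @ cs) @ x # ys" for x
        using w ij
        by (subst bracket_word_eqI[of _ as u bs v "cs @ x # ys"]) auto
    qed (use w(1) xs ys L.bracket_closed[OF uv] in auto)
  qed
qed

lemma bracket_word_in_words:
  assumes L: "leibniz_algebra F L" and w: "w \<in> tpow_words L n" and ij: "i < j" "j < length w"
  shows "bracket_word L w i j \<in> tpow_words L (n - 1)"
proof -
  obtain as u bs v cs where "w = as @ u # bs @ v # cs" "length as = i" "j = Suc (length as + length bs)"
    using split_list_at2[OF ij] .
  then show ?thesis
    using bracket_word_append[of L as u bs v cs] w leibniz_algebra.bracket_closed[OF L]
    by (auto simp: mem_tpow_words)
qed

lemma linear_maps_finsum: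
  assumes W: "module F W" and fin: "finite A" and f: "\<And>i. i \<in> A \<Longrightarrow> f i \<in> linear_maps F V W"
    and V: "module F V"
  shows "(\<lambda>x. \<Oplus>\<^bsub>W\<^esub>i\<in>A. f i x) \<in> linear_maps F V W"
proof -
  interpret W: module F W by (rule W)
  show ?thesis using fin f
  proof (induction A rule: finite_induct)
    case empty
    then show ?case using linear_maps_zero[OF W] by simp
  next
    case (insert a A)
    have *: "(\<lambda>x. f a x \<oplus>\<^bsub>W\<^esub> (\<Oplus>\<^bsub>W\<^esub>i\<in>A. f i x)) \<in> linear_maps F V W"
      using insert by (intro linear_maps_add W) auto
    have cl: "f i x \<in> carrier W" if "i \<in> insert a A" "x \<in> carrier V" for i x
      using linear_mapsD(1)[OF insert.prems] that by blast
    show ?case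
      using insert.hyps cl by (intro linear_maps_cong[OF * V]) (auto intro!: W.finsum_insert[symmetric])
  qed
qed

lemma linear_map_finsum:
  assumes V: "module F V" and W: "module F W" and f: "f \<in> linear_maps F V W" and A: "finite A"
    and g: "\<And>i. i \<in> A \<Longrightarrow> g i \<in> carrier V"
  shows "f (\<Oplus>\<^bsub>V\<^esub>i\<in>A. g i) = (\<Oplus>\<^bsub>W\<^esub>i\<in>A. f (g i))"
proof -
  interpret V: module F V by (rule V)
  interpret W: module F W by (rule W)
  show ?thesis using A g
  proof (induction A rule: finite_induct)
    case empty
    then show ?case using linear_maps_zero_neg(1)[OF f V W] by simp
  next
    case (insert a A)
    have "(\<Oplus>\<^bsub>V\<^esub>i\<in>insert a A. g i) = g a \<oplus>\<^bsub>V\<^esub> (\<Oplus>\<^bsub>V\<^esub>i\<in>A. g i)"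
      using insert by (intro V.finsum_insert) auto
    moreover have "(\<Oplus>\<^bsub>W\<^esub>i\<in>insert a A. f (g i)) = f (g a) \<oplus>\<^bsub>W\<^esub> (\<Oplus>\<^bsub>W\<^esub>i\<in>A. f (g i))"
      using insert linear_mapsD(1)[OF f] by (intro W.finsum_insert) auto
    moreover have "(\<Oplus>\<^bsub>V\<^esub>i\<in>A. g i) \<in> carrier V" using insert by (intro V.finsum_closed) auto
    ultimately show ?case using insert linear_mapsD(2)[OF f] by simp
  qed
qed

text \<open>
  The value of \<^const>\<open>CL_boundary\<close> at the pure tensor of a word.
\<close>

definition boundary_word ::
    "('f, 'r) ring_scheme \<Rightarrow> ('f, 'v, 'm) module_scheme \<Rightarrow> int \<Rightarrow> 'v list \<Rightarrow> ('v list \<Rightarrow> 'f) set"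
  where "boundary_word F L n xs = (\<Oplus>\<^bsub>CL F L (n - 1)\<^esub>j\<in>{..<length xs}. \<Oplus>\<^bsub>CL F L (n - 1)\<^esub>i\<in>{..<j}.
      ((\<ominus>\<^bsub>F\<^esub> \<one>\<^bsub>F\<^esub>) [^]\<^bsub>F\<^esub> Suc j) \<odot>\<^bsub>CL F L (n - 1)\<^esub> tpow_pure F L (bracket_word L xs i j))"

lemma CL_boundary_eq_lift: "CL_boundary F L n = tpow_lift (CL F L (n - 1)) F (boundary_word F L n)"
  by (simp only: CL_boundary_def boundary_word_def[abs_def])

lemma boundary_word_multilinear:
  assumes L: "leibniz_algebra F L"
  shows "boundary_word F L n \<in> multilinear_maps F L n (CL F L (n - 1))"
proof -
  interpret L: leibniz_algebra F L by (rule L)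
  let ?T = "CL F L (n - 1)"
  note M = L.module_axioms
  interpret T: module F ?T by (rule module_tpow[OF M])
  have s: "(\<ominus>\<^bsub>F\<^esub> \<one>\<^bsub>F\<^esub>) [^]\<^bsub>F\<^esub> (k::nat) \<in> carrier F" for k by simp
  have "boundary_word F L n xs \<in> carrier ?T" if xs: "xs \<in> tpow_words L n" for xs
    unfolding boundary_word_def
    by (intro T.M.finsum_closed Pi_I T.smult_closed s tpow_pure_closed[OF M] bracket_word_in_words[OF L xs]) auto
  moreover have "(\<lambda>x. boundary_word F L n (xs @ x # ys)) \<in> linear_maps F L ?T"
    if xy: "set xs \<subseteq> carrier L" "set ys \<subseteq> carrier L" "int (length xs + length ys + 1) = n" for xs ys
  proof -
    have "(\<lambda>x. tpow_pure F L (bracket_word L (xs @ x # ys) i j)) \<in> linear_maps F L ?T"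
      if ij: "i < j" "j < Suc (length xs + length ys)" for i j
    proof -
      obtain as bs g where g: "g \<in> linear_maps F L L" "set as \<subseteq> carrier L" "set bs \<subseteq> carrier L"
        "length as + length bs + 1 = length xs + length ys"
        and eq: "\<And>x. x \<in> carrier L \<Longrightarrow> bracket_word L (xs @ x # ys) i j = as @ g x # bs"
        using bracket_word_slot[OF L xy(1,2) ij(1)] ij(2) by (metis less_Suc_eq_le)
      have "(\<lambda>x. tpow_pure F L (as @ g x # bs)) \<in> linear_maps F L ?T"
        by (rule linear_maps_comp[OF g(1) multilinear_mapsD(2)[OF tpow_pure_multilinear[OF M] g(2,3)]])
          (use g(4) xy(3) in linarith)
      then show ?thesis by (rule linear_maps_cong[OF _ M]) (simp add: eq)
    qed
    then show ?thesis
      unfolding boundary_word_def length_append length_Cons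
      by (intro linear_maps_finsum linear_maps_smult T.module_axioms M s) auto
  qed
  ultimately show ?thesis by (simp add: multilinear_maps_def)
qed

lemma CL_boundary:
  assumes L: "leibniz_algebra F L"
  shows "CL_boundary F L n \<in> linear_maps F (CL F L n) (CL F L (n - 1))"
    and "\<And>xs. xs \<in> tpow_words L n \<Longrightarrow> CL_boundary F L n (tpow_pure F L xs) = boundary_word F L n xs"
  unfolding CL_boundary_eq_lift
  using tpow_lift[OF leibniz_algebra_module[OF L] module_tpow[OF leibniz_algebra_module[OF L]]
      boundary_word_multilinear[OF L]] by auto

lemma CL_boundary_natural:
  assumes L: "leibniz_algebra F L" and M: "leibniz_algebra F M" and f: "f \<in> leibniz_hom F L M"
    and t: "t \<in> carrier (CL F L n)"
  shows "CL_boundary F M n (tpow_map F M n f t) = tpow_map F M (n - 1) f (CL_boundary F L n t)"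
proof -
  note L' = leibniz_algebra_module[OF L] and M' = leibniz_algebra_module[OF M]
  have lf: "f \<in> linear_maps F L M" using f by (simp add: leibniz_hom_iff)
  note mp = tpow_map[OF L' M' lf]
  interpret L: leibniz_algebra F L by (rule L)
  interpret TL: module F "CL F L (n - 1)" by (rule module_tpow[OF L'])
  interpret TM: module F "CL F M (n - 1)" by (rule module_tpow[OF M'])
  have s: "(\<ominus>\<^bsub>F\<^esub> \<one>\<^bsub>F\<^esub>) [^]\<^bsub>F\<^esub> (k::nat) \<in> carrier F" for k by simp
  show ?thesis
  proof (rule tpow_maps_eqI[OF L' TM.module_axioms linear_maps_comp[OF mp(1) CL_boundary(1)[OF M]]
        linear_maps_comp[OF CL_boundary(1)[OF L] mp(1)] _ t])
    fix xs assume xs: "xs \<in> tpow_words L n"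
    have w: "bracket_word L xs i j \<in> tpow_words L (n - 1)" if "i < j" "j < length xs" for i j
      by (rule bracket_word_in_words[OF L xs that])
    have term_closed: "((\<ominus>\<^bsub>F\<^esub> \<one>\<^bsub>F\<^esub>) [^]\<^bsub>F\<^esub> Suc j) \<odot>\<^bsub>CL F L (n - 1)\<^esub> tpow_pure F L (bracket_word L xs i j)
        \<in> carrier (CL F L (n - 1))" if "i < j" "j < length xs" for i j
      by (intro TL.smult_closed s tpow_pure_closed[OF L'] w that)
    have "tpow_map F M (n - 1) f (CL_boundary F L n (tpow_pure F L xs)) =
        (\<Oplus>\<^bsub>CL F M (n - 1)\<^esub>j\<in>{..<length xs}. tpow_map F M (n - 1) f (\<Oplus>\<^bsub>CL F L (n - 1)\<^esub>i\<in>{..<j}.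
          ((\<ominus>\<^bsub>F\<^esub> \<one>\<^bsub>F\<^esub>) [^]\<^bsub>F\<^esub> Suc j) \<odot>\<^bsub>CL F L (n - 1)\<^esub> tpow_pure F L (bracket_word L xs i j)))"
      unfolding CL_boundary(2)[OF L xs] boundary_word_def
      by (rule linear_map_finsum[OF TL.module_axioms TM.module_axioms mp(1)])
        (intro finite_lessThan TL.M.finsum_closed Pi_I term_closed; simp only: lessThan_iff)+
    also have "\<dots> = boundary_word F M n (map f xs)"
      unfolding boundary_word_def length_map
    proof (intro TM.finsum_cong' refl Pi_I)
      fix j assume j: "j \<in> {..<length xs}"
      show "(\<Oplus>\<^bsub>CL F M (n - 1)\<^esub>i\<in>{..<j}. ((\<ominus>\<^bsub>F\<^esub> \<one>\<^bsub>F\<^esub>) [^]\<^bsub>F\<^esub> Suc j) \<odot>\<^bsub>CL F M (n - 1)\<^esub>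
          tpow_pure F M (bracket_word M (map f xs) i j)) \<in> carrier (CL F M (n - 1))"
        using j by (intro TM.M.finsum_closed Pi_I TM.smult_closed s tpow_pure_closed[OF M']
            bracket_word_in_words[OF M map_tpow_words[OF lf xs]]) auto
      have "tpow_map F M (n - 1) f (\<Oplus>\<^bsub>CL F L (n - 1)\<^esub>i\<in>{..<j}.
          ((\<ominus>\<^bsub>F\<^esub> \<one>\<^bsub>F\<^esub>) [^]\<^bsub>F\<^esub> Suc j) \<odot>\<^bsub>CL F L (n - 1)\<^esub> tpow_pure F L (bracket_word L xs i j)) =
        (\<Oplus>\<^bsub>CL F M (n - 1)\<^esub>i\<in>{..<j}. tpow_map F M (n - 1) f
          (((\<ominus>\<^bsub>F\<^esub> \<one>\<^bsub>F\<^esub>) [^]\<^bsub>F\<^esub> Suc j) \<odot>\<^bsub>CL F L (n - 1)\<^esub> tpow_pure F L (bracket_word L xs i j)))"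
        by (rule linear_map_finsum[OF TL.module_axioms TM.module_axioms mp(1)])
          (use j in \<open>intro finite_lessThan term_closed; simp only: lessThan_iff\<close>)+
      also have "\<dots> = (\<Oplus>\<^bsub>CL F M (n - 1)\<^esub>i\<in>{..<j}. ((\<ominus>\<^bsub>F\<^esub> \<one>\<^bsub>F\<^esub>) [^]\<^bsub>F\<^esub> Suc j) \<odot>\<^bsub>CL F M (n - 1)\<^esub>
          tpow_pure F M (bracket_word M (map f xs) i j))"
      proof (intro TM.finsum_cong' refl Pi_I)
        fix i assume i: "i \<in> {..<j}"
        then have ij: "i < j" "j < length xs" using j by auto
        show "((\<ominus>\<^bsub>F\<^esub> \<one>\<^bsub>F\<^esub>) [^]\<^bsub>F\<^esub> Suc j) \<odot>\<^bsub>CL F M (n - 1)\<^esub>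
          tpow_pure F M (bracket_word M (map f xs) i j) \<in> carrier (CL F M (n - 1))"
          using ij by (intro TM.smult_closed s tpow_pure_closed[OF M']
              bracket_word_in_words[OF M map_tpow_words[OF lf xs]]) auto
        have "set xs \<subseteq> carrier L" using xs by (simp add: mem_tpow_words)
        from bracket_word_map[OF f this ij]
        show "tpow_map F M (n - 1) f (((\<ominus>\<^bsub>F\<^esub> \<one>\<^bsub>F\<^esub>) [^]\<^bsub>F\<^esub> Suc j) \<odot>\<^bsub>CL F L (n - 1)\<^esub>
            tpow_pure F L (bracket_word L xs i j)) = ((\<ominus>\<^bsub>F\<^esub> \<one>\<^bsub>F\<^esub>) [^]\<^bsub>F\<^esub> Suc j) \<odot>\<^bsub>CL F M (n - 1)\<^esub>
          tpow_pure F M (bracket_word M (map f xs) i j)"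
          by (simp only: linear_mapsD(3)[OF mp(1) s tpow_pure_closed[OF L' w[OF ij]]] mp(2)[OF w[OF ij]])
      qed
      finally show "tpow_map F M (n - 1) f (\<Oplus>\<^bsub>CL F L (n - 1)\<^esub>i\<in>{..<j}.
          ((\<ominus>\<^bsub>F\<^esub> \<one>\<^bsub>F\<^esub>) [^]\<^bsub>F\<^esub> Suc j) \<odot>\<^bsub>CL F L (n - 1)\<^esub> tpow_pure F L (bracket_word L xs i j)) =
        (\<Oplus>\<^bsub>CL F M (n - 1)\<^esub>i\<in>{..<j}. ((\<ominus>\<^bsub>F\<^esub> \<one>\<^bsub>F\<^esub>) [^]\<^bsub>F\<^esub> Suc j) \<odot>\<^bsub>CL F M (n - 1)\<^esub>
          tpow_pure F M (bracket_word M (map f xs) i j))" .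
    qed
    finally show "CL_boundary F M n (tpow_map F M n f (tpow_pure F L xs)) =
        tpow_map F M (n - 1) f (CL_boundary F L n (tpow_pure F L xs))"
      using CL_boundary(2)[OF M map_tpow_words[OF lf xs]] mp(2)[OF xs] by simp
  qed
qed

section \<open>Boundaries of short words\<close>

context
  fixes F :: "('f, 'r) ring_scheme" and L :: "('f, 'v, 'm) module_scheme"
  assumes L: "leibniz_algebra F L"
begin

interpretation L: leibniz_algebra F L by (rule L)

private lemma sgn: "(\<ominus>\<^bsub>F\<^esub> \<one>\<^bsub>F\<^esub>) \<otimes>\<^bsub>F\<^esub> (\<ominus>\<^bsub>F\<^esub> \<one>\<^bsub>F\<^esub>) = \<one>\<^bsub>F\<^esub>"
  by (simp add: L.l_minus)

lemma boundary_word_2: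
  assumes [simp]: "x \<in> carrier L" "y \<in> carrier L"
  shows "boundary_word F L 2 [x, y] = tpow_pure F L [x \<otimes>\<^bsub>L\<^esub> y]"
proof -
  interpret T: module F "CL F L 1" by (rule module_tpow[OF L.module_axioms])
  have [simp]: "tpow_pure F L [u] \<in> carrier (CL F L 1)" if "u \<in> carrier L" for u
    using that by (intro tpow_pure_closed[OF L.module_axioms]) (simp add: mem_tpow_words)
  show ?thesis
    by (simp add: boundary_word_def lessThan_Suc Pi_def bracket_word_def sgn L.bracket_closed)
qed

lemma boundary_word_3:
  assumes [simp]: "x \<in> carrier L" "y \<in> carrier L" "z \<in> carrier L"
  shows "boundary_word F L 3 [x, y, z] = tpow_pure F L [x \<otimes>\<^bsub>L\<^esub> y, z] \<ominus>\<^bsub>CL F L 2\<^esub>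
    (tpow_pure F L [x \<otimes>\<^bsub>L\<^esub> z, y] \<oplus>\<^bsub>CL F L 2\<^esub> tpow_pure F L [x, y \<otimes>\<^bsub>L\<^esub> z])"
proof -
  interpret T: module F "CL F L 2" by (rule module_tpow[OF L.module_axioms])
  have [simp]: "tpow_pure F L [u, v] \<in> carrier (CL F L 2)" if "u \<in> carrier L" "v \<in> carrier L" for u v
    using that by (intro tpow_pure_closed[OF L.module_axioms]) (simp add: mem_tpow_words)
  show ?thesis
    by (simp add: boundary_word_def lessThan_Suc Pi_def bracket_word_def sgn L.bracket_closed
        module_minus_smult[OF T.module_axioms, symmetric] a_minus_def T.minus_add T.a_ac L.m_assoc)
qed

lemma boundary_word_4:
  assumes [simp]: "x \<in> carrier L" "y \<in> carrier L" "z \<in> carrier L" "w \<in> carrier L"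
  shows "boundary_word F L 4 [x, y, z, w] = tpow_pure F L [x \<otimes>\<^bsub>L\<^esub> y, z, w] \<ominus>\<^bsub>CL F L 3\<^esub>
    (tpow_pure F L [x \<otimes>\<^bsub>L\<^esub> z, y, w] \<oplus>\<^bsub>CL F L 3\<^esub> tpow_pure F L [x, y \<otimes>\<^bsub>L\<^esub> z, w]) \<oplus>\<^bsub>CL F L 3\<^esub>
    (tpow_pure F L [x \<otimes>\<^bsub>L\<^esub> w, y, z] \<oplus>\<^bsub>CL F L 3\<^esub> (tpow_pure F L [x, y \<otimes>\<^bsub>L\<^esub> w, z] \<oplus>\<^bsub>CL F L 3\<^esub>
     tpow_pure F L [x, y, z \<otimes>\<^bsub>L\<^esub> w]))"
proof -
  interpret T: module F "CL F L 3" by (rule module_tpow[OF L.module_axioms])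
  have [simp]: "tpow_pure F L [t, u, v] \<in> carrier (CL F L 3)"
    if "t \<in> carrier L" "u \<in> carrier L" "v \<in> carrier L" for t u v
    using that by (intro tpow_pure_closed[OF L.module_axioms]) (simp add: mem_tpow_words)
  show ?thesis
    by (simp add: boundary_word_def lessThan_Suc Pi_def bracket_word_def sgn L.bracket_closed
        module_minus_smult[OF T.module_axioms, symmetric] a_minus_def T.minus_add T.a_ac L.m_assoc)
qed

text \<open>
  The composite sends \<open>x \<otimes> y \<otimes> z\<close> to \<open>[[x, y], z] - [[x, z], y] - [x, [y, z]]\<close>, which is zero by the
  Leibniz identity.
\<close>

lemma boundary_boundary_2:
  assumes t: "t \<in> carrier (CL F L 3)"
  shows "CL_boundary F L 2 (CL_boundary F L 3 t) = \<zero>\<^bsub>CL F L 1\<^esub>"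
proof -
  interpret T: module F "CL F L 2" by (rule module_tpow[OF L.module_axioms])
  interpret T1: module F "CL F L 1" by (rule module_tpow[OF L.module_axioms])
  note d3 = CL_boundary[OF L, where n = 3, simplified] and d2 = CL_boundary[OF L, where n = 2, simplified]
  have pl: "(\<lambda>u. tpow_pure F L [u]) \<in> linear_maps F L (CL F L 1)"
    using multilinear_mapsD(2)[OF tpow_pure_multilinear[OF L.module_axioms], of "[]" "[]"] by simp
  show ?thesis
  proof (rule tpow_maps_eqI[OF L.module_axioms T1.module_axioms linear_maps_comp[OF d3(1) d2(1)]
        linear_maps_zero[OF T1.module_axioms] _ t])
    fix xs assume xs: "xs \<in> tpow_words L 3"
    then have "length xs = 3" by (simp add: mem_tpow_words)
    then obtain x y z where e: "xs = [x, y, z]" by (auto simp: numeral_3_eq_3 length_Suc_conv)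
    then have c [simp]: "x \<in> carrier L" "y \<in> carrier L" "z \<in> carrier L" using xs by (auto simp: mem_tpow_words)
    have p [simp]: "tpow_pure F L [u, v] \<in> carrier (CL F L 2)"
      and b [simp]: "CL_boundary F L 2 (tpow_pure F L [u, v]) = tpow_pure F L [u \<otimes>\<^bsub>L\<^esub> v]"
      if "u \<in> carrier L" "v \<in> carrier L" for u v
      using that d2(2)[of "[u, v]"] boundary_word_2[of u v]
      by (auto intro!: tpow_pure_closed[OF L.module_axioms] simp: mem_tpow_words)
    have p1 [simp]: "tpow_pure F L [u] \<in> carrier (CL F L 1)" if "u \<in> carrier L" for u
      using linear_mapsD(1)[OF pl that] .
    have "tpow_pure F L [x \<otimes>\<^bsub>L\<^esub> (y \<otimes>\<^bsub>L\<^esub> z)] = tpow_pure F L [(x \<otimes>\<^bsub>L\<^esub> y) \<otimes>\<^bsub>L\<^esub> z] \<ominus>\<^bsub>CL F L 1\<^esub> tpow_pure F L [(x \<otimes>\<^bsub>L\<^esub> z) \<otimes>\<^bsub>L\<^esub> y]"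
      using linear_maps_zero_neg(3)[OF pl L.module_axioms T1.module_axioms]
      by (simp add: L.leibniz_identity L.bracket_closed)
    moreover have "(p \<ominus>\<^bsub>CL F L 1\<^esub> (q \<oplus>\<^bsub>CL F L 1\<^esub> (p \<ominus>\<^bsub>CL F L 1\<^esub> q))) = \<zero>\<^bsub>CL F L 1\<^esub>"
      if "p \<in> carrier (CL F L 1)" "q \<in> carrier (CL F L 1)" for p q
      using that by algebra
    ultimately show "CL_boundary F L 2 (CL_boundary F L 3 (tpow_pure F L xs)) = \<zero>\<^bsub>CL F L 1\<^esub>"
      unfolding d3(2)[OF xs] unfolding e
      using linear_maps_zero_neg(3)[OF d2(1) T.module_axioms T1.module_axioms] linear_mapsD(2)[OF d2(1)]
      by (simp add: boundary_word_3 L.bracket_closed)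
  qed
qed

text \<open>
  The composite consists of eighteen terms.  Expanding the three of the form \<open>[x, [y, z]] \<otimes> w\<close> and the
  one of the form \<open>x \<otimes> [y, [z, w]]\<close> by the Leibniz identity leaves eleven different tensors, each of
  which occurs with total coefficient zero.
\<close>

lemma boundary_boundary_3:
  assumes t: "t \<in> carrier (CL F L 4)"
  shows "CL_boundary F L 3 (CL_boundary F L 4 t) = \<zero>\<^bsub>CL F L 2\<^esub>"
proof -
  interpret T: module F "CL F L 2" by (rule module_tpow[OF L.module_axioms])
  interpret T3: module F "CL F L 3" by (rule module_tpow[OF L.module_axioms])
  note d3 = CL_boundary[OF L, where n = 3, simplified] and d4 = CL_boundary[OF L, where n = 4, simplified]
  note B = L.bracket_closed
  define q where "q = (\<lambda>u v. tpow_pure F L [u, v])"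
  have q1: "(\<lambda>u. q u v) \<in> linear_maps F L (CL F L 2)" if "v \<in> carrier L" for v
    using multilinear_mapsD(2)[OF tpow_pure_multilinear[OF L.module_axioms, of 2], of "[]" "[v]"] that
    by (simp add: q_def)
  have q2: "q v \<in> linear_maps F L (CL F L 2)" if "v \<in> carrier L" for v
    using multilinear_mapsD(2)[OF tpow_pure_multilinear[OF L.module_axioms, of 2], of "[v]" "[]"] that
    by (simp add: q_def)
  have q: "q u v \<in> carrier (CL F L 2)" if "u \<in> carrier L" "v \<in> carrier L" for u v
    using linear_mapsD(1)[OF q2] that by auto
  have lz1: "q (x \<otimes>\<^bsub>L\<^esub> (y \<otimes>\<^bsub>L\<^esub> z)) v = q ((x \<otimes>\<^bsub>L\<^esub> y) \<otimes>\<^bsub>L\<^esub> z) v \<ominus>\<^bsub>CL F L 2\<^esub> q ((x \<otimes>\<^bsub>L\<^esub> z) \<otimes>\<^bsub>L\<^esub> y) v"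
    and lz2: "q v (x \<otimes>\<^bsub>L\<^esub> (y \<otimes>\<^bsub>L\<^esub> z)) = q v ((x \<otimes>\<^bsub>L\<^esub> y) \<otimes>\<^bsub>L\<^esub> z) \<ominus>\<^bsub>CL F L 2\<^esub> q v ((x \<otimes>\<^bsub>L\<^esub> z) \<otimes>\<^bsub>L\<^esub> y)"
    if "x \<in> carrier L" "y \<in> carrier L" "z \<in> carrier L" "v \<in> carrier L" for x y z v
    using linear_maps_zero_neg(3)[OF q1 L.module_axioms T.module_axioms]
      linear_maps_zero_neg(3)[OF q2 L.module_axioms T.module_axioms] that
    by (simp_all add: L.leibniz_identity B)
  have p3: "tpow_pure F L [u, v, w] \<in> carrier (CL F L 3)"
    and b3: "CL_boundary F L 3 (tpow_pure F L [u, v, w]) =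
      q (u \<otimes>\<^bsub>L\<^esub> v) w \<ominus>\<^bsub>CL F L 2\<^esub> (q (u \<otimes>\<^bsub>L\<^esub> w) v \<oplus>\<^bsub>CL F L 2\<^esub> q u (v \<otimes>\<^bsub>L\<^esub> w))"
    if "u \<in> carrier L" "v \<in> carrier L" "w \<in> carrier L" for u v w
    using that d3(2)[of "[u, v, w]"] boundary_word_3[of u v w]
    by (auto intro!: tpow_pure_closed[OF L.module_axioms] simp: mem_tpow_words q_def)
  have cancel: "(t1 \<ominus>\<^bsub>CL F L 2\<^esub> (t2 \<oplus>\<^bsub>CL F L 2\<^esub> t3)) \<ominus>\<^bsub>CL F L 2\<^esub>
     ((t4 \<ominus>\<^bsub>CL F L 2\<^esub> (t5 \<oplus>\<^bsub>CL F L 2\<^esub> t6)) \<oplus>\<^bsub>CL F L 2\<^esub>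
      ((t1 \<ominus>\<^bsub>CL F L 2\<^esub> t4) \<ominus>\<^bsub>CL F L 2\<^esub> (t7 \<oplus>\<^bsub>CL F L 2\<^esub> t8))) \<oplus>\<^bsub>CL F L 2\<^esub>
     ((t9 \<ominus>\<^bsub>CL F L 2\<^esub> (t10 \<oplus>\<^bsub>CL F L 2\<^esub> t7)) \<oplus>\<^bsub>CL F L 2\<^esub>
     (((t2 \<ominus>\<^bsub>CL F L 2\<^esub> t9) \<ominus>\<^bsub>CL F L 2\<^esub> (t6 \<oplus>\<^bsub>CL F L 2\<^esub> t11)) \<oplus>\<^bsub>CL F L 2\<^esub>
      (t3 \<ominus>\<^bsub>CL F L 2\<^esub> ((t5 \<ominus>\<^bsub>CL F L 2\<^esub> t10) \<oplus>\<^bsub>CL F L 2\<^esub> (t8 \<ominus>\<^bsub>CL F L 2\<^esub> t11))))) = \<zero>\<^bsub>CL F L 2\<^esub>"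
    if "t1 \<in> carrier (CL F L 2)" "t2 \<in> carrier (CL F L 2)" "t3 \<in> carrier (CL F L 2)"
      "t4 \<in> carrier (CL F L 2)" "t5 \<in> carrier (CL F L 2)" "t6 \<in> carrier (CL F L 2)"
      "t7 \<in> carrier (CL F L 2)" "t8 \<in> carrier (CL F L 2)" "t9 \<in> carrier (CL F L 2)"
      "t10 \<in> carrier (CL F L 2)" "t11 \<in> carrier (CL F L 2)"
    for t1 t2 t3 t4 t5 t6 t7 t8 t9 t10 t11
    using that by algebra
  show ?thesis
  proof (rule tpow_maps_eqI[OF L.module_axioms T.module_axioms linear_maps_comp[OF d4(1) d3(1)]
        linear_maps_zero[OF T.module_axioms] _ t])
    fix xs assume xs: "xs \<in> tpow_words L 4"
    then have "length xs = 4" by (simp add: mem_tpow_words)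
    then have "length xs = Suc (Suc (Suc (Suc 0)))" by simp
    then obtain x y z w where e: "xs = [x, y, z, w]" by (auto simp: length_Suc_conv)
    then have c [simp]: "x \<in> carrier L" "y \<in> carrier L" "z \<in> carrier L" "w \<in> carrier L"
      using xs by (auto simp: mem_tpow_words)
    show "CL_boundary F L 3 (CL_boundary F L 4 (tpow_pure F L xs)) = \<zero>\<^bsub>CL F L 2\<^esub>"
      unfolding d4(2)[OF xs] unfolding e boundary_word_4[OF c]
      by (simp add: linear_maps_zero_neg(3)[OF d3(1) T3.module_axioms T.module_axioms] linear_mapsD(2)[OF d3(1)]
          p3 B b3 lz1 lz2 cancel q)
  qed
qed

end

section \<open>Complements and retractions\<close>

text \<open>
  Zorn's lemma gives a submodule \<open>C\<close> maximal among those that meet \<open>N\<close> only in zero.  It is a complement: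
  for \<open>v\<close> outside \<open>N + C\<close> the larger submodule \<open>C + F v\<close> would still meet \<open>N\<close> only in zero, since
  \<open>c + a v \<in> N\<close> with \<open>a \<noteq> 0\<close> could be solved for \<open>v\<close>.  The retraction is the projection onto \<open>N\<close> along \<open>C\<close>.
\<close>

lemma submodule_retraction:
  assumes F: "field F" and V: "module F V" and N: "submodule N F V"
  obtains r where "r \<in> linear_maps F V V" "\<And>x. x \<in> carrier V \<Longrightarrow> r x \<in> N" "\<And>x. x \<in> N \<Longrightarrow> r x = x"
proof -
  interpret F: field F by (rule F)
  interpret V: module F V by (rule V)
  note N' = submoduleD[OF N]
  define A where "A = {C. submodule C F V \<and> C \<inter> N = {\<zero>\<^bsub>V\<^esub>}}"
  have "{\<zero>\<^bsub>V\<^esub>} \<in> A" using submodule_zero[OF V] N'(2) by (simp add: A_def)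
  then have "A \<noteq> {}" by blast
  moreover have "\<Union>\<C> \<in> A" if "\<C> \<noteq> {}" "subset.chain A \<C>" for \<C>
  proof -
    have sub: "C \<in> \<C> \<Longrightarrow> submodule C F V" and int: "C \<in> \<C> \<Longrightarrow> C \<inter> N = {\<zero>\<^bsub>V\<^esub>}" for C
      using that(2) by (auto simp: A_def subset.chain_def)
    have "submodule (\<Union>\<C>) F V"
    proof (rule submodule_criterion[OF V])
      show "\<Union>\<C> \<subseteq> carrier V" using submoduleD(1)[OF sub] by blast
      show "\<zero>\<^bsub>V\<^esub> \<in> \<Union>\<C>" using submoduleD(2)[OF sub] that(1) by blast
      show "c \<odot>\<^bsub>V\<^esub> a \<in> \<Union>\<C>" if "c \<in> carrier F" "a \<in> \<Union>\<C>" for c a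
        using submoduleD(4)[OF sub] that by blast
      fix a b assume "a \<in> \<Union>\<C>" "b \<in> \<Union>\<C>"
      then obtain C D where CD: "a \<in> C" "b \<in> D" "C \<in> \<C>" "D \<in> \<C>" by blast
      then have "C \<subseteq> D \<or> D \<subseteq> C" using that(2) by (auto simp: subset.chain_def)
      then show "a \<oplus>\<^bsub>V\<^esub> b \<in> \<Union>\<C>"
        using CD submoduleD(3)[OF sub[OF CD(3)]] submoduleD(3)[OF sub[OF CD(4)]] by blast
    qed
    moreover have "\<Union>\<C> \<inter> N = {\<zero>\<^bsub>V\<^esub>}" using int that(1) by blast
    ultimately show ?thesis by (simp add: A_def)
  qed
  ultimately obtain C where C: "C \<in> A" and max: "\<And>X. \<lbrakk>X \<in> A; C \<subseteq> X\<rbrakk> \<Longrightarrow> X = C"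
    using subset_Zorn_nonempty[of A] by metis
  have subC: "submodule C F V" and CN: "C \<inter> N = {\<zero>\<^bsub>V\<^esub>}" using C by (auto simp: A_def)
  note C' = submoduleD[OF subC]
  have decomp: "\<exists>n\<in>N. v \<ominus>\<^bsub>V\<^esub> n \<in> C" if v: "v \<in> carrier V" for v
  proof (rule ccontr)
    assume neg: "\<not> (\<exists>n\<in>N. v \<ominus>\<^bsub>V\<^esub> n \<in> C)"
    define D where "D = {c \<oplus>\<^bsub>V\<^esub> a \<odot>\<^bsub>V\<^esub> v | c a. c \<in> C \<and> a \<in> carrier F}"
    have DI: "c \<oplus>\<^bsub>V\<^esub> a \<odot>\<^bsub>V\<^esub> v \<in> D" if "c \<in> C" "a \<in> carrier F" for c a
      using that by (auto simp: D_def)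
    have cC: "c \<in> carrier V" if "c \<in> C" for c using C'(1) that by auto
    have cN: "n \<in> carrier V" if "n \<in> N" for n using N'(1) that by auto
    have CD: "C \<subseteq> D"
    proof
      fix c assume c: "c \<in> C"
      then show "c \<in> D" using DI[OF c, of "\<zero>\<^bsub>F\<^esub>"] v cC by simp
    qed
    have "submodule D F V"
    proof (rule submodule_criterion[OF V])
      show "D \<subseteq> carrier V" using cC v by (auto simp: D_def)
      show "\<zero>\<^bsub>V\<^esub> \<in> D" using CD C'(2) by auto
      show "x \<oplus>\<^bsub>V\<^esub> y \<in> D" if xy: "x \<in> D" "y \<in> D" for x y
      proof -
        obtain c a d b where *: "x = c \<oplus>\<^bsub>V\<^esub> a \<odot>\<^bsub>V\<^esub> v" "y = d \<oplus>\<^bsub>V\<^esub> b \<odot>\<^bsub>V\<^esub> v"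
          "c \<in> C" "a \<in> carrier F" "d \<in> C" "b \<in> carrier F"
          using xy by (auto simp: D_def)
        have "x \<oplus>\<^bsub>V\<^esub> y = (c \<oplus>\<^bsub>V\<^esub> d) \<oplus>\<^bsub>V\<^esub> (a \<oplus>\<^bsub>F\<^esub> b) \<odot>\<^bsub>V\<^esub> v"
          using * v cC by (simp add: V.smult_l_distr V.M.a_ac)
        then show ?thesis using DI[OF C'(3)[OF *(3,5)]] *(4,6) by simp
      qed
      show "k \<odot>\<^bsub>V\<^esub> x \<in> D" if kx: "k \<in> carrier F" "x \<in> D" for k x
      proof -
        obtain c a where *: "x = c \<oplus>\<^bsub>V\<^esub> a \<odot>\<^bsub>V\<^esub> v" "c \<in> C" "a \<in> carrier F"
          using kx by (auto simp: D_def)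
        have "k \<odot>\<^bsub>V\<^esub> x = k \<odot>\<^bsub>V\<^esub> c \<oplus>\<^bsub>V\<^esub> (k \<otimes>\<^bsub>F\<^esub> a) \<odot>\<^bsub>V\<^esub> v"
          using * v cC kx by (simp add: V.smult_r_distr V.smult_assoc1)
        then show ?thesis using DI[OF C'(4)[OF kx(1) *(2)]] *(3) kx(1) by simp
      qed
    qed
    moreover have "D \<inter> N = {\<zero>\<^bsub>V\<^esub>}"
    proof (intro equalityI subsetI)
      fix n assume "n \<in> D \<inter> N"
      then obtain c a where *: "n = c \<oplus>\<^bsub>V\<^esub> a \<odot>\<^bsub>V\<^esub> v" "c \<in> C" "a \<in> carrier F" and n: "n \<in> N"
        by (auto simp: D_def)
      show "n \<in> {\<zero>\<^bsub>V\<^esub>}"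
      proof (cases "a = \<zero>\<^bsub>F\<^esub>")
        case True
        then have "n = c" using * v cC by simp
        then show ?thesis using *(2) n CN by blast
      next
        case False
        then have i: "inv\<^bsub>F\<^esub> a \<in> carrier F" "inv\<^bsub>F\<^esub> a \<otimes>\<^bsub>F\<^esub> a = \<one>\<^bsub>F\<^esub>"
          using *(3) F.field_Units F.Units_l_inv by auto
        have av: "a \<odot>\<^bsub>V\<^esub> v \<in> carrier V" and c: "c \<in> carrier V" using *(3) v cC[OF *(2)] by auto
        then have "a \<odot>\<^bsub>V\<^esub> v = n \<ominus>\<^bsub>V\<^esub> c" unfolding *(1) by algebra
        then have "v = inv\<^bsub>F\<^esub> a \<odot>\<^bsub>V\<^esub> (n \<ominus>\<^bsub>V\<^esub> c)"
          using i *(3) v V.smult_assoc1[OF i(1) *(3) v] by simp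
        also have "\<dots> = inv\<^bsub>F\<^esub> a \<odot>\<^bsub>V\<^esub> n \<ominus>\<^bsub>V\<^esub> inv\<^bsub>F\<^esub> a \<odot>\<^bsub>V\<^esub> c"
          using i(1) cC[OF *(2)] cN[OF n] by (simp add: a_minus_def V.smult_r_distr V.smult_r_minus)
        finally have "v = inv\<^bsub>F\<^esub> a \<odot>\<^bsub>V\<^esub> n \<ominus>\<^bsub>V\<^esub> inv\<^bsub>F\<^esub> a \<odot>\<^bsub>V\<^esub> c" .
        moreover have "(p \<ominus>\<^bsub>V\<^esub> q) \<ominus>\<^bsub>V\<^esub> p = \<ominus>\<^bsub>V\<^esub> q" if "p \<in> carrier V" "q \<in> carrier V" for p q
          using that by algebra
        ultimately have "v \<ominus>\<^bsub>V\<^esub> inv\<^bsub>F\<^esub> a \<odot>\<^bsub>V\<^esub> n = \<ominus>\<^bsub>V\<^esub> (inv\<^bsub>F\<^esub> a \<odot>\<^bsub>V\<^esub> c)"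
          using i(1) cC[OF *(2)] cN[OF n] by simp
        then have "v \<ominus>\<^bsub>V\<^esub> inv\<^bsub>F\<^esub> a \<odot>\<^bsub>V\<^esub> n \<in> C" using C'(4,5) i(1) *(2) by simp
        then show ?thesis using neg N'(4)[OF i(1) n] by blast
      qed
    qed (use CD C'(2) N'(2) in auto)
    ultimately have "D = C" using max CD by (simp add: A_def)
    moreover have "v \<in> D" using DI[OF C'(2), of "\<one>\<^bsub>F\<^esub>"] v by simp
    moreover have "v \<ominus>\<^bsub>V\<^esub> \<zero>\<^bsub>V\<^esub> = v" using v by (simp add: a_minus_def)
    ultimately show False using neg N'(2) by auto
  qed
  have uniq: "n = m" if "n \<in> N" "m \<in> N" "v \<ominus>\<^bsub>V\<^esub> n \<in> C" "v \<ominus>\<^bsub>V\<^esub> m \<in> C" "v \<in> carrier V" for n m v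
  proof -
    have c: "n \<in> carrier V" "m \<in> carrier V" using that N'(1) by auto
    have "(v \<ominus>\<^bsub>V\<^esub> m) \<ominus>\<^bsub>V\<^esub> (v \<ominus>\<^bsub>V\<^esub> n) = n \<ominus>\<^bsub>V\<^esub> m" using c that(5) by algebra
    then have "n \<ominus>\<^bsub>V\<^esub> m \<in> C \<inter> N" using C'(6)[OF that(4,3)] N'(6)[OF that(1,2)] by simp
    then have "n \<ominus>\<^bsub>V\<^esub> m = \<zero>\<^bsub>V\<^esub>" using CN by auto
    then show ?thesis using c V.minus_eq_zero_iff by simp
  qed
  define r where "r = (\<lambda>v. THE n. n \<in> N \<and> v \<ominus>\<^bsub>V\<^esub> n \<in> C)"
  have rI: "r v = n" if "n \<in> N" "v \<ominus>\<^bsub>V\<^esub> n \<in> C" "v \<in> carrier V" for v n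
    unfolding r_def using that uniq by (intro the_equality) auto
  have r: "r v \<in> N" "v \<ominus>\<^bsub>V\<^esub> r v \<in> C" if "v \<in> carrier V" for v
    using decomp[OF that] rI that by auto
  have rc: "r v \<in> carrier V" if "v \<in> carrier V" for v using r[OF that] N'(1) by auto
  show ?thesis
  proof (rule that[of r])
    show "r x \<in> N" if "x \<in> carrier V" for x using r(1)[OF that] .
    show "r x = x" if "x \<in> N" for x
    proof (rule rI[OF that])
      show "x \<in> carrier V" using that N'(1) by auto
      then show "x \<ominus>\<^bsub>V\<^esub> x \<in> C" using C'(2) V.minus_eq_zero_iff[of x x] by simp
    qed
    show "r \<in> linear_maps F V V"
    proof (rule linear_mapsI[OF rc])
      fix x y assume xy: "x \<in> carrier V" "y \<in> carrier V"
      have "(x \<oplus>\<^bsub>V\<^esub> y) \<ominus>\<^bsub>V\<^esub> (r x \<oplus>\<^bsub>V\<^esub> r y) = (x \<ominus>\<^bsub>V\<^esub> r x) \<oplus>\<^bsub>V\<^esub> (y \<ominus>\<^bsub>V\<^esub> r y)"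
        using xy rc[OF xy(1)] rc[OF xy(2)] by algebra
      then show "r (x \<oplus>\<^bsub>V\<^esub> y) = r x \<oplus>\<^bsub>V\<^esub> r y"
        using xy r N'(3) C'(3) by (intro rI) auto
    next
      fix c x assume cx: "c \<in> carrier F" "x \<in> carrier V"
      have "c \<odot>\<^bsub>V\<^esub> x \<ominus>\<^bsub>V\<^esub> c \<odot>\<^bsub>V\<^esub> r x = c \<odot>\<^bsub>V\<^esub> (x \<ominus>\<^bsub>V\<^esub> r x)"
        using cx rc[OF cx(2)] by (simp add: a_minus_def V.smult_r_distr V.smult_r_minus)
      then show "r (c \<odot>\<^bsub>V\<^esub> x) = c \<odot>\<^bsub>V\<^esub> r x"
        using cx r N'(4) C'(4) by (intro rI) auto
    qed
  qed
qed

text \<open>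
  Inside \<open>V \<otimes> W\<close> the subspaces \<open>N \<otimes> W\<close> and \<open>V \<otimes> M\<close> meet only in \<open>N \<otimes> M\<close>; hence compatible bilinear
  maps on them have a common extension.  With retractions \<open>r\<close> onto \<open>N\<close> and \<open>s\<close> onto \<open>M\<close> it is
  \<open>a (r v) w + b (v - r v) (s w)\<close>: the second term is zero on \<open>N \<times> W\<close>, and for \<open>w \<in> M\<close> the first is
  \<open>b (r v) w\<close> and completes the second to \<open>b v w\<close>.
\<close>

lemma bilinear_extension:
  assumes F: "field F" and V: "module F V" and W: "module F W" and U: "module F U"
    and N: "submodule N F V" and M: "submodule M F W"
    and a: "a \<in> bilinear_maps F (V\<lparr>carrier := N\<rparr>) W U"
    and b: "b \<in> bilinear_maps F V (W\<lparr>carrier := M\<rparr>) U"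
    and agree: "\<And>n m. \<lbrakk>n \<in> N; m \<in> M\<rbrakk> \<Longrightarrow> a n m = b n m"
  obtains \<theta> where "\<theta> \<in> bilinear_maps F V W U"
    "\<And>n w. \<lbrakk>n \<in> N; w \<in> carrier W\<rbrakk> \<Longrightarrow> \<theta> n w = a n w"
    "\<And>v m. \<lbrakk>v \<in> carrier V; m \<in> M\<rbrakk> \<Longrightarrow> \<theta> v m = b v m"
proof -
  interpret V: module F V by (rule V)
  interpret W: module F W by (rule W)
  interpret U: module F U by (rule U)
  obtain r where r: "r \<in> linear_maps F V V" "\<And>x. x \<in> carrier V \<Longrightarrow> r x \<in> N" "\<And>x. x \<in> N \<Longrightarrow> r x = x"
    using submodule_retraction[OF F V N] by blast
  obtain s where s: "s \<in> linear_maps F W W" "\<And>x. x \<in> carrier W \<Longrightarrow> s x \<in> M" "\<And>x. x \<in> M \<Longrightarrow> s x = x"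
    using submodule_retraction[OF F W M] by blast
  have r': "r \<in> linear_maps F V (V\<lparr>carrier := N\<rparr>)" and s': "s \<in> linear_maps F W (W\<lparr>carrier := M\<rparr>)"
    using r s by (auto simp: linear_maps_def)
  have NV: "n \<in> carrier V" if "n \<in> N" for n using submoduleD(1)[OF N] that by auto
  have MW: "n \<in> carrier W" if "n \<in> M" for n using submoduleD(1)[OF M] that by auto
  have t: "(\<lambda>x. x \<ominus>\<^bsub>V\<^esub> r x) \<in> linear_maps F V V"
    by (rule linear_maps_minus[OF linear_maps_id r(1) V])
  have tc: "x \<ominus>\<^bsub>V\<^esub> r x \<in> carrier V" if "x \<in> carrier V" for x using linear_mapsD(1)[OF t that] .
  note a1 = bilinear_mapsD(1)[OF a] and a2 = bilinear_mapsD(2)[OF a, simplified]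
    and b1 = bilinear_mapsD(1)[OF b, simplified] and b2 = bilinear_mapsD(2)[OF b]
  let ?\<theta> = "\<lambda>v w. a (r v) w \<oplus>\<^bsub>U\<^esub> b (v \<ominus>\<^bsub>V\<^esub> r v) (s w)"
  show ?thesis
  proof (rule that[of ?\<theta>])
    show "?\<theta> \<in> bilinear_maps F V W U"
    proof (rule bilinear_mapsI)
      show "(\<lambda>v. ?\<theta> v w) \<in> linear_maps F V U" if "w \<in> carrier W" for w
        using that s(2)
        by (intro linear_maps_add U linear_maps_comp[OF r' a1] linear_maps_comp[OF t b1]) auto
      show "?\<theta> v \<in> linear_maps F W U" if "v \<in> carrier V" for v
        using that r(2) tc
        by (intro linear_maps_add U linear_maps_comp[OF s' b2] a2) auto
    qed
    show "?\<theta> n w = a n w" if "n \<in> N" "w \<in> carrier W" for n w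
    proof -
      have "n \<ominus>\<^bsub>V\<^esub> r n = \<zero>\<^bsub>V\<^esub>" using r(3)[OF that(1)] NV[OF that(1)] V.minus_eq_zero_iff by simp
      then have "b (n \<ominus>\<^bsub>V\<^esub> r n) (s w) = \<zero>\<^bsub>U\<^esub>"
        using linear_maps_zero_neg(1)[OF b1[OF s(2)[OF that(2)]] V U] by simp
      then show ?thesis using r(3)[OF that(1)] linear_mapsD(1)[OF a2[OF that(1)] that(2)] by simp
    qed
    show "?\<theta> v m = b v m" if "v \<in> carrier V" "m \<in> M" for v m
    proof -
      have "?\<theta> v m = b (r v) m \<oplus>\<^bsub>U\<^esub> b (v \<ominus>\<^bsub>V\<^esub> r v) m"
        using agree[OF r(2)[OF that(1)] that(2)] s(3)[OF that(2)] by simp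
      also have "\<dots> = b (r v \<oplus>\<^bsub>V\<^esub> (v \<ominus>\<^bsub>V\<^esub> r v)) m"
        using linear_mapsD(2)[OF b1[OF that(2)] NV[OF r(2)[OF that(1)]] tc[OF that(1)]] by simp
      also have "r v \<oplus>\<^bsub>V\<^esub> (v \<ominus>\<^bsub>V\<^esub> r v) = v"
        using that(1) NV[OF r(2)[OF that(1)]] by algebra
      finally show ?thesis .
    qed
  qed
qed

lemma restrict_minus:
  assumes "module F V" "submodule H F V" "x \<in> H" "y \<in> H"
  shows "x \<ominus>\<^bsub>V\<lparr>carrier := H\<rparr>\<^esub> y = x \<ominus>\<^bsub>V\<^esub> y"
  using assms submoduleD(1)[OF assms(2)] module_minus_smult[OF assms(1), of y]
    module_minus_smult[OF module_restrict[OF assms(1,2)], of y]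
  by (auto simp: a_minus_def)

section \<open>Linear isomorphisms\<close>

definition linear_iso ::
    "('f, 'r) ring_scheme \<Rightarrow> ('f, 'v, 'm) module_scheme \<Rightarrow> ('f, 'w, 'n) module_scheme \<Rightarrow> bool"
  where "linear_iso F V W \<longleftrightarrow> (\<exists>\<phi>\<in>linear_maps F V W. bij_betw \<phi> (carrier V) (carrier W))"

lemma linear_iso_sym:
  assumes V: "module F V" and iso: "linear_iso F V W"
  shows "linear_iso F W V"
proof -
  interpret V: module F V by (rule V)
  obtain \<phi> where \<phi>: "\<phi> \<in> linear_maps F V W" and b: "bij_betw \<phi> (carrier V) (carrier W)"
    using iso by (auto simp: linear_iso_def)
  let ?\<psi> = "the_inv_into (carrier V) \<phi>"
  have inj: "inj_on \<phi> (carrier V)" and im: "\<phi> ` carrier V = carrier W" using b by (auto simp: bij_betw_def)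
  have inv: "?\<psi> (\<phi> x) = x" if "x \<in> carrier V" for x by (rule the_inv_into_f_f[OF inj that])
  have "?\<psi> \<in> linear_maps F W V"
  proof (rule linear_mapsI)
    fix x y c assume "x \<in> carrier W"
    then obtain x' where x: "x = \<phi> x'" "x' \<in> carrier V" using im by blast
    then show "?\<psi> x \<in> carrier V" using inv by simp
    show "?\<psi> (c \<odot>\<^bsub>W\<^esub> x) = c \<odot>\<^bsub>V\<^esub> ?\<psi> x" if "c \<in> carrier F"
      using inv[of "c \<odot>\<^bsub>V\<^esub> x'"] x that linear_mapsD(3)[OF \<phi> that] inv by simp
    assume "y \<in> carrier W"
    then obtain y' where y: "y = \<phi> y'" "y' \<in> carrier V" using im by blast
    then show "?\<psi> (x \<oplus>\<^bsub>W\<^esub> y) = ?\<psi> x \<oplus>\<^bsub>V\<^esub> ?\<psi> y"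
      using inv[of "x' \<oplus>\<^bsub>V\<^esub> y'"] x linear_mapsD(2)[OF \<phi>] inv by simp
  qed
  moreover have "bij_betw ?\<psi> (carrier W) (carrier V)" by (rule bij_betw_the_inv_into[OF b])
  ultimately show ?thesis by (auto simp: linear_iso_def)
qed

lemma linear_iso_trans:
  assumes "linear_iso F U V" and "linear_iso F V W"
  shows "linear_iso F U W"
proof -
  obtain f g where f: "f \<in> linear_maps F U V" "bij_betw f (carrier U) (carrier V)"
    and g: "g \<in> linear_maps F V W" "bij_betw g (carrier V) (carrier W)"
    using assms by (auto simp: linear_iso_def)
  have "bij_betw (\<lambda>x. g (f x)) (carrier U) (carrier W)"
    using bij_betw_trans[OF f(2) g(2)] by (simp add: comp_def)
  then show ?thesis using linear_maps_comp[OF f(1) g(1)] by (auto simp: linear_iso_def)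
qed

lemma linear_iso_refl: "linear_iso F V V"
  unfolding linear_iso_def using linear_maps_id by (intro bexI[of _ "\<lambda>x. x"]) (auto simp: bij_betw_def)

lemma linear_iso_direct_sum:
  assumes "linear_iso F V V'" and "linear_iso F W W'"
  shows "linear_iso F (V \<boxplus> W) (V' \<boxplus> W')"
proof -
  obtain f g where f: "f \<in> linear_maps F V V'" "bij_betw f (carrier V) (carrier V')"
    and g: "g \<in> linear_maps F W W'" "bij_betw g (carrier W) (carrier W')"
    using assms by (auto simp: linear_iso_def)
  have "(\<lambda>x. (f (fst x), g (snd x))) \<in> linear_maps F (V \<boxplus> W) (V' \<boxplus> W')"
    by (intro linear_maps_Pair linear_maps_comp[OF linear_maps_fst f(1)] linear_maps_comp[OF linear_maps_snd g(1)])
  moreover have "bij_betw (\<lambda>x. (f (fst x), g (snd x))) (carrier (V \<boxplus> W)) (carrier (V' \<boxplus> W'))"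
    using bij_betw_map_prod[OF f(2) g(2)] by (simp add: direct_sum_simps map_prod_def case_prod_unfold)
  ultimately show ?thesis by (auto simp: linear_iso_def)
qed

text \<open>
  The isomorphism theorem, with the kernel given by a membership criterion.
\<close>

lemma linear_iso_quotient:
  assumes V: "module F V" and W: "module F W" and f: "f \<in> linear_maps F V W"
    and surj: "carrier W \<subseteq> f ` carrier V"
    and ker: "\<And>x. x \<in> carrier V \<Longrightarrow> f x = \<zero>\<^bsub>W\<^esub> \<longleftrightarrow> x \<in> N" and NV: "N \<subseteq> carrier V"
  shows "linear_iso F (quotient_alg V N) W"
proof -
  have "N = {x \<in> carrier V. f x = \<zero>\<^bsub>W\<^esub>}" using ker NV by auto
  then have N: "submodule N F V" using submodule_kernel[OF f V W] by simp
  interpret V: module F V by (rule V)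
  interpret W: module F W by (rule W)
  have f0: "\<And>x. x \<in> N \<Longrightarrow> f x = \<zero>\<^bsub>W\<^esub>" using ker NV by auto
  note g = quotient_lift[OF V N W f f0]
  have "inj_on (\<lambda>K. the_elem (f ` K)) (carrier (quotient_alg V N))"
  proof (rule inj_onI)
    fix K H assume "K \<in> carrier (quotient_alg V N)" "H \<in> carrier (quotient_alg V N)"
      and eq: "the_elem (f ` K) = the_elem (f ` H)"
    then obtain x y where *: "K = N +>\<^bsub>V\<^esub> x" "H = N +>\<^bsub>V\<^esub> y" "x \<in> carrier V" "y \<in> carrier V"
      by (auto simp: quotient_alg_simps)
    then have "f x = f y" using eq g(2) by simp
    then have "f (x \<ominus>\<^bsub>V\<^esub> y) = \<zero>\<^bsub>W\<^esub>"
      using linear_maps_zero_neg(3)[OF f V W *(3,4)] linear_mapsD(1)[OF f] *(3,4) by (simp add: W.minus_eq_zero_iff)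
    then show "K = H" using * ker coset_eq_iff[OF V N] by simp
  qed
  moreover have "(\<lambda>K. the_elem (f ` K)) ` carrier (quotient_alg V N) = carrier W"
    using surj g(2) linear_mapsD(1)[OF f] by (auto simp: quotient_alg_simps image_image)
  ultimately show ?thesis using g(1) by (auto simp: linear_iso_def bij_betw_def)
qed

definition trivial_bracket :: "('f, 'v, 'm) module_scheme \<Rightarrow> bool"
  where "trivial_bracket L \<longleftrightarrow> (\<forall>x\<in>carrier L. \<forall>y\<in>carrier L. x \<otimes>\<^bsub>L\<^esub> y = \<zero>\<^bsub>L\<^esub>)"

lemma trivial_bracket_free_module: "trivial_bracket (free_module F S)"
  by (simp add: trivial_bracket_def free_module_simps)

lemma trivial_bracket_direct_sum: "\<lbrakk>trivial_bracket L; trivial_bracket M\<rbrakk> \<Longrightarrow> trivial_bracket (L \<boxplus> M)"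
  by (auto simp: trivial_bracket_def direct_sum_simps)

lemma trivial_bracket_restrict: "\<lbrakk>trivial_bracket L; H \<subseteq> carrier L\<rbrakk> \<Longrightarrow> trivial_bracket (L\<lparr>carrier := H\<rparr>)"
  by (auto simp: trivial_bracket_def)

lemma trivial_bracket_quotient:
  assumes V: "module F V" and N: "submodule N F V" and triv: "trivial_bracket V"
  shows "trivial_bracket (quotient_alg V N)"
proof -
  interpret V: module F V by (rule V)
  have "N +>\<^bsub>V\<^esub> \<zero>\<^bsub>V\<^esub> = N" using coset_eq_self_iff[OF V N V.zero_closed] submoduleD(2)[OF N] by simp
  then show ?thesis
    using triv by (auto simp: trivial_bracket_def quotient_alg_simps quotient_alg_mult[OF V N])
qed

lemma trivial_bracket_tpow:
  assumes "module F V" shows "trivial_bracket (tpow F V n)"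
  unfolding tpow_def tpow_rels_eq_span
  by (intro trivial_bracket_quotient[of F] trivial_bracket_free_module linear_span_submodule
      tpow_relators_subset[OF assms] module_free_module module_is_cring[OF assms])

lemma trivial_bracket_tensor:
  assumes "module F V" "module F W" shows "trivial_bracket (tensor F V W)"
  unfolding tensor_def tensor_rels_eq_span
  by (intro trivial_bracket_quotient[of F] trivial_bracket_free_module linear_span_submodule
      tensor_relators_subset[OF assms] module_free_module module_is_cring[OF assms(1)])

text \<open>
  Between algebras with zero bracket every linear map respects the bracket, as it sends zero to
  zero.
\<close>

lemma leibniz_isomorphic_trivial_bracket:
  assumes "module F V" "module F W" "linear_iso F V W" "trivial_bracket V" "trivial_bracket W"
  shows "leibniz_isomorphic F V W"
proof -
  obtain \<phi> where \<phi>: "\<phi> \<in> linear_maps F V W" "bij_betw \<phi> (carrier V) (carrier W)"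
    using assms(3) by (auto simp: linear_iso_def)
  have "\<phi> \<in> leibniz_hom F V W"
    unfolding leibniz_hom_iff
    using \<phi>(1) assms(4,5) linear_maps_zero_neg(1)[OF \<phi>(1) assms(1,2)] linear_mapsD(1)[OF \<phi>(1)]
    by (simp add: trivial_bracket_def)
  then show ?thesis using \<phi>(2) by (auto simp: leibniz_isomorphic_def)
qed

section \<open>Relative homology as homology of the kernel\<close>

text \<open>
  The degree \<open>2\<close> cycles of the kernel of the projection \<open>C(L) \<rightarrow> C(L/N)\<close>.
\<close>

definition rel_cycles ::
    "('f, 'r) ring_scheme \<Rightarrow> ('f, 'v, 'm) module_scheme \<Rightarrow> 'v set \<Rightarrow> ('v list \<Rightarrow> 'f) set set"
  where "rel_cycles F L N = {a \<in> carrier (CL F L 2). CL_boundary F L 2 a = \<zero>\<^bsub>CL F L 1\<^esub> \<and>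
    CL_proj F L N 2 a = \<zero>\<^bsub>CL F (quotient_alg L N) 2\<^esub>}"

text \<open>
  The degree \<open>3\<close> part of the same kernel.
\<close>

definition rel_chains ::
    "('f, 'r) ring_scheme \<Rightarrow> ('f, 'v, 'm) module_scheme \<Rightarrow> 'v set \<Rightarrow> ('v list \<Rightarrow> 'f) set set"
  where "rel_chains F L N =
    {c \<in> carrier (CL F L 3). CL_proj F L N 3 c = \<zero>\<^bsub>CL F (quotient_alg L N) 3\<^esub>}"

abbreviation (input) "rel_boundaries F L N \<equiv> CL_boundary F L 3 ` rel_chains F L N"

abbreviation (input) "rel_cycle_space F L N \<equiv> (CL F L 2)\<lparr>carrier := rel_cycles F L N\<rparr>"

abbreviation (input) "HL2_kernel F L N \<equiv> quotient_alg (rel_cycle_space F L N) (rel_boundaries F L N)"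

lemma cone_boundary_linear:
  assumes L: "leibniz_algebra F L" and N: "leibniz_ideal F L N"
  shows "cone_boundary F L N n \<in> linear_maps F (cone F L N n) (cone F L N (n - 1))"
proof -
  note L' = leibniz_algebra_module[OF L] and Q = leibniz_algebra_quotient[OF L N]
  note Q' = leibniz_algebra_module[OF Q]
  have S: "submodule N F L" using N by (simp add: leibniz_ideal_def)
  have eq: "n - 1 - 1 = n - 2" by simp
  have "cone_boundary F L N n = (\<lambda>z. (\<ominus>\<^bsub>CL F L (n - 2)\<^esub> CL_boundary F L (n - 1) (fst z),
      CL_boundary F (quotient_alg L N) n (snd z) \<oplus>\<^bsub>CL F (quotient_alg L N) (n - 1)\<^esub> CL_proj F L N (n - 1) (fst z)))"
    by (simp add: cone_boundary_def case_prod_unfold)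
  moreover have "CL_proj F L N (n - 1) \<in> linear_maps F (CL F L (n - 1)) (CL F (quotient_alg L N) (n - 1))"
    unfolding CL_proj_eq_tpow_map by (rule tpow_map(1)[OF L' Q' coset_linear[OF L' S]])
  ultimately show ?thesis
    unfolding cone_def eq
    using CL_boundary(1)[OF L, of "n - 1", unfolded eq] CL_boundary(1)[OF Q]
    by (auto intro!: linear_maps_Pair linear_maps_uminus linear_maps_add module_tpow L' Q'
        linear_maps_comp[OF linear_maps_fst] linear_maps_comp[OF linear_maps_snd])
qed

context
  fixes F :: "('f, 'r) ring_scheme" and L :: "('f, 'v, 'm) module_scheme" and N :: "'v set"
  assumes L: "leibniz_algebra F L" and N: "leibniz_ideal F L N"
begin

private lemma L': "module F L" by (rule leibniz_algebra_module[OF L])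
private lemma Q: "leibniz_algebra F (quotient_alg L N)" by (rule leibniz_algebra_quotient[OF L N])
private lemma Q': "module F (quotient_alg L N)" by (rule leibniz_algebra_module[OF Q])
private lemma S: "submodule N F L" using N by (simp add: leibniz_ideal_def)

lemma CL_proj_linear: "CL_proj F L N n \<in> linear_maps F (CL F L n) (CL F (quotient_alg L N) n)"
  unfolding CL_proj_eq_tpow_map by (rule tpow_map(1)[OF L' Q' coset_linear[OF L' S]])

lemma CL_proj_boundary:
  "t \<in> carrier (CL F L n) \<Longrightarrow>
    CL_boundary F (quotient_alg L N) n (CL_proj F L N n t) = CL_proj F L N (n - 1) (CL_boundary F L n t)"
  unfolding CL_proj_eq_tpow_map by (rule CL_boundary_natural[OF L Q coset_leibniz_hom[OF L N]])

lemma CL_proj_surj: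
  assumes "t \<in> carrier (CL F (quotient_alg L N) n)"
  obtains s where "s \<in> carrier (CL F L n)" "CL_proj F L N n s = t"
  unfolding CL_proj_eq_tpow_map
  by (rule tpow_map_surj[OF L' Q' coset_linear[OF L' S] _ assms]) (auto simp: quotient_alg_simps)

lemma rel_chains_submodule: "submodule (rel_chains F L N) F (CL F L 3)"
  unfolding rel_chains_def by (rule submodule_kernel[OF CL_proj_linear module_tpow[OF L'] module_tpow[OF Q']])

lemma rel_cycles_submodule: "submodule (rel_cycles F L N) F (CL F L 2)"
proof -
  have "rel_cycles F L N = \<Inter>{{a \<in> carrier (CL F L 2). CL_boundary F L 2 a = \<zero>\<^bsub>CL F L 1\<^esub>},
    {a \<in> carrier (CL F L 2). CL_proj F L N 2 a = \<zero>\<^bsub>CL F (quotient_alg L N) 2\<^esub>}}"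
    by (auto simp: rel_cycles_def)
  also have "submodule \<dots> F (CL F L 2)"
    using submodule_kernel[OF CL_boundary(1)[OF L, where n = 2, simplified] module_tpow[OF L'] module_tpow[OF L']]
      submodule_kernel[OF CL_proj_linear module_tpow[OF L'] module_tpow[OF Q']]
    by (intro submodule_Inter[OF module_tpow[OF L']]) auto
  finally show ?thesis .
qed

lemma rel_boundaries_submodule: "submodule (rel_boundaries F L N) F (CL F L 2)"
  by (rule submodule_image[OF CL_boundary(1)[OF L, where n = 3, simplified] module_tpow[OF L'] module_tpow[OF L']
        rel_chains_submodule])

text \<open>
  The projection is a chain map, so the boundary of an element of its kernel is again in the kernel.
\<close>

lemma rel_boundaries_subset: "rel_boundaries F L N \<subseteq> rel_cycles F L N"
proof
  fix a assume "a \<in> rel_boundaries F L N"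
  then obtain c where c: "c \<in> carrier (CL F L 3)" "CL_proj F L N 3 c = \<zero>\<^bsub>CL F (quotient_alg L N) 3\<^esub>"
    and a: "a = CL_boundary F L 3 c" by (auto simp: rel_chains_def)
  have "CL_proj F L N 2 a = \<zero>\<^bsub>CL F (quotient_alg L N) 2\<^esub>"
    using CL_proj_boundary[OF c(1)] c(2) a
      linear_maps_zero_neg(1)[OF CL_boundary(1)[OF Q, where n = 3] module_tpow[OF Q'] module_tpow[OF Q']]
    by simp
  moreover have "a \<in> carrier (CL F L 2)"
    using linear_mapsD(1)[OF CL_boundary(1)[OF L, where n = 3] c(1)] a by simp
  ultimately show "a \<in> rel_cycles F L N"
    using boundary_boundary_2[OF L c(1)] a by (simp add: rel_cycles_def)
qed

lemma module_rel_cycle_space: "module F (rel_cycle_space F L N)"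
  by (rule module_restrict[OF module_tpow[OF L'] rel_cycles_submodule])

lemma rel_boundaries_submodule_of_cycles: "submodule (rel_boundaries F L N) F (rel_cycle_space F L N)"
  by (rule submodule_restrict[OF module_tpow[OF L'] rel_cycles_submodule rel_boundaries_submodule rel_boundaries_subset])

lemma module_HL2_kernel: "module F (HL2_kernel F L N)"
  by (rule module_quotient_alg[OF module_rel_cycle_space rel_boundaries_submodule_of_cycles])

definition "cone_cycles = {z \<in> carrier (cone F L N 3). cone_boundary F L N 3 z = \<zero>\<^bsub>cone F L N 2\<^esub>}"
definition "cone_boundaries = cone_boundary F L N 4 ` carrier (cone F L N 4)"

lemma HL_rel_2_eq: "HL_rel F 2 L N = quotient_alg ((cone F L N 3)\<lparr>carrier := cone_cycles\<rparr>) cone_boundaries"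
  by (simp add: HL_rel_def chain_homology_def cone_cycles_def cone_boundaries_def)

private lemma module_cone: "module F (cone F L N n)"
  unfolding cone_def by (intro module_direct_sum module_tpow L' Q')

private lemma cone_cycles_submodule: "submodule cone_cycles F (cone F L N 3)"
  unfolding cone_cycles_def
  by (rule submodule_kernel[OF cone_boundary_linear[OF L N, where n = 3, simplified] module_cone module_cone])

private lemma cone_boundaries_submodule: "submodule cone_boundaries F (cone F L N 3)"
proof -
  interpret C: module F "cone F L N 4" by (rule module_cone)
  show ?thesis unfolding cone_boundaries_def
    by (rule submodule_image[OF cone_boundary_linear[OF L N, where n = 4, simplified] module_cone module_cone
          C.carrier_is_submodule])
qed

private lemma mem_cone_cycles:
  "(a, b) \<in> cone_cycles \<longleftrightarrow> a \<in> carrier (CL F L 2) \<and> b \<in> carrier (CL F (quotient_alg L N) 3) \<and>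
    CL_boundary F L 2 a = \<zero>\<^bsub>CL F L 1\<^esub> \<and>
    CL_boundary F (quotient_alg L N) 3 b \<oplus>\<^bsub>CL F (quotient_alg L N) 2\<^esub> CL_proj F L N 2 a = \<zero>\<^bsub>CL F (quotient_alg L N) 2\<^esub>"
proof -
  interpret T: module F "CL F L 1" by (rule module_tpow[OF L'])
  have "\<ominus>\<^bsub>CL F L 1\<^esub> CL_boundary F L 2 a = \<zero>\<^bsub>CL F L 1\<^esub> \<longleftrightarrow> CL_boundary F L 2 a = \<zero>\<^bsub>CL F L 1\<^esub>"
    if "a \<in> carrier (CL F L 2)"
    by (rule T.add.inv_eq_1_iff) (use linear_mapsD(1)[OF CL_boundary(1)[OF L, where n = 2] that] in simp)
  then show ?thesis
    by (auto simp: cone_cycles_def cone_def cone_boundary_def direct_sum_simps)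
qed

private lemma boundary_of_cone:
  assumes "c \<in> carrier (CL F L 3)"
  shows "(\<ominus>\<^bsub>CL F L 2\<^esub> CL_boundary F L 3 c, CL_proj F L N 3 c) \<in> cone_boundaries"
proof -
  interpret D: module F "CL F (quotient_alg L N) 4" by (rule module_tpow[OF Q'])
  interpret D3: module F "CL F (quotient_alg L N) 3" by (rule module_tpow[OF Q'])
  have "(c, \<zero>\<^bsub>CL F (quotient_alg L N) 4\<^esub>) \<in> carrier (cone F L N 4)"
    using assms by (simp add: cone_def direct_sum_simps)
  moreover have "cone_boundary F L N 4 (c, \<zero>\<^bsub>CL F (quotient_alg L N) 4\<^esub>) =
      (\<ominus>\<^bsub>CL F L 2\<^esub> CL_boundary F L 3 c, CL_proj F L N 3 c)"
    using linear_maps_zero_neg(1)[OF CL_boundary(1)[OF Q, where n = 4] module_tpow[OF Q'] module_tpow[OF Q']]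
      linear_mapsD(1)[OF CL_proj_linear assms]
    by (simp add: cone_boundary_def)
  ultimately show ?thesis unfolding cone_boundaries_def by (metis imageI)
qed

text \<open>
  A boundary in the cone also involves a chain \<open>e\<close> of degree \<open>4\<close> in the quotient.  It can be absorbed:
  lift \<open>e\<close> to \<open>e'\<close> and replace \<open>c\<close> by \<open>\<partial> e' + c\<close>, which has the same boundary because \<open>\<partial> \<partial> = 0\<close>.
\<close>

private lemma cone_boundariesE:
  assumes "z \<in> cone_boundaries"
  obtains c where "c \<in> carrier (CL F L 3)" "z = (\<ominus>\<^bsub>CL F L 2\<^esub> CL_boundary F L 3 c, CL_proj F L N 3 c)"
proof -
  interpret C2: module F "CL F L 2" by (rule module_tpow[OF L'])
  interpret C3: module F "CL F L 3" by (rule module_tpow[OF L'])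
  obtain c e where c: "c \<in> carrier (CL F L 3)" and e: "e \<in> carrier (CL F (quotient_alg L N) 4)"
    and z: "z = (\<ominus>\<^bsub>CL F L 2\<^esub> CL_boundary F L 3 c,
      CL_boundary F (quotient_alg L N) 4 e \<oplus>\<^bsub>CL F (quotient_alg L N) 3\<^esub> CL_proj F L N 3 c)"
    using assms by (auto simp: cone_boundaries_def cone_def cone_boundary_def direct_sum_simps)
  obtain e' where e': "e' \<in> carrier (CL F L 4)" "CL_proj F L N 4 e' = e" using CL_proj_surj[OF e] .
  have de: "CL_boundary F L 4 e' \<in> carrier (CL F L 3)"
    using linear_mapsD(1)[OF CL_boundary(1)[OF L, where n = 4] e'(1)] by simp
  have "CL_boundary F (quotient_alg L N) 4 e = CL_proj F L N 3 (CL_boundary F L 4 e')"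
    using CL_proj_boundary[OF e'(1)] e'(2) by simp
  then have "CL_proj F L N 3 (CL_boundary F L 4 e' \<oplus>\<^bsub>CL F L 3\<^esub> c) =
      CL_boundary F (quotient_alg L N) 4 e \<oplus>\<^bsub>CL F (quotient_alg L N) 3\<^esub> CL_proj F L N 3 c"
    using linear_mapsD(2)[OF CL_proj_linear de c] by simp
  moreover have "CL_boundary F L 3 (CL_boundary F L 4 e' \<oplus>\<^bsub>CL F L 3\<^esub> c) = CL_boundary F L 3 c"
    using linear_mapsD(2)[OF CL_boundary(1)[OF L, where n = 3] de c] boundary_boundary_3[OF L e'(1)]
      linear_mapsD(1)[OF CL_boundary(1)[OF L, where n = 3] c] by simp
  ultimately show ?thesis using that[of "CL_boundary F L 4 e' \<oplus>\<^bsub>CL F L 3\<^esub> c"] de c z by simp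
qed

private lemma cone_boundaries_subset: "cone_boundaries \<subseteq> cone_cycles"
proof
  fix z assume "z \<in> cone_boundaries"
  then obtain c where c: "c \<in> carrier (CL F L 3)"
    and z: "z = (\<ominus>\<^bsub>CL F L 2\<^esub> CL_boundary F L 3 c, CL_proj F L N 3 c)" by (rule cone_boundariesE)
  interpret C1: module F "CL F L 1" by (rule module_tpow[OF L'])
  interpret C2: module F "CL F L 2" by (rule module_tpow[OF L'])
  interpret D2: module F "CL F (quotient_alg L N) 2" by (rule module_tpow[OF Q'])
  have dc: "CL_boundary F L 3 c \<in> carrier (CL F L 2)"
    using linear_mapsD(1)[OF CL_boundary(1)[OF L, where n = 3] c] by simp
  have "CL_boundary F L 2 (\<ominus>\<^bsub>CL F L 2\<^esub> CL_boundary F L 3 c) = \<zero>\<^bsub>CL F L 1\<^esub>"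
    using linear_maps_zero_neg(2)[OF CL_boundary(1)[OF L, where n = 2, simplified] C2.module_axioms C1.module_axioms dc]
      boundary_boundary_2[OF L c] by simp
  moreover have "CL_proj F L N 2 (\<ominus>\<^bsub>CL F L 2\<^esub> CL_boundary F L 3 c) =
      \<ominus>\<^bsub>CL F (quotient_alg L N) 2\<^esub> CL_boundary F (quotient_alg L N) 3 (CL_proj F L N 3 c)"
    using linear_maps_zero_neg(2)[OF CL_proj_linear C2.module_axioms D2.module_axioms dc] CL_proj_boundary[OF c] by simp
  moreover have "CL_boundary F (quotient_alg L N) 3 (CL_proj F L N 3 c) \<in> carrier (CL F (quotient_alg L N) 2)"
    using linear_mapsD(1)[OF CL_boundary(1)[OF Q, where n = 3] linear_mapsD(1)[OF CL_proj_linear c]] by simp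
  ultimately show "z \<in> cone_cycles"
    using z dc linear_mapsD(1)[OF CL_proj_linear c] by (simp add: mem_cone_cycles D2.M.r_neg)
qed

private lemma module_cone_cycles: "module F ((cone F L N 3)\<lparr>carrier := cone_cycles\<rparr>)"
  by (rule module_restrict[OF module_cone cone_cycles_submodule])

private lemma cone_boundaries_submodule_of_cycles: "submodule cone_boundaries F ((cone F L N 3)\<lparr>carrier := cone_cycles\<rparr>)"
  by (rule submodule_restrict[OF module_cone cone_cycles_submodule cone_boundaries_submodule cone_boundaries_subset])

lemma module_HL_rel_2: "module F (HL_rel F 2 L N)"
  unfolding HL_rel_2_eq by (rule module_quotient_alg[OF module_cone_cycles cone_boundaries_submodule_of_cycles])

lemma trivial_bracket_HL_rel_2: "trivial_bracket (HL_rel F 2 L N)"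
proof -
  have "trivial_bracket (cone F L N 3)"
    unfolding cone_def by (intro trivial_bracket_direct_sum trivial_bracket_tpow L' Q')
  then show ?thesis
    unfolding HL_rel_2_eq
    by (intro trivial_bracket_quotient[OF module_cone_cycles cone_boundaries_submodule_of_cycles] trivial_bracket_restrict)
      (auto simp: cone_cycles_def)
qed

text \<open>
  The isomorphism sends \<open>a\<close> to the class of \<open>(a, 0)\<close>.  For surjectivity, lift the second component of a
  cycle \<open>(a, b)\<close> to \<open>c\<close>; subtracting the boundary \<open>(- \<partial> c, b)\<close> of \<open>(c, 0)\<close> leaves \<open>(a + \<partial> c, 0)\<close>.
\<close>

theorem HL_rel_2_iso_kernel: "linear_iso F (HL2_kernel F L N) (HL_rel F 2 L N)"
proof -
  let ?Q = "quotient_alg L N"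
  let ?A = "(cone F L N 3)\<lparr>carrier := cone_cycles\<rparr>"
  interpret C2: module F "CL F L 2" by (rule module_tpow[OF L'])
  interpret D2: module F "CL F ?Q 2" by (rule module_tpow[OF Q'])
  interpret D3: module F "CL F ?Q 3" by (rule module_tpow[OF Q'])
  have d3: "CL_boundary F L 3 c \<in> carrier (CL F L 2)" if "c \<in> carrier (CL F L 3)" for c
    using linear_mapsD(1)[OF CL_boundary(1)[OF L, where n = 3] that] by simp
  have dQ0: "CL_boundary F ?Q 3 \<zero>\<^bsub>CL F ?Q 3\<^esub> = \<zero>\<^bsub>CL F ?Q 2\<^esub>"
    using linear_maps_zero_neg(1)[OF CL_boundary(1)[OF Q, where n = 3] module_tpow[OF Q'] module_tpow[OF Q']] by simp
  have cyc: "(a, \<zero>\<^bsub>CL F ?Q 3\<^esub>) \<in> cone_cycles \<longleftrightarrow> a \<in> rel_cycles F L N" for a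
    using linear_mapsD(1)[OF CL_proj_linear, of a 2]
    by (auto simp: mem_cone_cycles rel_cycles_def dQ0)
  define f where "f = (\<lambda>a. cone_boundaries +>\<^bsub>?A\<^esub> (a, \<zero>\<^bsub>CL F ?Q 3\<^esub>))"
  have i: "(\<lambda>a. (a, \<zero>\<^bsub>CL F ?Q 3\<^esub>)) \<in> linear_maps F (rel_cycle_space F L N) ?A"
    by (rule linear_mapsI) (auto simp: cyc cone_def direct_sum_simps)
  have f: "f \<in> linear_maps F (rel_cycle_space F L N) (HL_rel F 2 L N)"
    unfolding f_def HL_rel_2_eq
    by (rule linear_maps_comp[OF i coset_linear[OF module_cone_cycles cone_boundaries_submodule_of_cycles]])
  show ?thesis
  proof (rule linear_iso_quotient[OF module_rel_cycle_space module_HL_rel_2 f])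
    show "rel_boundaries F L N \<subseteq> carrier (rel_cycle_space F L N)" using rel_boundaries_subset by simp
    fix a assume "a \<in> carrier (rel_cycle_space F L N)"
    then have a: "(a, \<zero>\<^bsub>CL F ?Q 3\<^esub>) \<in> carrier ?A" using cyc by simp
    have "f a = \<zero>\<^bsub>HL_rel F 2 L N\<^esub> \<longleftrightarrow> (a, \<zero>\<^bsub>CL F ?Q 3\<^esub>) \<in> cone_boundaries"
      unfolding f_def HL_rel_2_eq quotient_alg_simps
      by (rule coset_eq_self_iff[OF module_cone_cycles cone_boundaries_submodule_of_cycles a])
    also have "\<dots> \<longleftrightarrow> a \<in> rel_boundaries F L N"
    proof
      assume "(a, \<zero>\<^bsub>CL F ?Q 3\<^esub>) \<in> cone_boundaries"
      then obtain c where c: "c \<in> carrier (CL F L 3)"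
        "(a, \<zero>\<^bsub>CL F ?Q 3\<^esub>) = (\<ominus>\<^bsub>CL F L 2\<^esub> CL_boundary F L 3 c, CL_proj F L N 3 c)"
        by (rule cone_boundariesE)
      then have "CL_boundary F L 3 c \<in> rel_boundaries F L N" by (auto simp: rel_chains_def)
      then show "a \<in> rel_boundaries F L N" using submoduleD(5)[OF rel_boundaries_submodule] c(2) by simp
    next
      assume "a \<in> rel_boundaries F L N"
      then have "\<ominus>\<^bsub>CL F L 2\<^esub> a \<in> rel_boundaries F L N" by (rule submoduleD(5)[OF rel_boundaries_submodule])
      then obtain c where c: "c \<in> carrier (CL F L 3)" "CL_proj F L N 3 c = \<zero>\<^bsub>CL F ?Q 3\<^esub>"
        "\<ominus>\<^bsub>CL F L 2\<^esub> a = CL_boundary F L 3 c" by (auto simp: rel_chains_def)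
      have "a \<in> carrier (CL F L 2)"
        using \<open>a \<in> rel_boundaries F L N\<close> submoduleD(1)[OF rel_boundaries_submodule] by auto
      then have "\<ominus>\<^bsub>CL F L 2\<^esub> CL_boundary F L 3 c = a" unfolding c(3)[symmetric] by (rule C2.M.minus_minus)
      then show "(a, \<zero>\<^bsub>CL F ?Q 3\<^esub>) \<in> cone_boundaries" using boundary_of_cone[OF c(1)] c(2) by simp
    qed
    finally show "f a = \<zero>\<^bsub>HL_rel F 2 L N\<^esub> \<longleftrightarrow> a \<in> rel_boundaries F L N" .
  next
    show "carrier (HL_rel F 2 L N) \<subseteq> f ` carrier (rel_cycle_space F L N)"
    proof
      fix k assume "k \<in> carrier (HL_rel F 2 L N)"
      then obtain z where z: "z \<in> cone_cycles" "k = cone_boundaries +>\<^bsub>?A\<^esub> z"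
        by (auto simp: HL_rel_2_eq quotient_alg_simps)
      obtain a b where ab: "z = (a, b)" by (cases z)
      then have a: "a \<in> carrier (CL F L 2)" and b: "b \<in> carrier (CL F ?Q 3)" using z mem_cone_cycles by auto
      obtain c where c: "c \<in> carrier (CL F L 3)" "CL_proj F L N 3 c = b" using CL_proj_surj[OF b] .
      let ?d = "(\<ominus>\<^bsub>CL F L 2\<^esub> CL_boundary F L 3 c, b)"
      have d: "?d \<in> cone_boundaries" using boundary_of_cone[OF c(1)] c(2) by simp
      have diff: "z \<ominus>\<^bsub>cone F L N 3\<^esub> ?d = (a \<oplus>\<^bsub>CL F L 2\<^esub> CL_boundary F L 3 c, \<zero>\<^bsub>CL F ?Q 3\<^esub>)"
        unfolding ab cone_def
        using a b d3[OF c(1)] direct_sum_minus[OF C2.module_axioms D3.module_axioms, of a b "\<ominus>\<^bsub>CL F L 2\<^esub> CL_boundary F L 3 c" b]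
        by (simp add: a_minus_def D3.M.r_neg)
      let ?a = "a \<oplus>\<^bsub>CL F L 2\<^esub> CL_boundary F L 3 c"
      have "z \<ominus>\<^bsub>cone F L N 3\<^esub> ?d \<in> cone_cycles"
        using submoduleD(6)[OF cone_cycles_submodule z(1)] d cone_boundaries_subset by blast
      then have a': "?a \<in> rel_cycles F L N" using cyc diff by simp
      interpret A: module F ?A by (rule module_cone_cycles)
      interpret K: module F "cone F L N 3" by (rule module_cone)
      have zc: "z \<in> carrier (cone F L N 3)" and dc: "?d \<in> carrier (cone F L N 3)"
        using z(1) d submoduleD(1)[OF cone_cycles_submodule] submoduleD(1)[OF cone_boundaries_submodule] by auto
      have "z \<ominus>\<^bsub>?A\<^esub> (?a, \<zero>\<^bsub>CL F ?Q 3\<^esub>) \<in> cone_boundaries"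
      proof -
        have "z \<ominus>\<^bsub>?A\<^esub> (?a, \<zero>\<^bsub>CL F ?Q 3\<^esub>) = z \<ominus>\<^bsub>cone F L N 3\<^esub> (?a, \<zero>\<^bsub>CL F ?Q 3\<^esub>)"
          by (rule restrict_minus[OF module_cone cone_cycles_submodule z(1)]) (use cyc a' in simp)
        also have "\<dots> = ?d"
          unfolding diff[symmetric] using zc dc by algebra
        finally show ?thesis using d by simp
      qed
      then have "k = f ?a"
        unfolding f_def z(2)
        using coset_eq_iff[OF module_cone_cycles cone_boundaries_submodule_of_cycles] z(1) cyc a' by simp
      then show "k \<in> f ` carrier (rel_cycle_space F L N)" using a' by auto
    qed
  qed
qed

end

section \<open>Commutators and pairings\<close>

lemma leibniz_ideal_carrier:
  assumes "leibniz_algebra F L" shows "leibniz_ideal F L (carrier L)"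
proof -
  interpret L: leibniz_algebra F L by (rule assms)
  show ?thesis using L.carrier_is_submodule by (simp add: leibniz_ideal_def L.bracket_closed)
qed

lemma leibniz_idealD:
  assumes "leibniz_ideal F L N"
  shows "submodule N F L" "n \<in> N \<Longrightarrow> n \<in> carrier L"
    "\<lbrakk>x \<in> carrier L; n \<in> N\<rbrakk> \<Longrightarrow> x \<otimes>\<^bsub>L\<^esub> n \<in> N" "\<lbrakk>x \<in> carrier L; n \<in> N\<rbrakk> \<Longrightarrow> n \<otimes>\<^bsub>L\<^esub> x \<in> N"
  using assms submoduleD(1)[of N F L] by (auto simp: leibniz_ideal_def)

context
  fixes F :: "('f, 'r) ring_scheme" and L :: "('f, 'v, 'm) module_scheme" and N :: "'v set"
  assumes L: "leibniz_algebra F L" and N: "leibniz_ideal F L N"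
begin

private lemma gens: "(\<Union>x\<in>carrier L. \<Union>n\<in>N. {x \<otimes>\<^bsub>L\<^esub> n, n \<otimes>\<^bsub>L\<^esub> x}) \<subseteq> N"
  using leibniz_idealD[OF N] by auto

private lemma N_carrier: "N \<subseteq> carrier L"
  using leibniz_idealD(2)[OF N] by auto

lemma commutator_submodule: "submodule (commutator F L N) F L"
  unfolding commutator_def using gens N_carrier
  by (intro linear_span_submodule leibniz_algebra_module[OF L]) auto

lemma commutator_subset: "commutator F L N \<subseteq> N"
  unfolding commutator_def by (rule linear_span_minimal[OF gens leibniz_idealD(1)[OF N]])

lemma commutatorI:
  assumes "x \<in> carrier L" "n \<in> N"
  shows "x \<otimes>\<^bsub>L\<^esub> n \<in> commutator F L N" "n \<otimes>\<^bsub>L\<^esub> x \<in> commutator F L N"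
  unfolding commutator_def using assms by (auto intro!: subsetD[OF linear_span_superset])

lemma vanishes_on_commutator:
  assumes "f \<in> linear_maps F L U" "module F U"
    and "\<And>x n. \<lbrakk>x \<in> carrier L; n \<in> N\<rbrakk> \<Longrightarrow> f (x \<otimes>\<^bsub>L\<^esub> n) = \<zero>\<^bsub>U\<^esub>"
    and "\<And>x n. \<lbrakk>x \<in> carrier L; n \<in> N\<rbrakk> \<Longrightarrow> f (n \<otimes>\<^bsub>L\<^esub> x) = \<zero>\<^bsub>U\<^esub>"
    and "u \<in> commutator F L N"
  shows "f u = \<zero>\<^bsub>U\<^esub>"
proof (rule linear_map_vanishes_on_span[OF assms(1) leibniz_algebra_module[OF L] assms(2) _ _ assms(5)[unfolded commutator_def]])
  show "(\<Union>x\<in>carrier L. \<Union>n\<in>N. {x \<otimes>\<^bsub>L\<^esub> n, n \<otimes>\<^bsub>L\<^esub> x}) \<subseteq> carrier L" using gens N_carrier by auto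
qed (use assms(3,4) in auto)

lemma module_restrict_ideal: "module F (L\<lparr>carrier := N\<rparr>)"
  by (rule module_restrict[OF leibniz_algebra_module[OF L] leibniz_idealD(1)[OF N]])

lemma commutator_submodule_restrict: "submodule (commutator F L N) F (L\<lparr>carrier := N\<rparr>)"
  by (rule submodule_restrict[OF leibniz_algebra_module[OF L] leibniz_idealD(1)[OF N] commutator_submodule commutator_subset])

lemma module_ideal_bar: "module F (ideal_bar F L N)"
  unfolding ideal_bar_def by (rule module_quotient_alg[OF module_restrict_ideal commutator_submodule_restrict])

lemma ideal_class_linear: "ideal_class F L N \<in> linear_maps F (L\<lparr>carrier := N\<rparr>) (ideal_bar F L N)"
proof -
  have "ideal_class F L N = (\<lambda>x. commutator F L N +>\<^bsub>L\<lparr>carrier := N\<rparr>\<^esub> x)"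
    by (simp add: ideal_class_def fun_eq_iff a_r_coset_def r_coset_def)
  then show ?thesis
    unfolding ideal_bar_def using coset_linear[OF module_restrict_ideal commutator_submodule_restrict] by simp
qed

lemma ideal_bar_carrier: "carrier (ideal_bar F L N) = ideal_class F L N ` N"
  by (simp add: ideal_bar_def ideal_class_def quotient_alg_simps a_r_coset_def r_coset_def)

lemma ideal_class_eq_iff:
  "\<lbrakk>x \<in> N; y \<in> N\<rbrakk> \<Longrightarrow> ideal_class F L N x = ideal_class F L N y \<longleftrightarrow> x \<ominus>\<^bsub>L\<^esub> y \<in> commutator F L N"
  unfolding ideal_class_def
  using coset_eq_iff[OF leibniz_algebra_module[OF L] commutator_submodule] N_carrier by auto

lemma ideal_class_zero: "u \<in> commutator F L N \<Longrightarrow> ideal_class F L N u = \<zero>\<^bsub>ideal_bar F L N\<^esub>"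
  unfolding ideal_class_def ideal_bar_def quotient_alg_simps
  using coset_eq_self_iff[OF leibniz_algebra_module[OF L] commutator_submodule, of u]
    submoduleD(1)[OF commutator_submodule] by auto

end

text \<open>
  The abelianization is the case of the ideal \<open>N = L\<close>, so one set of lemmas serves all four factors of
  the cross term.
\<close>

lemma alg_bar_eq: "alg_bar F L = ideal_bar F L (carrier L)" "alg_class F L = ideal_class F L (carrier L)"
  by (auto simp: alg_bar_def ideal_bar_def alg_class_def ideal_class_def fun_eq_iff)

definition bar_pure ::
    "('f, 'r) ring_scheme \<Rightarrow> ('f, 'v, 'm) module_scheme \<Rightarrow> 'v set \<Rightarrow> ('f, 'w, 'n) module_scheme \<Rightarrow> 'w set
      \<Rightarrow> 'v \<Rightarrow> 'w \<Rightarrow> ('v set \<times> 'w set \<Rightarrow> 'f) set"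
  where "bar_pure F L N M J u w =
    pure_tensor F (ideal_bar F L N) (ideal_bar F M J) (ideal_class F L N u) (ideal_class F M J w)"

abbreviation (input) "bar_tensor F L N M J \<equiv> tensor F (ideal_bar F L N) (ideal_bar F M J)"

lemma bilinear_maps_comp:
  assumes "f \<in> bilinear_maps F V W U" "g \<in> linear_maps F U U'"
  shows "(\<lambda>v w. g (f v w)) \<in> bilinear_maps F V W U'"
  using bilinear_mapsD[OF assms(1)] by (intro bilinear_mapsI linear_maps_comp[OF _ assms(2)]) auto

lemma bilinear_maps_comp2:
  assumes "f \<in> bilinear_maps F V W U" "g \<in> linear_maps F V' V" "h \<in> linear_maps F W' W"
  shows "(\<lambda>v w. f (g v) (h w)) \<in> bilinear_maps F V' W' U"
proof (rule bilinear_mapsI)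
  show "(\<lambda>v. f (g v) (h w)) \<in> linear_maps F V' U" if "w \<in> carrier W'" for w
    by (rule linear_maps_comp[OF assms(2) bilinear_mapsD(1)[OF assms(1) linear_mapsD(1)[OF assms(3) that]]])
  show "(\<lambda>w. f (g v) (h w)) \<in> linear_maps F W' U" if "v \<in> carrier V'" for v
    by (rule linear_maps_comp[OF assms(3) bilinear_mapsD(2)[OF assms(1) linear_mapsD(1)[OF assms(2) that]]])
qed

lemma bilinear_maps_add:
  assumes "f \<in> bilinear_maps F V W U" "g \<in> bilinear_maps F V W U" "module F U"
  shows "(\<lambda>v w. f v w \<oplus>\<^bsub>U\<^esub> g v w) \<in> bilinear_maps F V W U"
  using bilinear_mapsD[OF assms(1)] bilinear_mapsD[OF assms(2)]
  by (intro bilinear_mapsI linear_maps_add assms(3)) auto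

lemma linear_maps_restrict:
  assumes "f \<in> linear_maps F V W" "N \<subseteq> carrier V"
  shows "f \<in> linear_maps F (V\<lparr>carrier := N\<rparr>) W"
  using linear_mapsD[OF assms(1)] subsetD[OF assms(2)] by (intro linear_mapsI) simp_all

lemma bilinear_maps_restrict:
  assumes "f \<in> bilinear_maps F V W U" "N \<subseteq> carrier V" "M \<subseteq> carrier W"
  shows "f \<in> bilinear_maps F (V\<lparr>carrier := N\<rparr>) (W\<lparr>carrier := M\<rparr>) U"
proof (rule bilinear_mapsI)
  show "(\<lambda>v. f v w) \<in> linear_maps F (V\<lparr>carrier := N\<rparr>) U" if "w \<in> carrier (W\<lparr>carrier := M\<rparr>)" for w
    using that assms(2,3) by (intro linear_maps_restrict[OF bilinear_mapsD(1)[OF assms(1)]]) auto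
  show "(\<lambda>w. f v w) \<in> linear_maps F (W\<lparr>carrier := M\<rparr>) U" if "v \<in> carrier (V\<lparr>carrier := N\<rparr>)" for v
    using that assms(2,3) by (intro linear_maps_restrict[OF bilinear_mapsD(2)[OF assms(1)]]) auto
qed

context
  fixes F :: "('f, 'r) ring_scheme"
    and L :: "('f, 'v, 'm) module_scheme" and N :: "'v set"
    and M :: "('f, 'w, 'n) module_scheme" and J :: "'w set"
  assumes L: "leibniz_algebra F L" and N: "leibniz_ideal F L N"
    and M: "leibniz_algebra F M" and J: "leibniz_ideal F M J"
begin

lemma module_bar_tensor: "module F (bar_tensor F L N M J)"
  by (intro module_tensor module_ideal_bar L N M J)

lemma bar_pure_bilinear:
  "bar_pure F L N M J \<in> bilinear_maps F (L\<lparr>carrier := N\<rparr>) (M\<lparr>carrier := J\<rparr>) (bar_tensor F L N M J)"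
  unfolding bar_pure_def
  by (rule bilinear_maps_comp2[OF pure_tensor_bilinear[OF module_ideal_bar[OF L N] module_ideal_bar[OF M J]]
        ideal_class_linear[OF L N] ideal_class_linear[OF M J]])

lemma bar_pure_zero:
  assumes "u \<in> N" "w \<in> J" "u \<in> commutator F L N \<or> w \<in> commutator F M J"
  shows "bar_pure F L N M J u w = \<zero>\<^bsub>bar_tensor F L N M J\<^esub>"
proof -
  note B = pure_tensor_bilinear[OF module_ideal_bar[OF L N] module_ideal_bar[OF M J]]
  have "ideal_class F L N u \<in> carrier (ideal_bar F L N)" "ideal_class F M J w \<in> carrier (ideal_bar F M J)"
    using assms(1,2) by (auto simp: ideal_bar_carrier[OF L N] ideal_bar_carrier[OF M J])
  then show ?thesis
    using assms(3) ideal_class_zero[OF L N] ideal_class_zero[OF M J]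
      linear_maps_zero_neg(1)[OF bilinear_mapsD(1)[OF B] module_ideal_bar[OF L N] module_bar_tensor]
      linear_maps_zero_neg(1)[OF bilinear_mapsD(2)[OF B] module_ideal_bar[OF M J] module_bar_tensor]
    by (auto simp: bar_pure_def)
qed

lemma bar_tensor_spanned:
  assumes "submodule H F (bar_tensor F L N M J)" "\<And>u w. \<lbrakk>u \<in> N; w \<in> J\<rbrakk> \<Longrightarrow> bar_pure F L N M J u w \<in> H"
  shows "carrier (bar_tensor F L N M J) \<subseteq> H"
  using assms
  by (intro tensor_spanned[OF module_ideal_bar[OF L N] module_ideal_bar[OF M J]])
    (auto simp: ideal_bar_carrier[OF L N] ideal_bar_carrier[OF M J] bar_pure_def)

text \<open>
  A bilinear map that vanishes on commutators depends only on the classes of its arguments, so it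
  may be evaluated on arbitrarily chosen representatives.
\<close>

lemma bar_tensor_lift:
  assumes U: "module F U"
    and f: "f \<in> bilinear_maps F (L\<lparr>carrier := N\<rparr>) (M\<lparr>carrier := J\<rparr>) U"
    and f0: "\<And>u w. \<lbrakk>u \<in> N; w \<in> J; u \<in> commutator F L N \<or> w \<in> commutator F M J\<rbrakk> \<Longrightarrow> f u w = \<zero>\<^bsub>U\<^esub>"
  obtains g where "g \<in> linear_maps F (bar_tensor F L N M J) U"
    "\<And>u w. \<lbrakk>u \<in> N; w \<in> J\<rbrakk> \<Longrightarrow> g (bar_pure F L N M J u w) = f u w"
proof -
  interpret U: module F U by (rule U)
  let ?V = "L\<lparr>carrier := N\<rparr>" and ?W = "M\<lparr>carrier := J\<rparr>"
  note V = module_restrict_ideal[OF L N] and W = module_restrict_ideal[OF M J]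
  note fl = bilinear_mapsD(1)[OF f, simplified] and fr = bilinear_mapsD(2)[OF f, simplified]
  have fc: "f u w \<in> carrier U" if "u \<in> N" "w \<in> J" for u w using bilinear_mapsD(3)[OF f] that by simp
  have congl: "f u w = f u' w" if "u \<in> N" "u' \<in> N" "w \<in> J" "ideal_class F L N u = ideal_class F L N u'" for u u' w
  proof -
    have d: "u \<ominus>\<^bsub>L\<^esub> u' \<in> commutator F L N" using ideal_class_eq_iff[OF L N] that by simp
    have "f (u \<ominus>\<^bsub>?V\<^esub> u') w = f u w \<ominus>\<^bsub>U\<^esub> f u' w"
      using linear_maps_zero_neg(3)[OF fl V U] that by simp
    moreover have "u \<ominus>\<^bsub>?V\<^esub> u' = u \<ominus>\<^bsub>L\<^esub> u'"
      by (rule restrict_minus[OF leibniz_algebra_module[OF L] leibniz_idealD(1)[OF N] that(1,2)])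
    ultimately have "f u w \<ominus>\<^bsub>U\<^esub> f u' w = \<zero>\<^bsub>U\<^esub>"
      using f0[of "u \<ominus>\<^bsub>L\<^esub> u'" w] d commutator_subset[OF L N] that(3) by auto
    then show ?thesis using fc that U.minus_eq_zero_iff by simp
  qed
  have congr: "f u w = f u w'" if "u \<in> N" "w \<in> J" "w' \<in> J" "ideal_class F M J w = ideal_class F M J w'" for u w w'
  proof -
    have d: "w \<ominus>\<^bsub>M\<^esub> w' \<in> commutator F M J" using ideal_class_eq_iff[OF M J] that by simp
    have "f u (w \<ominus>\<^bsub>?W\<^esub> w') = f u w \<ominus>\<^bsub>U\<^esub> f u w'"
      using linear_maps_zero_neg(3)[OF fr W U] that by simp
    moreover have "w \<ominus>\<^bsub>?W\<^esub> w' = w \<ominus>\<^bsub>M\<^esub> w'"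
      by (rule restrict_minus[OF leibniz_algebra_module[OF M] leibniz_idealD(1)[OF J] that(2,3)])
    ultimately have "f u w \<ominus>\<^bsub>U\<^esub> f u w' = \<zero>\<^bsub>U\<^esub>"
      using f0[of u "w \<ominus>\<^bsub>M\<^esub> w'"] d commutator_subset[OF M J] that(1) by auto
    then show ?thesis using fc that U.minus_eq_zero_iff by simp
  qed
  define r where "r = (\<lambda>k. SOME u. u \<in> N \<and> ideal_class F L N u = k)"
  define s where "s = (\<lambda>k. SOME w. w \<in> J \<and> ideal_class F M J w = k)"
  have r: "r (ideal_class F L N u) \<in> N \<and> ideal_class F L N (r (ideal_class F L N u)) = ideal_class F L N u" if "u \<in> N" for u
    unfolding r_def by (rule someI_ex) (use that in auto)
  have s: "s (ideal_class F M J u) \<in> J \<and> ideal_class F M J (s (ideal_class F M J u)) = ideal_class F M J u" if "u \<in> J" for u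
    unfolding s_def by (rule someI_ex) (use that in auto)
  define f' where "f' = (\<lambda>k l. f (r k) (s l))"
  have f': "f' (ideal_class F L N u) (ideal_class F M J w) = f u w" if "u \<in> N" "w \<in> J" for u w
    unfolding f'_def using congl[of "r (ideal_class F L N u)" u] congr[of u "s (ideal_class F M J w)" w] r s that by simp
  note cl = ideal_class_linear[OF L N] and cm = ideal_class_linear[OF M J]
  note cl' = linear_mapsD(2,3)[OF cl, simplified, symmetric] and cm' = linear_mapsD(2,3)[OF cm, simplified, symmetric]
  note sub = submoduleD[OF leibniz_idealD(1)[OF N]] submoduleD[OF leibniz_idealD(1)[OF J]]
  have "f' \<in> bilinear_maps F (ideal_bar F L N) (ideal_bar F M J) U"
  proof (rule bilinear_mapsI)
    fix l assume "l \<in> carrier (ideal_bar F M J)"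
    then obtain w where w: "l = ideal_class F M J w" "w \<in> J" by (auto simp: ideal_bar_carrier[OF M J])
    show "(\<lambda>k. f' k l) \<in> linear_maps F (ideal_bar F L N) U"
      using w sub linear_mapsD[OF fl[OF w(2)]]
      by (intro linear_mapsI) (auto simp: ideal_bar_carrier[OF L N] cl' f' fc)
  next
    fix k assume "k \<in> carrier (ideal_bar F L N)"
    then obtain u where u: "k = ideal_class F L N u" "u \<in> N" by (auto simp: ideal_bar_carrier[OF L N])
    show "(\<lambda>l. f' k l) \<in> linear_maps F (ideal_bar F M J) U"
      using u sub linear_mapsD[OF fr[OF u(2)]]
      by (intro linear_mapsI) (auto simp: ideal_bar_carrier[OF M J] cm' f' fc)
  qed
  then obtain g where g: "g \<in> linear_maps F (bar_tensor F L N M J) U"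
    "\<And>k l. \<lbrakk>k \<in> carrier (ideal_bar F L N); l \<in> carrier (ideal_bar F M J)\<rbrakk> \<Longrightarrow>
      g (pure_tensor F (ideal_bar F L N) (ideal_bar F M J) k l) = f' k l"
    using tensor_lift[OF module_ideal_bar[OF L N] module_ideal_bar[OF M J] U] by blast
  show ?thesis
    by (rule that[OF g(1)])
      (simp add: bar_pure_def g(2) ideal_bar_carrier[OF L N] ideal_bar_carrier[OF M J] f')
qed

end

text \<open>
  The pairings of \<open>L\<close> with \<open>M\<close> whose restrictions to \<open>N \<times> M\<close> and \<open>L \<times> J\<close> factor through the tensor
  products of the abelian quotients.  For \<open>U\<close> the chains of degree \<open>2\<close> modulo relative boundaries, the four conditions
  hold because these products are boundaries of mixed words.
\<close>

definition cross_pairings ::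
    "('f, 'r) ring_scheme \<Rightarrow> ('f, 'v, 'm) module_scheme \<Rightarrow> 'v set \<Rightarrow> ('f, 'w, 'n) module_scheme \<Rightarrow> 'w set
      \<Rightarrow> ('f, 'u, 'k) module_scheme \<Rightarrow> ('v \<Rightarrow> 'w \<Rightarrow> 'u) set"
  where "cross_pairings F L N M J U = {f \<in> bilinear_maps F L M U.
    (\<forall>u\<in>commutator F L N. \<forall>w\<in>carrier M. f u w = \<zero>\<^bsub>U\<^esub>) \<and>
    (\<forall>u\<in>N. \<forall>w\<in>commutator F M (carrier M). f u w = \<zero>\<^bsub>U\<^esub>) \<and>
    (\<forall>u\<in>commutator F L (carrier L). \<forall>w\<in>J. f u w = \<zero>\<^bsub>U\<^esub>) \<and>
    (\<forall>u\<in>carrier L. \<forall>w\<in>commutator F M J. f u w = \<zero>\<^bsub>U\<^esub>)}"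

lemma cross_pairings_null:
  assumes "f \<in> cross_pairings F L N M J U"
  shows "f \<in> bilinear_maps F L M U"
    and "\<lbrakk>u \<in> N; w \<in> carrier M; u \<in> commutator F L N \<or> w \<in> commutator F M (carrier M)\<rbrakk> \<Longrightarrow> f u w = \<zero>\<^bsub>U\<^esub>"
    and "\<lbrakk>u \<in> carrier L; w \<in> J; u \<in> commutator F L (carrier L) \<or> w \<in> commutator F M J\<rbrakk> \<Longrightarrow> f u w = \<zero>\<^bsub>U\<^esub>"
  using assms by (auto simp: cross_pairings_def)

text \<open>
  The pairings induced by \<open>a\<close> and \<open>b\<close> agree on \<open>N \<times> J\<close>, the relation that the antidiagonal
  generators impose, and so have a common extension to \<open>L \<times> M\<close>.
\<close>

lemma cross_pairings_extend:
  assumes F: "field F"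
    and L: "leibniz_algebra F L" and N: "leibniz_ideal F L N"
    and M: "leibniz_algebra F M" and J: "leibniz_ideal F M J" and U: "module F U"
    and a: "a \<in> linear_maps F (bar_tensor F L N M (carrier M)) U"
    and b: "b \<in> linear_maps F (bar_tensor F L (carrier L) M J) U"
    and agree: "\<And>n m. \<lbrakk>n \<in> N; m \<in> J\<rbrakk> \<Longrightarrow>
      a (bar_pure F L N M (carrier M) n m) = b (bar_pure F L (carrier L) M J n m)"
  obtains \<theta> where "\<theta> \<in> cross_pairings F L N M J U"
    "\<And>n w. \<lbrakk>n \<in> N; w \<in> carrier M\<rbrakk> \<Longrightarrow> \<theta> n w = a (bar_pure F L N M (carrier M) n w)"
    "\<And>v m. \<lbrakk>v \<in> carrier L; m \<in> J\<rbrakk> \<Longrightarrow> \<theta> v m = b (bar_pure F L (carrier L) M J v m)"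
proof -
  note cL = leibniz_ideal_carrier[OF L] and cM = leibniz_ideal_carrier[OF M]
  note A = bilinear_maps_comp[OF bar_pure_bilinear[OF L N M cM] a, simplified]
  note B = bilinear_maps_comp[OF bar_pure_bilinear[OF L cL M J] b, simplified]
  obtain \<theta> where \<theta>: "\<theta> \<in> bilinear_maps F L M U"
    "\<And>n w. \<lbrakk>n \<in> N; w \<in> carrier M\<rbrakk> \<Longrightarrow> \<theta> n w = a (bar_pure F L N M (carrier M) n w)"
    "\<And>v m. \<lbrakk>v \<in> carrier L; m \<in> J\<rbrakk> \<Longrightarrow> \<theta> v m = b (bar_pure F L (carrier L) M J v m)"
    using bilinear_extension[OF F leibniz_algebra_module[OF L] leibniz_algebra_module[OF M] U
        leibniz_idealD(1)[OF N] leibniz_idealD(1)[OF J] A B agree] by blast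
  have a0: "a \<zero>\<^bsub>bar_tensor F L N M (carrier M)\<^esub> = \<zero>\<^bsub>U\<^esub>"
    by (rule linear_maps_zero_neg(1)[OF a module_bar_tensor[OF L N M cM] U])
  have b0: "b \<zero>\<^bsub>bar_tensor F L (carrier L) M J\<^esub> = \<zero>\<^bsub>U\<^esub>"
    by (rule linear_maps_zero_neg(1)[OF b module_bar_tensor[OF L cL M J] U])
  have "\<theta> \<in> cross_pairings F L N M J U"
    unfolding cross_pairings_def
  proof (intro CollectI conjI ballI)
    show "\<theta> u w = \<zero>\<^bsub>U\<^esub>" if "u \<in> commutator F L N" "w \<in> carrier M" for u w
    proof -
      have u: "u \<in> N" using that commutator_subset[OF L N] by blast
      show ?thesis using \<theta>(2)[OF u that(2)] bar_pure_zero[OF L N M cM u that(2)] that(1) a0 by simp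
    qed
    show "\<theta> u w = \<zero>\<^bsub>U\<^esub>" if "u \<in> N" "w \<in> commutator F M (carrier M)" for u w
    proof -
      have w: "w \<in> carrier M" using that commutator_subset[OF M cM] by blast
      show ?thesis using \<theta>(2)[OF that(1) w] bar_pure_zero[OF L N M cM that(1) w] that(2) a0 by simp
    qed
    show "\<theta> u w = \<zero>\<^bsub>U\<^esub>" if "u \<in> commutator F L (carrier L)" "w \<in> J" for u w
    proof -
      have u: "u \<in> carrier L" using that commutator_subset[OF L cL] by blast
      show ?thesis using \<theta>(3)[OF u that(2)] bar_pure_zero[OF L cL M J u that(2)] that(1) b0 by simp
    qed
    show "\<theta> u w = \<zero>\<^bsub>U\<^esub>" if "u \<in> carrier L" "w \<in> commutator F M J" for u w
    proof -
      have w: "w \<in> J" using that commutator_subset[OF M J] by blast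
      show ?thesis using \<theta>(3)[OF that(1) w] bar_pure_zero[OF L cL M J that(1) w] that(2) b0 by simp
    qed
  qed (rule \<theta>(1))
  then show ?thesis using that \<theta> by blast
qed

lemma cross_pairings_factor:
  assumes L: "leibniz_algebra F L" and N: "leibniz_ideal F L N"
    and M: "leibniz_algebra F M" and J: "leibniz_ideal F M J" and U: "module F U"
    and f: "f \<in> cross_pairings F L N M J U"
  obtains a b where "a \<in> linear_maps F (bar_tensor F L N M (carrier M)) U"
    "b \<in> linear_maps F (bar_tensor F L (carrier L) M J) U"
    "\<And>n w. \<lbrakk>n \<in> N; w \<in> carrier M\<rbrakk> \<Longrightarrow> a (bar_pure F L N M (carrier M) n w) = f n w"
    "\<And>v m. \<lbrakk>v \<in> carrier L; m \<in> J\<rbrakk> \<Longrightarrow> b (bar_pure F L (carrier L) M J v m) = f v m"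
proof -
  note cL = leibniz_ideal_carrier[OF L] and cM = leibniz_ideal_carrier[OF M]
  note fn = cross_pairings_null[OF f]
  have NL: "N \<subseteq> carrier L" and JM: "J \<subseteq> carrier M" using leibniz_idealD(2)[OF N] leibniz_idealD(2)[OF J] by auto
  obtain a where a: "a \<in> linear_maps F (bar_tensor F L N M (carrier M)) U"
    "\<And>n w. \<lbrakk>n \<in> N; w \<in> carrier M\<rbrakk> \<Longrightarrow> a (bar_pure F L N M (carrier M) n w) = f n w"
    using bar_tensor_lift[OF L N M cM U bilinear_maps_restrict[OF fn(1) NL order_refl] fn(2)] by blast
  obtain b where b: "b \<in> linear_maps F (bar_tensor F L (carrier L) M J) U"
    "\<And>v m. \<lbrakk>v \<in> carrier L; m \<in> J\<rbrakk> \<Longrightarrow> b (bar_pure F L (carrier L) M J v m) = f v m"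
    using bar_tensor_lift[OF L cL M J U bilinear_maps_restrict[OF fn(1) order_refl JM] fn(3)] by blast
  show ?thesis by (rule that[OF a(1) b(1) a(2) b(2)])
qed

section \<open>The universal property of the cross term\<close>

abbreviation (input) cross_quotient ::
    "('f, 'r) ring_scheme \<Rightarrow> ('f, 'a, 'm) module_scheme \<Rightarrow> 'a set
      \<Rightarrow> ('f, 'b, 'n) module_scheme \<Rightarrow> 'b set
      \<Rightarrow> ('f, ((('a set \<times> 'b set \<Rightarrow> 'f) set \<times> ('b set \<times> 'a set \<Rightarrow> 'f) set) \<times>
              (('a set \<times> 'b set \<Rightarrow> 'f) set \<times> ('b set \<times> 'a set \<Rightarrow> 'f) set)) set) module"
  where "cross_quotient F L N M J \<equiv> quotient_alg (cross_sum F L N M J) (cross_subalgebra F L N M J)"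

text \<open>
  The generators of \<^const>\<open>cross_subalgebra\<close>, with the negatives computed in each summand.
\<close>

definition cross_generators where
  "cross_generators F L N M J = (\<Union>n\<in>N. \<Union>m\<in>J.
    {((bar_pure F L N M (carrier M) n m, \<zero>\<^bsub>bar_tensor F M (carrier M) L N\<^esub>),
      (\<ominus>\<^bsub>bar_tensor F L (carrier L) M J\<^esub> bar_pure F L (carrier L) M J n m, \<zero>\<^bsub>bar_tensor F M J L (carrier L)\<^esub>)),
     ((\<zero>\<^bsub>bar_tensor F L N M (carrier M)\<^esub>, bar_pure F M (carrier M) L N m n),
      (\<zero>\<^bsub>bar_tensor F L (carrier L) M J\<^esub>, \<ominus>\<^bsub>bar_tensor F M J L (carrier L)\<^esub> bar_pure F M J L (carrier L) m n))})"

context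
  fixes F :: "('f, 'r) ring_scheme"
    and L :: "('f, 'a, 'm) module_scheme" and N :: "'a set"
    and M :: "('f, 'b, 'n) module_scheme" and J :: "'b set"
  assumes L: "leibniz_algebra F L" and N: "leibniz_ideal F L N"
    and M: "leibniz_algebra F M" and J: "leibniz_ideal F M J"
begin

private lemma cL: "leibniz_ideal F L (carrier L)" by (rule leibniz_ideal_carrier[OF L])
private lemma cM: "leibniz_ideal F M (carrier M)" by (rule leibniz_ideal_carrier[OF M])

private lemma T1: "module F (bar_tensor F L N M (carrier M))" by (rule module_bar_tensor[OF L N M cM])
private lemma T2: "module F (bar_tensor F M (carrier M) L N)" by (rule module_bar_tensor[OF M cM L N])
private lemma T3: "module F (bar_tensor F L (carrier L) M J)" by (rule module_bar_tensor[OF L cL M J])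
private lemma T4: "module F (bar_tensor F M J L (carrier L))" by (rule module_bar_tensor[OF M J L cL])

lemma cross_sum_eq: "cross_sum F L N M J =
  (bar_tensor F L N M (carrier M) \<boxplus> bar_tensor F M (carrier M) L N) \<boxplus>
  (bar_tensor F L (carrier L) M J \<boxplus> bar_tensor F M J L (carrier L))"
  by (simp add: cross_sum_def nonabelian_tensor_def alg_bar_eq)

lemma module_cross_sum: "module F (cross_sum F L N M J)"
  unfolding cross_sum_eq by (intro module_direct_sum T1 T2 T3 T4)

lemma trivial_bracket_cross_sum: "trivial_bracket (cross_sum F L N M J)"
  unfolding cross_sum_eq
  by (intro trivial_bracket_direct_sum trivial_bracket_tensor module_ideal_bar L M N J cL cM)

private lemma bar_pure_closed:
  "\<lbrakk>leibniz_algebra F L'; leibniz_ideal F L' N'; leibniz_algebra F M'; leibniz_ideal F M' J'; u \<in> N'; w \<in> J'\<rbrakk>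
    \<Longrightarrow> bar_pure F L' N' M' J' u w \<in> carrier (bar_tensor F L' N' M' J')"
  using bilinear_mapsD(3)[OF bar_pure_bilinear] by fastforce

lemma cross_generators_subset: "cross_generators F L N M J \<subseteq> carrier (cross_sum F L N M J)"
proof -
  interpret T1: module F "bar_tensor F L N M (carrier M)" by (rule T1)
  interpret T2: module F "bar_tensor F M (carrier M) L N" by (rule T2)
  interpret T3: module F "bar_tensor F L (carrier L) M J" by (rule T3)
  interpret T4: module F "bar_tensor F M J L (carrier L)" by (rule T4)
  show ?thesis
    using leibniz_idealD(2)[OF N] leibniz_idealD(2)[OF J]
    by (auto simp: cross_generators_def cross_sum_eq direct_sum_simps
        intro!: bar_pure_closed L M N J cL cM T3.a_inv_closed T4.a_inv_closed)
qed

text \<open>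
  The bracket is zero, so subalgebras are the same as subspaces.
\<close>

lemma cross_subalgebra_eq_span:
  "cross_subalgebra F L N M J = linear_span F (cross_sum F L N M J) (cross_generators F L N M J)"
proof -
  interpret T3: module F "bar_tensor F L (carrier L) M J" by (rule T3)
  interpret T4: module F "bar_tensor F M J L (carrier L)" by (rule T4)
  have "leibniz_subalgebra F (cross_sum F L N M J) = (\<lambda>H. submodule H F (cross_sum F L N M J))"
    using trivial_bracket_cross_sum submoduleD(1,2)[of _ F "cross_sum F L N M J"]
    by (auto simp: fun_eq_iff leibniz_subalgebra_def trivial_bracket_def subset_eq)
  moreover have "cross_subalgebra F L N M J =
      generated_subalgebra F (cross_sum F L N M J) (cross_generators F L N M J)"
  proof -
    have [simp]: "\<ominus>\<^bsub>bar_tensor F L (carrier L) M J \<boxplus> bar_tensor F M J L (carrier L)\<^esub>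
        (bar_pure F L (carrier L) M J n m, \<zero>\<^bsub>bar_tensor F M J L (carrier L)\<^esub>) =
        (\<ominus>\<^bsub>bar_tensor F L (carrier L) M J\<^esub> bar_pure F L (carrier L) M J n m, \<zero>\<^bsub>bar_tensor F M J L (carrier L)\<^esub>)"
      "\<ominus>\<^bsub>bar_tensor F L (carrier L) M J \<boxplus> bar_tensor F M J L (carrier L)\<^esub>
        (\<zero>\<^bsub>bar_tensor F L (carrier L) M J\<^esub>, bar_pure F M J L (carrier L) m n) =
        (\<zero>\<^bsub>bar_tensor F L (carrier L) M J\<^esub>, \<ominus>\<^bsub>bar_tensor F M J L (carrier L)\<^esub> bar_pure F M J L (carrier L) m n)"
      if "n \<in> N" "m \<in> J" for n m
      using that leibniz_idealD(2)[OF N] leibniz_idealD(2)[OF J]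
      by (simp_all add: direct_sum_uminus[OF T3 T4] bar_pure_closed L M N J cL cM)
    show ?thesis
      unfolding cross_subalgebra_def cross_generators_def Let_def
      by (intro arg_cong[where f = "generated_subalgebra F (cross_sum F L N M J)"] SUP_cong refl)
        (simp add: star_left_def star_right_def alg_bar_eq nonabelian_tensor_def bar_pure_def[symmetric])
  qed
  ultimately show ?thesis by (simp add: generated_subalgebra_def linear_span_def)
qed

lemma cross_subalgebra_submodule: "submodule (cross_subalgebra F L N M J) F (cross_sum F L N M J)"
  unfolding cross_subalgebra_eq_span by (rule linear_span_submodule[OF module_cross_sum cross_generators_subset])

lemma module_cross_quotient: "module F (cross_quotient F L N M J)"
  by (rule module_quotient_alg[OF module_cross_sum cross_subalgebra_submodule])

lemma trivial_bracket_cross_quotient: "trivial_bracket (cross_quotient F L N M J)"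
  by (rule trivial_bracket_quotient[OF module_cross_sum cross_subalgebra_submodule trivial_bracket_cross_sum])

text \<open>
  The pairings \<open>\<theta>12\<close> and \<open>\<theta>21\<close> are universal only on arguments of which one lies in the ideal: there
  their values generate the quotient, and there \<open>\<Gamma>\<close> carries them to the given pairings.  On all other
  arguments their values depend on a choice of retractions.
\<close>

lemma cross_quotient_universal:
  assumes U: "module F U"
    and m12: "\<mu>12 \<in> cross_pairings F L N M J U" and m21: "\<mu>21 \<in> cross_pairings F M J L N U"
  obtains \<theta>12 \<theta>21 \<Gamma> where
    "\<theta>12 \<in> cross_pairings F L N M J (cross_quotient F L N M J)"
    "\<theta>21 \<in> cross_pairings F M J L N (cross_quotient F L N M J)"
    "\<Gamma> \<in> linear_maps F (cross_quotient F L N M J) U"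
    "\<And>x y. \<lbrakk>x \<in> carrier L; y \<in> carrier M; x \<in> N \<or> y \<in> J\<rbrakk> \<Longrightarrow> \<Gamma> (\<theta>12 x y) = \<mu>12 x y"
    "\<And>x y. \<lbrakk>x \<in> carrier L; y \<in> carrier M; x \<in> N \<or> y \<in> J\<rbrakk> \<Longrightarrow> \<Gamma> (\<theta>21 y x) = \<mu>21 y x"
    "\<And>H. \<lbrakk>submodule H F (cross_quotient F L N M J);
      \<And>x y. \<lbrakk>x \<in> carrier L; y \<in> carrier M; x \<in> N \<or> y \<in> J\<rbrakk> \<Longrightarrow> \<theta>12 x y \<in> H \<and> \<theta>21 y x \<in> H\<rbrakk>
      \<Longrightarrow> carrier (cross_quotient F L N M J) \<subseteq> H"
proof -
  let ?T1 = "bar_tensor F L N M (carrier M)" and ?T2 = "bar_tensor F M (carrier M) L N"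
  let ?T3 = "bar_tensor F L (carrier L) M J" and ?T4 = "bar_tensor F M J L (carrier L)"
  let ?S = "cross_sum F L N M J" and ?C = "cross_quotient F L N M J"
  interpret T1: module F ?T1 by (rule T1)
  interpret T2: module F ?T2 by (rule T2)
  interpret T3: module F ?T3 by (rule T3)
  interpret T4: module F ?T4 by (rule T4)
  interpret S: module F ?S by (rule module_cross_sum)
  interpret C: module F ?C by (rule module_cross_quotient)
  interpret U: module F U by (rule U)
  have F: "field F" using L by (simp add: leibniz_algebra_def)
  have NL: "n \<in> carrier L" if "n \<in> N" for n using leibniz_idealD(2)[OF N that] .
  have JM: "m \<in> carrier M" if "m \<in> J" for m using leibniz_idealD(2)[OF J that] .
  note bp = bar_pure_closed[OF L N M cM] bar_pure_closed[OF M cM L N]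
    bar_pure_closed[OF L cL M J] bar_pure_closed[OF M J L cL]
  define q where "q = (\<lambda>z. cross_subalgebra F L N M J +>\<^bsub>?S\<^esub> z)"
  have q: "q \<in> linear_maps F ?S ?C"
    unfolding q_def by (rule coset_linear[OF module_cross_sum cross_subalgebra_submodule])
  have qsurj: "carrier ?C = q ` carrier ?S" by (simp add: q_def quotient_alg_simps)
  define i1 where "i1 = (\<lambda>t. q ((t, \<zero>\<^bsub>?T2\<^esub>), (\<zero>\<^bsub>?T3\<^esub>, \<zero>\<^bsub>?T4\<^esub>)))"
  define i2 where "i2 = (\<lambda>t. q ((\<zero>\<^bsub>?T1\<^esub>, t), (\<zero>\<^bsub>?T3\<^esub>, \<zero>\<^bsub>?T4\<^esub>)))"
  define i3 where "i3 = (\<lambda>t. q ((\<zero>\<^bsub>?T1\<^esub>, \<zero>\<^bsub>?T2\<^esub>), (t, \<zero>\<^bsub>?T4\<^esub>)))"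
  define i4 where "i4 = (\<lambda>t. q ((\<zero>\<^bsub>?T1\<^esub>, \<zero>\<^bsub>?T2\<^esub>), (\<zero>\<^bsub>?T3\<^esub>, t)))"
  have i: "i1 \<in> linear_maps F ?T1 ?C" "i2 \<in> linear_maps F ?T2 ?C" "i3 \<in> linear_maps F ?T3 ?C" "i4 \<in> linear_maps F ?T4 ?C"
    unfolding i1_def i2_def i3_def i4_def
    by (rule linear_maps_comp[OF _ q], (unfold cross_sum_eq)[1],
        (intro linear_maps_Pair linear_maps_id linear_maps_zero T1 T2 T3 T4)[1])+
  have split: "q ((t1, t2), (t3, t4)) = (i1 t1 \<oplus>\<^bsub>?C\<^esub> i2 t2) \<oplus>\<^bsub>?C\<^esub> (i3 t3 \<oplus>\<^bsub>?C\<^esub> i4 t4)"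
    if "t1 \<in> carrier ?T1" "t2 \<in> carrier ?T2" "t3 \<in> carrier ?T3" "t4 \<in> carrier ?T4" for t1 t2 t3 t4
  proof -
    let ?a1 = "((t1, \<zero>\<^bsub>?T2\<^esub>), (\<zero>\<^bsub>?T3\<^esub>, \<zero>\<^bsub>?T4\<^esub>))" and ?a2 = "((\<zero>\<^bsub>?T1\<^esub>, t2), (\<zero>\<^bsub>?T3\<^esub>, \<zero>\<^bsub>?T4\<^esub>))"
    let ?a3 = "((\<zero>\<^bsub>?T1\<^esub>, \<zero>\<^bsub>?T2\<^esub>), (t3, \<zero>\<^bsub>?T4\<^esub>))" and ?a4 = "((\<zero>\<^bsub>?T1\<^esub>, \<zero>\<^bsub>?T2\<^esub>), (\<zero>\<^bsub>?T3\<^esub>, t4))"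
    have a: "?a1 \<in> carrier ?S" "?a2 \<in> carrier ?S" "?a3 \<in> carrier ?S" "?a4 \<in> carrier ?S"
      using that by (simp_all add: cross_sum_eq direct_sum_simps)
    have "((t1, t2), (t3, t4)) = (?a1 \<oplus>\<^bsub>?S\<^esub> ?a2) \<oplus>\<^bsub>?S\<^esub> (?a3 \<oplus>\<^bsub>?S\<^esub> ?a4)"
      using that by (simp add: cross_sum_eq direct_sum_simps)
    then have "q ((t1, t2), (t3, t4)) = q ((?a1 \<oplus>\<^bsub>?S\<^esub> ?a2) \<oplus>\<^bsub>?S\<^esub> (?a3 \<oplus>\<^bsub>?S\<^esub> ?a4))" by (rule arg_cong)
    also have "\<dots> = (q ?a1 \<oplus>\<^bsub>?C\<^esub> q ?a2) \<oplus>\<^bsub>?C\<^esub> (q ?a3 \<oplus>\<^bsub>?C\<^esub> q ?a4)"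
      by (simp only: linear_mapsD(2)[OF q] S.a_closed a)
    finally show ?thesis by (simp only: i1_def i2_def i3_def i4_def)
  qed
  have q0: "q z = \<zero>\<^bsub>?C\<^esub>" if "z \<in> cross_generators F L N M J" for z
  proof -
    have "z \<in> cross_subalgebra F L N M J"
      unfolding cross_subalgebra_eq_span by (rule subsetD[OF linear_span_superset that])
    moreover from this have "z \<in> carrier ?S" using submoduleD(1)[OF cross_subalgebra_submodule] by blast
    ultimately show ?thesis
      unfolding q_def quotient_alg_simps
      using coset_eq_self_iff[OF module_cross_sum cross_subalgebra_submodule, of z] by blast
  qed
  \<comment> \<open>The two families of antidiagonal generators say that the first and third summands agree on \<open>N \<times> J\<close>, and the second and fourth on \<open>J \<times> N\<close>.\<close>
  have agree13: "i1 (bar_pure F L N M (carrier M) n m) = i3 (bar_pure F L (carrier L) M J n m)"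
    if nm: "n \<in> N" "m \<in> J" for n m
  proof -
    let ?a = "bar_pure F L N M (carrier M) n m" and ?b = "bar_pure F L (carrier L) M J n m"
    have ab: "?a \<in> carrier ?T1" "?b \<in> carrier ?T3" using nm NL JM bp by auto
    have "((?a, \<zero>\<^bsub>?T2\<^esub>), (\<ominus>\<^bsub>?T3\<^esub> ?b, \<zero>\<^bsub>?T4\<^esub>)) \<in> cross_generators F L N M J"
      using nm by (auto simp: cross_generators_def)
    from q0[OF this] have "(i1 ?a \<oplus>\<^bsub>?C\<^esub> i2 \<zero>\<^bsub>?T2\<^esub>) \<oplus>\<^bsub>?C\<^esub> (i3 (\<ominus>\<^bsub>?T3\<^esub> ?b) \<oplus>\<^bsub>?C\<^esub> i4 \<zero>\<^bsub>?T4\<^esub>) = \<zero>\<^bsub>?C\<^esub>"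
      using split ab by simp
    then have "i1 ?a \<ominus>\<^bsub>?C\<^esub> i3 ?b = \<zero>\<^bsub>?C\<^esub>"
      using linear_maps_zero_neg(1)[OF i(2) T2 C.module_axioms] linear_maps_zero_neg(1)[OF i(4) T4 C.module_axioms]
        linear_maps_zero_neg(2)[OF i(3) T3 C.module_axioms ab(2)]
        linear_mapsD(1)[OF i(1) ab(1)] linear_mapsD(1)[OF i(3) ab(2)]
      by (simp add: a_minus_def)
    then show ?thesis using linear_mapsD(1)[OF i(1) ab(1)] linear_mapsD(1)[OF i(3) ab(2)] C.minus_eq_zero_iff by simp
  qed
  have agree24: "i4 (bar_pure F M J L (carrier L) m n) = i2 (bar_pure F M (carrier M) L N m n)"
    if nm: "m \<in> J" "n \<in> N" for n m
  proof -
    let ?a = "bar_pure F M (carrier M) L N m n" and ?b = "bar_pure F M J L (carrier L) m n"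
    have ab: "?a \<in> carrier ?T2" "?b \<in> carrier ?T4" using nm NL JM bp by auto
    have "((\<zero>\<^bsub>?T1\<^esub>, ?a), (\<zero>\<^bsub>?T3\<^esub>, \<ominus>\<^bsub>?T4\<^esub> ?b)) \<in> cross_generators F L N M J"
      using nm by (auto simp: cross_generators_def)
    from q0[OF this] have "(i1 \<zero>\<^bsub>?T1\<^esub> \<oplus>\<^bsub>?C\<^esub> i2 ?a) \<oplus>\<^bsub>?C\<^esub> (i3 \<zero>\<^bsub>?T3\<^esub> \<oplus>\<^bsub>?C\<^esub> i4 (\<ominus>\<^bsub>?T4\<^esub> ?b)) = \<zero>\<^bsub>?C\<^esub>"
      using split ab by simp
    then have "i2 ?a \<ominus>\<^bsub>?C\<^esub> i4 ?b = \<zero>\<^bsub>?C\<^esub>"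
      using linear_maps_zero_neg(1)[OF i(1) T1 C.module_axioms] linear_maps_zero_neg(1)[OF i(3) T3 C.module_axioms]
        linear_maps_zero_neg(2)[OF i(4) T4 C.module_axioms ab(2)]
        linear_mapsD(1)[OF i(2) ab(1)] linear_mapsD(1)[OF i(4) ab(2)]
      by (simp add: a_minus_def)
    then show ?thesis using linear_mapsD(1)[OF i(2) ab(1)] linear_mapsD(1)[OF i(4) ab(2)] C.minus_eq_zero_iff by simp
  qed
  obtain \<theta>12 where t12: "\<theta>12 \<in> cross_pairings F L N M J ?C"
    "\<And>n w. \<lbrakk>n \<in> N; w \<in> carrier M\<rbrakk> \<Longrightarrow> \<theta>12 n w = i1 (bar_pure F L N M (carrier M) n w)"
    "\<And>v m. \<lbrakk>v \<in> carrier L; m \<in> J\<rbrakk> \<Longrightarrow> \<theta>12 v m = i3 (bar_pure F L (carrier L) M J v m)"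
    using cross_pairings_extend[OF F L N M J C.module_axioms i(1) i(3) agree13] by blast
  obtain \<theta>21 where t21: "\<theta>21 \<in> cross_pairings F M J L N ?C"
    "\<And>n w. \<lbrakk>n \<in> J; w \<in> carrier L\<rbrakk> \<Longrightarrow> \<theta>21 n w = i4 (bar_pure F M J L (carrier L) n w)"
    "\<And>v m. \<lbrakk>v \<in> carrier M; m \<in> N\<rbrakk> \<Longrightarrow> \<theta>21 v m = i2 (bar_pure F M (carrier M) L N v m)"
    using cross_pairings_extend[OF F M J L N C.module_axioms i(4) i(2) agree24] by blast
  obtain g1 g3 where g13: "g1 \<in> linear_maps F ?T1 U" "g3 \<in> linear_maps F ?T3 U"
    "\<And>n w. \<lbrakk>n \<in> N; w \<in> carrier M\<rbrakk> \<Longrightarrow> g1 (bar_pure F L N M (carrier M) n w) = \<mu>12 n w"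
    "\<And>v m. \<lbrakk>v \<in> carrier L; m \<in> J\<rbrakk> \<Longrightarrow> g3 (bar_pure F L (carrier L) M J v m) = \<mu>12 v m"
    using cross_pairings_factor[OF L N M J U m12] by blast
  obtain g4 g2 where g42: "g4 \<in> linear_maps F ?T4 U" "g2 \<in> linear_maps F ?T2 U"
    "\<And>n w. \<lbrakk>n \<in> J; w \<in> carrier L\<rbrakk> \<Longrightarrow> g4 (bar_pure F M J L (carrier L) n w) = \<mu>21 n w"
    "\<And>v m. \<lbrakk>v \<in> carrier M; m \<in> N\<rbrakk> \<Longrightarrow> g2 (bar_pure F M (carrier M) L N v m) = \<mu>21 v m"
    using cross_pairings_factor[OF M J L N U m21] by blast
  define G where "G = (\<lambda>z. (g1 (fst (fst z)) \<oplus>\<^bsub>U\<^esub> g2 (snd (fst z))) \<oplus>\<^bsub>U\<^esub> (g3 (fst (snd z)) \<oplus>\<^bsub>U\<^esub> g4 (snd (snd z))))"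
  have G: "G \<in> linear_maps F ?S U"
    unfolding G_def cross_sum_eq
    by (intro linear_maps_add U linear_maps_comp[OF _ g13(1)] linear_maps_comp[OF _ g13(2)]
        linear_maps_comp[OF _ g42(1)] linear_maps_comp[OF _ g42(2)]
        linear_maps_comp[OF linear_maps_fst linear_maps_fst] linear_maps_comp[OF linear_maps_fst linear_maps_snd]
        linear_maps_comp[OF linear_maps_snd linear_maps_fst] linear_maps_comp[OF linear_maps_snd linear_maps_snd])
  have g0: "g1 \<zero>\<^bsub>?T1\<^esub> = \<zero>\<^bsub>U\<^esub>" "g2 \<zero>\<^bsub>?T2\<^esub> = \<zero>\<^bsub>U\<^esub>" "g3 \<zero>\<^bsub>?T3\<^esub> = \<zero>\<^bsub>U\<^esub>" "g4 \<zero>\<^bsub>?T4\<^esub> = \<zero>\<^bsub>U\<^esub>"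
    by (rule linear_maps_zero_neg(1)[OF g13(1) T1 U] linear_maps_zero_neg(1)[OF g13(2) T3 U]
        linear_maps_zero_neg(1)[OF g42(1) T4 U] linear_maps_zero_neg(1)[OF g42(2) T2 U])+
  have m12c: "\<mu>12 x y \<in> carrier U" if "x \<in> carrier L" "y \<in> carrier M" for x y
    using bilinear_mapsD(3)[OF cross_pairings_null(1)[OF m12] that] .
  have m21c: "\<mu>21 y x \<in> carrier U" if "x \<in> carrier L" "y \<in> carrier M" for x y
    using bilinear_mapsD(3)[OF cross_pairings_null(1)[OF m21] that(2,1)] .
  have "G z = \<zero>\<^bsub>U\<^esub>" if "z \<in> cross_generators F L N M J" for z
    using that NL JM
    by (auto simp: cross_generators_def G_def g0 g13 g42 bp m12c m21c U.M.r_neg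
        linear_maps_zero_neg(2)[OF g13(2) T3 U] linear_maps_zero_neg(2)[OF g42(1) T4 U])
  then have G0: "G z = \<zero>\<^bsub>U\<^esub>" if "z \<in> cross_subalgebra F L N M J" for z
    using linear_map_vanishes_on_span[OF G module_cross_sum U cross_generators_subset] that
    unfolding cross_subalgebra_eq_span by blast
  define \<Gamma> where "\<Gamma> = (\<lambda>K. the_elem (G ` K))"
  have \<Gamma>: "\<Gamma> \<in> linear_maps F ?C U"
    unfolding \<Gamma>_def by (rule quotient_lift(1)[OF module_cross_sum cross_subalgebra_submodule U G G0])
  have \<Gamma>q: "\<Gamma> (q z) = G z" if "z \<in> carrier ?S" for z
    unfolding \<Gamma>_def q_def by (rule quotient_lift(2)[OF module_cross_sum cross_subalgebra_submodule U G G0 that])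
  have G1: "\<Gamma> (i1 t) = g1 t" if "t \<in> carrier ?T1" for t
    unfolding i1_def using that linear_mapsD(1)[OF g13(1) that]
    by (subst \<Gamma>q) (simp_all add: cross_sum_eq direct_sum_simps G_def g0)
  have G2: "\<Gamma> (i2 t) = g2 t" if "t \<in> carrier ?T2" for t
    unfolding i2_def using that linear_mapsD(1)[OF g42(2) that]
    by (subst \<Gamma>q) (simp_all add: cross_sum_eq direct_sum_simps G_def g0)
  have G3: "\<Gamma> (i3 t) = g3 t" if "t \<in> carrier ?T3" for t
    unfolding i3_def using that linear_mapsD(1)[OF g13(2) that]
    by (subst \<Gamma>q) (simp_all add: cross_sum_eq direct_sum_simps G_def g0)
  have G4: "\<Gamma> (i4 t) = g4 t" if "t \<in> carrier ?T4" for t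
    unfolding i4_def using that linear_mapsD(1)[OF g42(1) that]
    by (subst \<Gamma>q) (simp_all add: cross_sum_eq direct_sum_simps G_def g0)
  show ?thesis
  proof (rule that[OF t12(1) t21(1) \<Gamma>])
    show "\<Gamma> (\<theta>12 x y) = \<mu>12 x y" if "x \<in> carrier L" "y \<in> carrier M" "x \<in> N \<or> y \<in> J" for x y
      using that(3)
    proof
      assume "x \<in> N"
      then show ?thesis using t12(2) G1 bp(1) g13(3) that(2) by simp
    next
      assume "y \<in> J"
      then show ?thesis using t12(3) G3 bp(3) g13(4) that(1) by simp
    qed
    show "\<Gamma> (\<theta>21 y x) = \<mu>21 y x" if "x \<in> carrier L" "y \<in> carrier M" "x \<in> N \<or> y \<in> J" for x y
      using that(3)
    proof
      assume "x \<in> N"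
      then show ?thesis using t21(3) G2 bp(2) g42(4) that(2) by simp
    next
      assume "y \<in> J"
      then show ?thesis using t21(2) G4 bp(4) g42(3) that(1) by simp
    qed
    fix H assume H: "submodule H F ?C"
      and HI: "\<And>x y. \<lbrakk>x \<in> carrier L; y \<in> carrier M; x \<in> N \<or> y \<in> J\<rbrakk> \<Longrightarrow> \<theta>12 x y \<in> H \<and> \<theta>21 y x \<in> H"
    have 1: "carrier ?T1 \<subseteq> {t \<in> carrier ?T1. i1 t \<in> H}"
      by (rule bar_tensor_spanned[OF L N M cM submodule_preimage[OF i(1) T1 C.module_axioms H]])
        (use HI NL t12(2) bp(1) in force)
    have 2: "carrier ?T2 \<subseteq> {t \<in> carrier ?T2. i2 t \<in> H}"
      by (rule bar_tensor_spanned[OF M cM L N submodule_preimage[OF i(2) T2 C.module_axioms H]])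
        (use HI NL t21(3) bp(2) in force)
    have 3: "carrier ?T3 \<subseteq> {t \<in> carrier ?T3. i3 t \<in> H}"
      by (rule bar_tensor_spanned[OF L cL M J submodule_preimage[OF i(3) T3 C.module_axioms H]])
        (use HI JM t12(3) bp(3) in force)
    have 4: "carrier ?T4 \<subseteq> {t \<in> carrier ?T4. i4 t \<in> H}"
      by (rule bar_tensor_spanned[OF M J L cL submodule_preimage[OF i(4) T4 C.module_axioms H]])
        (use HI JM t21(2) bp(4) in force)
    show "carrier ?C \<subseteq> H"
    proof
      fix k assume "k \<in> carrier ?C"
      then obtain t1 t2 t3 t4 where k: "k = q ((t1, t2), (t3, t4))" and t: "t1 \<in> carrier ?T1" "t2 \<in> carrier ?T2"
        "t3 \<in> carrier ?T3" "t4 \<in> carrier ?T4"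
        unfolding qsurj by (auto simp: cross_sum_eq direct_sum_simps)
      have "i1 t1 \<in> H" "i2 t2 \<in> H" "i3 t3 \<in> H" "i4 t4 \<in> H" using 1 2 3 4 t by auto
      then show "k \<in> H" unfolding k split[OF t] by (intro submoduleD(3)[OF H])
    qed
  qed
qed

end

section \<open>Words of length two and three\<close>

lemma tpow_words_2: "xs \<in> tpow_words V 2 \<longleftrightarrow> (\<exists>x y. xs = [x, y] \<and> x \<in> carrier V \<and> y \<in> carrier V)"
proof
  assume "xs \<in> tpow_words V 2"
  moreover from this have "length xs = Suc (Suc 0)" by (simp add: mem_tpow_words)
  ultimately show "\<exists>x y. xs = [x, y] \<and> x \<in> carrier V \<and> y \<in> carrier V"
    by (auto simp: mem_tpow_words length_Suc_conv)
qed (auto simp: mem_tpow_words)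

lemma tpow_words_3:
  "xs \<in> tpow_words V 3 \<longleftrightarrow> (\<exists>x y z. xs = [x, y, z] \<and> x \<in> carrier V \<and> y \<in> carrier V \<and> z \<in> carrier V)"
proof
  assume "xs \<in> tpow_words V 3"
  moreover from this have "length xs = Suc (Suc (Suc 0))" by (simp add: mem_tpow_words)
  ultimately show "\<exists>x y z. xs = [x, y, z] \<and> x \<in> carrier V \<and> y \<in> carrier V \<and> z \<in> carrier V"
    by (auto simp: mem_tpow_words length_Suc_conv)
qed (auto simp: mem_tpow_words)

lemma tpow_pure_zero:
  assumes V: "module F V" and xs: "xs \<in> tpow_words V n" "\<zero>\<^bsub>V\<^esub> \<in> set xs"
  shows "tpow_pure F V xs = \<zero>\<^bsub>tpow F V n\<^esub>"
proof -
  obtain as bs where e: "xs = as @ \<zero>\<^bsub>V\<^esub> # bs" using xs(2) by (meson split_list)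
  have "(\<lambda>x. tpow_pure F V (as @ x # bs)) \<in> linear_maps F V (tpow F V n)"
    using xs(1) unfolding e by (intro multilinear_mapsD(2)[OF tpow_pure_multilinear[OF V]]) (auto simp: mem_tpow_words)
  from linear_maps_zero_neg(1)[OF this V module_tpow[OF V]] show ?thesis by (simp add: e)
qed

lemma tpow_pure_2_bilinear:
  assumes V: "module F V"
  shows "(\<lambda>x y. tpow_pure F V [x, y]) \<in> bilinear_maps F V V (tpow F V 2)"
proof (rule bilinear_mapsI)
  show "(\<lambda>x. tpow_pure F V [x, y]) \<in> linear_maps F V (tpow F V 2)" if "y \<in> carrier V" for y
    using multilinear_mapsD(2)[OF tpow_pure_multilinear[OF V, of 2], of "[]" "[y]"] that by simp
  show "(\<lambda>y. tpow_pure F V [x, y]) \<in> linear_maps F V (tpow F V 2)" if "x \<in> carrier V" for x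
    using multilinear_mapsD(2)[OF tpow_pure_multilinear[OF V, of 2], of "[x]" "[]"] that by simp
qed

lemma tpow_2_lift:
  assumes V: "module F V" and U: "module F U" and f: "f \<in> bilinear_maps F V V U"
  obtains g where "g \<in> linear_maps F (tpow F V 2) U"
    "\<And>x y. \<lbrakk>x \<in> carrier V; y \<in> carrier V\<rbrakk> \<Longrightarrow> g (tpow_pure F V [x, y]) = f x y"
proof -
  let ?h = "\<lambda>xs. f (xs ! 0) (xs ! 1)"
  have "(\<lambda>x. ?h (xs @ x # ys)) \<in> linear_maps F V U"
    if "set xs \<subseteq> carrier V" "set ys \<subseteq> carrier V" "int (length xs + length ys + 1) = 2" for xs ys
  proof -
    have "(xs = [] \<and> (\<exists>y. ys = [y])) \<or> (ys = [] \<and> (\<exists>x. xs = [x]))"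
      using that(3) by (cases xs; cases ys) auto
    then show ?thesis using that(1,2) bilinear_mapsD(1,2)[OF f] by auto
  qed
  then have h: "?h \<in> multilinear_maps F V 2 U"
    using bilinear_mapsD(3)[OF f] by (auto simp: multilinear_maps_def tpow_words_2)
  show ?thesis
    by (rule that[OF tpow_lift(1)[OF V U h]]) (subst tpow_lift(2)[OF V U h], auto simp: tpow_words_2)
qed

section \<open>Functoriality\<close>

context
  fixes F :: "('f, 'r) ring_scheme" and L :: "('f, 'v, 'm) module_scheme" and N :: "'v set"
  assumes L: "leibniz_algebra F L" and N: "leibniz_ideal F L N"
begin

private lemma word_module: "module F L" by (rule leibniz_algebra_module[OF L])

lemma CL_proj_word_zero:
  assumes "xs \<in> tpow_words L n" "set xs \<inter> N \<noteq> {}"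
  shows "CL_proj F L N n (tpow_pure F L xs) = \<zero>\<^bsub>CL F (quotient_alg L N) n\<^esub>"
proof -
  note S = leibniz_idealD(1)[OF N]
  note Q = module_quotient_alg[OF word_module S]
  obtain x where x: "x \<in> set xs" "x \<in> N" using assms(2) by blast
  have "N +>\<^bsub>L\<^esub> x = \<zero>\<^bsub>quotient_alg L N\<^esub>"
    using coset_eq_self_iff[OF word_module S leibniz_idealD(2)[OF N x(2)]] x(2) by (simp add: quotient_alg_simps)
  then have "\<zero>\<^bsub>quotient_alg L N\<^esub> \<in> set (map (\<lambda>x. N +>\<^bsub>L\<^esub> x) xs)" using x(1) by force
  then show ?thesis
    unfolding CL_proj_eq_tpow_map tpow_map(2)[OF word_module Q coset_linear[OF word_module S] assms(1)]
    by (rule tpow_pure_zero[OF Q map_tpow_words[OF coset_linear[OF word_module S] assms(1)]])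
qed

lemma ideal_vanishes_on_CL_proj_kernel:
  assumes "module F W" "T \<in> linear_maps F (CL F L n) W"
    "\<And>xs. \<lbrakk>xs \<in> tpow_words L n; set xs \<inter> N \<noteq> {}\<rbrakk> \<Longrightarrow> T (tpow_pure F L xs) = \<zero>\<^bsub>W\<^esub>"
    "t \<in> carrier (CL F L n)" "CL_proj F L N n t = \<zero>\<^bsub>CL F (quotient_alg L N) n\<^esub>"
  shows "T t = \<zero>\<^bsub>W\<^esub>"
  by (rule vanishes_on_CL_proj_kernel[OF word_module leibniz_idealD(1)[OF N] assms(1,2) _ assms(4,5)]) (rule assms(3))

lemma word_in_rel_chains:
  assumes "x \<in> carrier L" "y \<in> carrier L" "z \<in> carrier L" "x \<in> N \<or> y \<in> N \<or> z \<in> N"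
  shows "tpow_pure F L [x, y, z] \<in> rel_chains F L N"
proof -
  have w: "[x, y, z] \<in> tpow_words L 3" using assms by (simp add: mem_tpow_words)
  show ?thesis
    unfolding rel_chains_def
    using tpow_pure_closed[OF word_module w] CL_proj_word_zero[OF w] assms(4) by auto
qed

end

context
  fixes F :: "('f, 'r) ring_scheme" and L :: "('f, 'v, 'm) module_scheme" and N :: "'v set"
    and K :: "('f, 'w, 'n) module_scheme" and P :: "'w set" and f :: "'v \<Rightarrow> 'w"
  assumes L: "leibniz_algebra F L" and N: "leibniz_ideal F L N"
    and K: "leibniz_algebra F K" and P: "leibniz_ideal F K P"
    and f: "f \<in> leibniz_hom F L K" and fN: "\<And>n. n \<in> N \<Longrightarrow> f n \<in> P"
begin

private lemma source_module: "module F L" by (rule leibniz_algebra_module[OF L])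
private lemma target_module: "module F K" by (rule leibniz_algebra_module[OF K])
private lemma source_linear: "f \<in> linear_maps F L K" using f by (simp add: leibniz_hom_iff)

lemma tpow_map_proj_kernel:
  assumes "t \<in> carrier (CL F L n)" "CL_proj F L N n t = \<zero>\<^bsub>CL F (quotient_alg L N) n\<^esub>"
  shows "CL_proj F K P n (tpow_map F K n f t) = \<zero>\<^bsub>CL F (quotient_alg K P) n\<^esub>"
proof (rule ideal_vanishes_on_CL_proj_kernel[OF L N module_tpow[OF leibniz_algebra_module[OF leibniz_algebra_quotient[OF K P]]]
      linear_maps_comp[OF tpow_map(1)[OF source_module target_module source_linear] CL_proj_linear[OF K P]] _ assms])
  fix xs assume xs: "xs \<in> tpow_words L n" "set xs \<inter> N \<noteq> {}"
  then have "set (map f xs) \<inter> P \<noteq> {}" using fN by auto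
  then show "CL_proj F K P n (tpow_map F K n f (tpow_pure F L xs)) = \<zero>\<^bsub>CL F (quotient_alg K P) n\<^esub>"
    unfolding tpow_map(2)[OF source_module target_module source_linear xs(1)] by (rule CL_proj_word_zero[OF K P map_tpow_words[OF source_linear xs(1)]])
qed

lemma tpow_map_rel_cycles:
  assumes "a \<in> rel_cycles F L N" shows "tpow_map F K 2 f a \<in> rel_cycles F K P"
proof -
  have a: "a \<in> carrier (CL F L 2)" "CL_boundary F L 2 a = \<zero>\<^bsub>CL F L 1\<^esub>"
    "CL_proj F L N 2 a = \<zero>\<^bsub>CL F (quotient_alg L N) 2\<^esub>" using assms by (auto simp: rel_cycles_def)
  have "CL_boundary F K 2 (tpow_map F K 2 f a) = \<zero>\<^bsub>CL F K 1\<^esub>"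
    using CL_boundary_natural[OF L K f a(1)] a(2)
      linear_maps_zero_neg(1)[OF tpow_map(1)[OF source_module target_module source_linear] module_tpow[OF source_module] module_tpow[OF target_module]] by simp
  then show ?thesis
    using linear_mapsD(1)[OF tpow_map(1)[OF source_module target_module source_linear] a(1)] tpow_map_proj_kernel[OF a(1,3)]
    by (simp add: rel_cycles_def)
qed

lemma tpow_map_rel_boundaries:
  assumes "a \<in> rel_boundaries F L N" shows "tpow_map F K 2 f a \<in> rel_boundaries F K P"
proof -
  obtain c where c: "c \<in> carrier (CL F L 3)" "CL_proj F L N 3 c = \<zero>\<^bsub>CL F (quotient_alg L N) 3\<^esub>"
    "a = CL_boundary F L 3 c" using assms by (auto simp: rel_chains_def)
  have "tpow_map F K 3 f c \<in> rel_chains F K P"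
    using linear_mapsD(1)[OF tpow_map(1)[OF source_module target_module source_linear] c(1)] tpow_map_proj_kernel[OF c(1,2)]
    by (simp add: rel_chains_def)
  moreover have "tpow_map F K 2 f a = CL_boundary F K 3 (tpow_map F K 3 f c)"
    using CL_boundary_natural[OF L K f c(1)] c(3) by simp
  ultimately show ?thesis by blast
qed

end

section \<open>Pairings with values in the chains of degree two\<close>

text \<open>
  As the brackets \<open>[e x, d y]\<close> are zero, \<open>\<partial> (e x \<otimes> e x' \<otimes> d y) = e [x, x'] \<otimes> d y\<close> and
  \<open>\<partial> (e x \<otimes> d y \<otimes> d y') = - e x \<otimes> d [y, y']\<close>.  If one of the three letters comes from the ideals, the word lies
  in the kernel of the projection and the right-hand side is a relative boundary.  These are the four
  conditions on a cross pairing.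
\<close>

lemma orthogonal_homs_cross_pairing:
  fixes F :: "('f, 'r) ring_scheme"
    and L :: "('f, 'a, 'm) module_scheme" and M :: "('f, 'b, 'n) module_scheme"
    and K :: "('f, 'c, 'k) module_scheme"
  assumes L: "leibniz_algebra F L" and N: "leibniz_ideal F L N"
    and M: "leibniz_algebra F M" and J: "leibniz_ideal F M J"
    and K: "leibniz_algebra F K" and P: "leibniz_ideal F K P"
    and e: "e \<in> leibniz_hom F L K" and eN: "\<And>n. n \<in> N \<Longrightarrow> e n \<in> P"
    and d: "d \<in> leibniz_hom F M K" and dJ: "\<And>m. m \<in> J \<Longrightarrow> d m \<in> P"
    and ed: "\<And>x y. \<lbrakk>x \<in> carrier L; y \<in> carrier M\<rbrakk> \<Longrightarrow> e x \<otimes>\<^bsub>K\<^esub> d y = \<zero>\<^bsub>K\<^esub>"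
  shows "(\<lambda>x y. rel_boundaries F K P +>\<^bsub>CL F K 2\<^esub> tpow_pure F K [e x, d y])
    \<in> cross_pairings F L N M J (quotient_alg (CL F K 2) (rel_boundaries F K P))"
proof -
  let ?U = "quotient_alg (CL F K 2) (rel_boundaries F K P)"
  let ?f = "\<lambda>x y. rel_boundaries F K P +>\<^bsub>CL F K 2\<^esub> tpow_pure F K [e x, d y]"
  interpret L: leibniz_algebra F L by (rule L)
  interpret M: leibniz_algebra F M by (rule M)
  interpret K: leibniz_algebra F K by (rule K)
  note K' = K.module_axioms
  have T: "module F (CL F K 2)" by (rule module_tpow[OF K'])
  interpret T: module F "CL F K 2" by (rule T)
  note B = rel_boundaries_submodule[OF K P]
  have U: "module F ?U" by (rule module_quotient_alg[OF T B])
  have le: "e \<in> linear_maps F L K" and ld: "d \<in> linear_maps F M K" using e d by (auto simp: leibniz_hom_iff)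
  note ec = linear_mapsD(1)[OF le] and dc = linear_mapsD(1)[OF ld]
  have f: "?f \<in> bilinear_maps F L M ?U"
    by (rule bilinear_maps_comp[OF bilinear_maps_comp2[OF tpow_pure_2_bilinear[OF K'] le ld] coset_linear[OF T B]])
  note p2 = bilinear_mapsD(3)[OF tpow_pure_2_bilinear[OF K']]
  have p0: "tpow_pure F K [\<zero>\<^bsub>K\<^esub>, v] = \<zero>\<^bsub>CL F K 2\<^esub>" "tpow_pure F K [v, \<zero>\<^bsub>K\<^esub>] = \<zero>\<^bsub>CL F K 2\<^esub>"
    if "v \<in> carrier K" for v
    using that by (auto intro!: tpow_pure_zero[OF K'] simp: mem_tpow_words)
  have bd: "CL_boundary F K 3 (tpow_pure F K [u, v, w]) = tpow_pure F K [u \<otimes>\<^bsub>K\<^esub> v, w] \<ominus>\<^bsub>CL F K 2\<^esub>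
    (tpow_pure F K [u \<otimes>\<^bsub>K\<^esub> w, v] \<oplus>\<^bsub>CL F K 2\<^esub> tpow_pure F K [u, v \<otimes>\<^bsub>K\<^esub> w])"
    if "u \<in> carrier K" "v \<in> carrier K" "w \<in> carrier K" for u v w
    using CL_boundary(2)[OF K, of "[u, v, w]" 3] boundary_word_3[OF K that] that by (simp add: mem_tpow_words)
  have null: "?f x y = \<zero>\<^bsub>?U\<^esub>" if "tpow_pure F K [e x, d y] \<in> rel_boundaries F K P" for x y
    unfolding quotient_alg_simps
    using coset_eq_self_iff[OF T B] that submoduleD(1)[OF B] by blast
  have left: "?f (x \<otimes>\<^bsub>L\<^esub> x') y = \<zero>\<^bsub>?U\<^esub>"
    if *: "x \<in> carrier L" "x' \<in> carrier L" "y \<in> carrier M" "x \<in> N \<or> x' \<in> N \<or> y \<in> J" for x x' y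
  proof (rule null)
    have "CL_boundary F K 3 (tpow_pure F K [e x, e x', d y]) = tpow_pure F K [e x \<otimes>\<^bsub>K\<^esub> e x', d y]"
      using * ec dc by (simp add: bd ed p0 p2 K.bracket_closed a_minus_def)
    moreover have "tpow_pure F K [e x, e x', d y] \<in> rel_chains F K P"
      using * ec dc eN dJ by (intro word_in_rel_chains[OF K P]) auto
    ultimately show "tpow_pure F K [e (x \<otimes>\<^bsub>L\<^esub> x'), d y] \<in> rel_boundaries F K P"
      using e *(1,2) by (auto simp: leibniz_hom_iff image_iff)
  qed
  have right: "?f x (y \<otimes>\<^bsub>M\<^esub> y') = \<zero>\<^bsub>?U\<^esub>"
    if *: "x \<in> carrier L" "y \<in> carrier M" "y' \<in> carrier M" "x \<in> N \<or> y \<in> J \<or> y' \<in> J" for x y y'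
  proof (rule null)
    have "CL_boundary F K 3 (tpow_pure F K [e x, d y, d y']) = \<ominus>\<^bsub>CL F K 2\<^esub> tpow_pure F K [e x, d y \<otimes>\<^bsub>K\<^esub> d y']"
      using * ec dc by (simp add: bd ed p0 p2 K.bracket_closed a_minus_def)
    moreover have "tpow_pure F K [e x, d y, d y'] \<in> rel_chains F K P"
      using * ec dc eN dJ by (intro word_in_rel_chains[OF K P]) auto
    ultimately have "\<ominus>\<^bsub>CL F K 2\<^esub> tpow_pure F K [e x, d y \<otimes>\<^bsub>K\<^esub> d y'] \<in> rel_boundaries F K P"
      by (metis imageI)
    then have "\<ominus>\<^bsub>CL F K 2\<^esub> (\<ominus>\<^bsub>CL F K 2\<^esub> tpow_pure F K [e x, d y \<otimes>\<^bsub>K\<^esub> d y']) \<in> rel_boundaries F K P"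
      by (rule submoduleD(5)[OF B])
    then show "tpow_pure F K [e x, d (y \<otimes>\<^bsub>M\<^esub> y')] \<in> rel_boundaries F K P"
      using d * ec dc p2 by (simp add: leibniz_hom_iff K.bracket_closed)
  qed
  note NL = leibniz_idealD(2)[OF N] and JM = leibniz_idealD(2)[OF J]
  show ?thesis
    unfolding cross_pairings_def
  proof (intro CollectI conjI ballI)
    show "?f u w = \<zero>\<^bsub>?U\<^esub>" if "u \<in> commutator F L N" "w \<in> carrier M" for u w
      by (rule vanishes_on_commutator[OF L N bilinear_mapsD(1)[OF f that(2)] U _ _ that(1)])
        (use left that(2) NL in blast)+
    show "?f u w = \<zero>\<^bsub>?U\<^esub>" if "u \<in> N" "w \<in> commutator F M (carrier M)" for u w
      by (rule vanishes_on_commutator[OF M leibniz_ideal_carrier[OF M] bilinear_mapsD(2)[OF f NL[OF that(1)]] U _ _ that(2)])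
        (use right that(1) NL in blast)+
    show "?f u w = \<zero>\<^bsub>?U\<^esub>" if "u \<in> commutator F L (carrier L)" "w \<in> J" for u w
      by (rule vanishes_on_commutator[OF L leibniz_ideal_carrier[OF L] bilinear_mapsD(1)[OF f JM[OF that(2)]] U _ _ that(1)])
        (use left that(2) JM in blast)+
    show "?f u w = \<zero>\<^bsub>?U\<^esub>" if "u \<in> carrier L" "w \<in> commutator F M J" for u w
      by (rule vanishes_on_commutator[OF M J bilinear_mapsD(2)[OF f that(1)] U _ _ that(2)])
        (use right that(1) JM in blast)+
  qed (rule f)
qed

section \<open>The homology of a direct sum\<close>

text \<open>
  The isomorphism is \<open>a \<mapsto> ([p a], [r a], \<Theta> a)\<close>, where \<open>p\<close> and \<open>r\<close> are induced by the projections of the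
  direct sum, \<open>i\<close> and \<open>j\<close> below by the inclusions, and \<open>\<Theta> (u \<otimes> v) = \<theta> u\<^sub>1 v\<^sub>2 + \<theta>' u\<^sub>2 v\<^sub>1\<close> by the universal pairings.  For injectivity, \<open>a\<close> is the
  sum of \<open>i p a\<close>, \<open>j r a\<close> and its mixed part \<open>X a\<close>; on cycles the class of \<open>X a\<close> modulo relative boundaries is
  \<open>\<Gamma> (\<Theta> a)\<close>, where \<open>\<Gamma>\<close> comes from the universal property.  If the three components of the image
  of \<open>a\<close> are zero, then all three summands of \<open>a\<close> are relative boundaries.
\<close>

theorem HL2_kernel_direct_sum:
  fixes F :: "('f, 'r) ring_scheme"
    and L :: "('f, 'a, 'm) module_scheme" and N :: "'a set"
    and M :: "('f, 'b, 'n) module_scheme" and J :: "'b set"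
  assumes L: "leibniz_algebra F L" and N: "leibniz_ideal F L N"
    and M: "leibniz_algebra F M" and J: "leibniz_ideal F M J"
  shows "linear_iso F (HL2_kernel F (L \<boxplus> M) (N \<times> J))
    (HL2_kernel F L N \<boxplus> HL2_kernel F M J \<boxplus> cross_quotient F L N M J)"
proof -
  let ?G = "L \<boxplus> M" and ?P = "N \<times> J" and ?C = "cross_quotient F L N M J"
  let ?B = "rel_boundaries F ?G ?P"
  let ?Q = "quotient_alg (CL F ?G 2) ?B"
  let ?K1 = "HL2_kernel F L N" and ?K2 = "HL2_kernel F M J"
  interpret L: leibniz_algebra F L by (rule L)
  interpret M: leibniz_algebra F M by (rule M)
  have G: "leibniz_algebra F ?G" by (rule leibniz_algebra_direct_sum[OF L M])
  interpret G: leibniz_algebra F ?G by (rule G)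
  have P: "leibniz_ideal F ?G ?P" by (rule leibniz_ideal_direct_sum[OF L M N J])
  note L' = L.module_axioms and M' = M.module_axioms and G' = G.module_axioms
  have TL: "module F (CL F L n)" and TM: "module F (CL F M n)" and TG: "module F (CL F ?G n)" for n
    by (rule module_tpow[OF L'] module_tpow[OF M'] module_tpow[OF G'])+
  interpret TG2: module F "CL F ?G 2" by (rule TG)
  have NL: "n \<in> carrier L" if "n \<in> N" for n using leibniz_idealD(2)[OF N that] .
  have JM: "m \<in> carrier M" if "m \<in> J" for m using leibniz_idealD(2)[OF J that] .
  have N0: "\<zero>\<^bsub>L\<^esub> \<in> N" and J0: "\<zero>\<^bsub>M\<^esub> \<in> J"
    using submoduleD(2)[OF leibniz_idealD(1)[OF N]] submoduleD(2)[OF leibniz_idealD(1)[OF J]] by auto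
  have zL: "\<zero>\<^bsub>L\<^esub> \<otimes>\<^bsub>L\<^esub> x = \<zero>\<^bsub>L\<^esub>" "x \<otimes>\<^bsub>L\<^esub> \<zero>\<^bsub>L\<^esub> = \<zero>\<^bsub>L\<^esub>" if "x \<in> carrier L" for x
    using that L.bracket_smult_left[of "\<zero>\<^bsub>F\<^esub>" "\<zero>\<^bsub>L\<^esub>" x] L.bracket_smult_right[of "\<zero>\<^bsub>F\<^esub>" x "\<zero>\<^bsub>L\<^esub>"] L.bracket_closed
    by simp_all
  have zM: "\<zero>\<^bsub>M\<^esub> \<otimes>\<^bsub>M\<^esub> x = \<zero>\<^bsub>M\<^esub>" "x \<otimes>\<^bsub>M\<^esub> \<zero>\<^bsub>M\<^esub> = \<zero>\<^bsub>M\<^esub>" if "x \<in> carrier M" for x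
    using that M.bracket_smult_left[of "\<zero>\<^bsub>F\<^esub>" "\<zero>\<^bsub>M\<^esub>" x] M.bracket_smult_right[of "\<zero>\<^bsub>F\<^esub>" x "\<zero>\<^bsub>M\<^esub>"] M.bracket_closed
    by simp_all
  define i where "i = (\<lambda>x::'a. (x, \<zero>\<^bsub>M\<^esub>))"
  define j where "j = (\<lambda>y::'b. (\<zero>\<^bsub>L\<^esub>, y))"
  have i: "i \<in> leibniz_hom F L ?G" and j: "j \<in> leibniz_hom F M ?G"
    by (auto simp: leibniz_hom_def i_def j_def direct_sum_simps zL zM)
  have p: "fst \<in> leibniz_hom F ?G L" and r: "snd \<in> leibniz_hom F ?G M"
    by (auto simp: leibniz_hom_def direct_sum_simps)
  have iN: "\<And>n. n \<in> N \<Longrightarrow> i n \<in> ?P" and jJ: "\<And>m. m \<in> J \<Longrightarrow> j m \<in> ?P"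
    and pN: "\<And>z. z \<in> ?P \<Longrightarrow> fst z \<in> N" and rJ: "\<And>z. z \<in> ?P \<Longrightarrow> snd z \<in> J"
    using N0 J0 by (auto simp: i_def j_def)
  have li: "i \<in> linear_maps F L ?G" and lj: "j \<in> linear_maps F M ?G"
    and lp: "fst \<in> linear_maps F ?G L" and lr: "snd \<in> linear_maps F ?G M"
    using i j p r by (auto simp: leibniz_hom_iff)
  note ic = linear_mapsD(1)[OF li] and jc = linear_mapsD(1)[OF lj]
    and pc = linear_mapsD(1)[OF lp] and rc = linear_mapsD(1)[OF lr]
  define i2 p2 j2 r2 where "i2 = tpow_map F ?G 2 i" and  "p2 = tpow_map F L 2 (fst :: 'a \<times> 'b \<Rightarrow> 'a)"
    and "j2 = tpow_map F ?G 2 j" and  "r2 = tpow_map F M 2 (snd :: 'a \<times> 'b \<Rightarrow> 'b)"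
  have l2: "i2 \<in> linear_maps F (CL F L 2) (CL F ?G 2)" "p2 \<in> linear_maps F (CL F ?G 2) (CL F L 2)"
    "j2 \<in> linear_maps F (CL F M 2) (CL F ?G 2)" "r2 \<in> linear_maps F (CL F ?G 2) (CL F M 2)"
    unfolding i2_def p2_def j2_def r2_def
    by (rule tpow_map(1)[OF L' G' li] tpow_map(1)[OF G' L' lp] tpow_map(1)[OF M' G' lj] tpow_map(1)[OF G' M' lr])+
  have i2: "i2 (tpow_pure F L [x, y]) = tpow_pure F ?G [i x, i y]" if "x \<in> carrier L" "y \<in> carrier L" for x y
    unfolding i2_def using tpow_map(2)[OF L' G' li, of "[x, y]" 2] that by (simp add: mem_tpow_words)
  have j2: "j2 (tpow_pure F M [x, y]) = tpow_pure F ?G [j x, j y]" if "x \<in> carrier M" "y \<in> carrier M" for x y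
    unfolding j2_def using tpow_map(2)[OF M' G' lj, of "[x, y]" 2] that by (simp add: mem_tpow_words)
  have p2: "p2 (tpow_pure F ?G [u, v]) = tpow_pure F L [fst u, fst v]" if "u \<in> carrier ?G" "v \<in> carrier ?G" for u v
    unfolding p2_def using tpow_map(2)[OF G' L' lp, of "[u, v]" 2] that by (simp add: mem_tpow_words)
  have r2: "r2 (tpow_pure F ?G [u, v]) = tpow_pure F M [snd u, snd v]" if "u \<in> carrier ?G" "v \<in> carrier ?G" for u v
    unfolding r2_def using tpow_map(2)[OF G' M' lr, of "[u, v]" 2] that by (simp add: mem_tpow_words)
  have pair: "(\<lambda>x y. ?B +>\<^bsub>CL F ?G 2\<^esub> tpow_pure F ?G [i x, j y]) \<in> cross_pairings F L N M J ?Q"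
    by (rule orthogonal_homs_cross_pairing[OF L N M J G P i iN j jJ])
      (auto simp: i_def j_def direct_sum_simps zL zM)
  have pair': "(\<lambda>y x. ?B +>\<^bsub>CL F ?G 2\<^esub> tpow_pure F ?G [j y, i x]) \<in> cross_pairings F M J L N ?Q"
    by (rule orthogonal_homs_cross_pairing[OF M J L N G P j jJ i iN])
      (auto simp: i_def j_def direct_sum_simps zL zM)
  have B: "submodule ?B F (CL F ?G 2)" by (rule rel_boundaries_submodule[OF G P])
  have Q: "module F ?Q" by (rule module_quotient_alg[OF TG B])
  interpret Q: module F ?Q by (rule Q)
  have C: "module F ?C" by (rule module_cross_quotient[OF L N M J])
  interpret C: module F ?C by (rule C)
  obtain \<theta> \<theta>' \<Gamma> where \<theta>: "\<theta> \<in> cross_pairings F L N M J ?C" and \<theta>': "\<theta>' \<in> cross_pairings F M J L N ?C"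
    and \<Gamma>: "\<Gamma> \<in> linear_maps F ?C ?Q"
    and \<Gamma>\<theta>: "\<And>x y. \<lbrakk>x \<in> carrier L; y \<in> carrier M; x \<in> N \<or> y \<in> J\<rbrakk> \<Longrightarrow>
      \<Gamma> (\<theta> x y) = ?B +>\<^bsub>CL F ?G 2\<^esub> tpow_pure F ?G [i x, j y]"
    and \<Gamma>\<theta>': "\<And>x y. \<lbrakk>x \<in> carrier L; y \<in> carrier M; x \<in> N \<or> y \<in> J\<rbrakk> \<Longrightarrow>
      \<Gamma> (\<theta>' y x) = ?B +>\<^bsub>CL F ?G 2\<^esub> tpow_pure F ?G [j y, i x]"
    and gen: "\<And>H. \<lbrakk>submodule H F ?C;
      \<And>x y. \<lbrakk>x \<in> carrier L; y \<in> carrier M; x \<in> N \<or> y \<in> J\<rbrakk> \<Longrightarrow> \<theta> x y \<in> H \<and> \<theta>' y x \<in> H\<rbrakk>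
      \<Longrightarrow> carrier ?C \<subseteq> H"
    using cross_quotient_universal[OF L N M J Q pair pair'] by blast
  note \<theta>n = cross_pairings_null[OF \<theta>] and \<theta>'n = cross_pairings_null[OF \<theta>']
  note \<theta>c = bilinear_mapsD(3)[OF \<theta>n(1)] and \<theta>'c = bilinear_mapsD(3)[OF \<theta>'n(1)]
  have "(\<lambda>u v. \<theta> (fst u) (snd v) \<oplus>\<^bsub>?C\<^esub> \<theta>' (snd u) (fst v)) \<in> bilinear_maps F ?G ?G ?C"
    by (intro bilinear_maps_add C bilinear_maps_comp2[OF \<theta>n(1) lp lr] bilinear_maps_comp2[OF \<theta>'n(1) lr lp])
  then obtain \<Theta> where \<Theta>: "\<Theta> \<in> linear_maps F (CL F ?G 2) ?C"
    "\<And>u v. \<lbrakk>u \<in> carrier ?G; v \<in> carrier ?G\<rbrakk> \<Longrightarrow>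
      \<Theta> (tpow_pure F ?G [u, v]) = \<theta> (fst u) (snd v) \<oplus>\<^bsub>?C\<^esub> \<theta>' (snd u) (fst v)"
    using tpow_2_lift[OF G' C] by blast
  have "(\<lambda>u v. tpow_pure F ?G [i (fst u), j (snd v)] \<oplus>\<^bsub>CL F ?G 2\<^esub> tpow_pure F ?G [j (snd u), i (fst v)])
      \<in> bilinear_maps F ?G ?G (CL F ?G 2)"
    by (intro bilinear_maps_add TG bilinear_maps_comp2[OF tpow_pure_2_bilinear[OF G']]
        linear_maps_comp[OF lp li] linear_maps_comp[OF lr lj])
  then obtain X where X: "X \<in> linear_maps F (CL F ?G 2) (CL F ?G 2)"
    "\<And>u v. \<lbrakk>u \<in> carrier ?G; v \<in> carrier ?G\<rbrakk> \<Longrightarrow>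
      X (tpow_pure F ?G [u, v]) = tpow_pure F ?G [i (fst u), j (snd v)] \<oplus>\<^bsub>CL F ?G 2\<^esub> tpow_pure F ?G [j (snd u), i (fst v)]"
    using tpow_2_lift[OF G' TG] by blast
  note tp = bilinear_mapsD(3)[OF tpow_pure_2_bilinear[OF G']]
  note \<theta>00 = linear_maps_zero_neg(1)[OF bilinear_mapsD(1)[OF \<theta>n(1)] L' C]
    linear_maps_zero_neg(1)[OF bilinear_mapsD(2)[OF \<theta>n(1)] M' C]
    linear_maps_zero_neg(1)[OF bilinear_mapsD(1)[OF \<theta>'n(1)] M' C]
    linear_maps_zero_neg(1)[OF bilinear_mapsD(2)[OF \<theta>'n(1)] L' C]
  \<comment> \<open>Every chain is the sum of its pure parts and its mixed part.\<close>
  have decomp: "a = (i2 (p2 a) \<oplus>\<^bsub>CL F ?G 2\<^esub> j2 (r2 a)) \<oplus>\<^bsub>CL F ?G 2\<^esub> X a" if a: "a \<in> carrier (CL F ?G 2)" for a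
  proof (rule tpow_maps_eqI[OF G' TG linear_maps_id _ _ a])
    show "(\<lambda>a. (i2 (p2 a) \<oplus>\<^bsub>CL F ?G 2\<^esub> j2 (r2 a)) \<oplus>\<^bsub>CL F ?G 2\<^esub> X a) \<in> linear_maps F (CL F ?G 2) (CL F ?G 2)"
      by (intro linear_maps_add TG X linear_maps_comp[OF l2(2,1)] linear_maps_comp[OF l2(4,3)])
    fix xs assume "xs \<in> tpow_words ?G 2"
    then obtain u v where xs: "xs = [u, v]" and u: "u \<in> carrier ?G" and v: "v \<in> carrier ?G"
      by (auto simp: tpow_words_2)
    let ?u1 = "i (fst u)" and ?u2 = "j (snd u)" and ?v1 = "i (fst v)" and ?v2 = "j (snd v)"
    have c: "?u1 \<in> carrier ?G" "?u2 \<in> carrier ?G" "?v1 \<in> carrier ?G" "?v2 \<in> carrier ?G"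
      using ic jc pc rc u v by auto
    have eu: "u = ?u1 \<oplus>\<^bsub>?G\<^esub> ?u2" and ev: "v = ?v1 \<oplus>\<^bsub>?G\<^esub> ?v2"
      using u v by (auto simp: i_def j_def direct_sum_simps)
    note l = linear_mapsD(2)[OF bilinear_mapsD(1)[OF tpow_pure_2_bilinear[OF G']]]
      and r = linear_mapsD(2)[OF bilinear_mapsD(2)[OF tpow_pure_2_bilinear[OF G']]]
    have "tpow_pure F ?G [u, v] = tpow_pure F ?G [?u1 \<oplus>\<^bsub>?G\<^esub> ?u2, ?v1 \<oplus>\<^bsub>?G\<^esub> ?v2]"
      using eu ev by simp
    also have "\<dots> = (tpow_pure F ?G [?u1, ?v1] \<oplus>\<^bsub>CL F ?G 2\<^esub> tpow_pure F ?G [?u1, ?v2]) \<oplus>\<^bsub>CL F ?G 2\<^esub>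
        (tpow_pure F ?G [?u2, ?v1] \<oplus>\<^bsub>CL F ?G 2\<^esub> tpow_pure F ?G [?u2, ?v2])"
      using l[of "?v1 \<oplus>\<^bsub>?G\<^esub> ?v2" ?u1 ?u2] r[of ?u1 ?v1 ?v2] r[of ?u2 ?v1 ?v2] c by simp
    also have "\<dots> = (tpow_pure F ?G [?u1, ?v1] \<oplus>\<^bsub>CL F ?G 2\<^esub> tpow_pure F ?G [?u2, ?v2]) \<oplus>\<^bsub>CL F ?G 2\<^esub>
        (tpow_pure F ?G [?u1, ?v2] \<oplus>\<^bsub>CL F ?G 2\<^esub> tpow_pure F ?G [?u2, ?v1])"
      using tp[OF c(1,3)] tp[OF c(1,4)] tp[OF c(2,3)] tp[OF c(2,4)] by algebra
    also have "\<dots> = (i2 (p2 (tpow_pure F ?G [u, v])) \<oplus>\<^bsub>CL F ?G 2\<^esub> j2 (r2 (tpow_pure F ?G [u, v])))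
        \<oplus>\<^bsub>CL F ?G 2\<^esub> X (tpow_pure F ?G [u, v])"
      using u v by (simp add: p2 r2 i2 j2 X(2) pc rc)
    finally show "tpow_pure F ?G xs = (i2 (p2 (tpow_pure F ?G xs)) \<oplus>\<^bsub>CL F ?G 2\<^esub> j2 (r2 (tpow_pure F ?G xs)))
        \<oplus>\<^bsub>CL F ?G 2\<^esub> X (tpow_pure F ?G xs)"
      unfolding xs .
  qed
  \<comment> \<open>Both sides agree on words with an entry in the ideal, hence on the kernel of the projection.\<close>
  have cross: "\<Gamma> (\<Theta> a) = ?B +>\<^bsub>CL F ?G 2\<^esub> X a" if a: "a \<in> rel_cycles F ?G ?P" for a
  proof -
    let ?T = "\<lambda>a. \<Gamma> (\<Theta> a) \<ominus>\<^bsub>?Q\<^esub> (?B +>\<^bsub>CL F ?G 2\<^esub> X a)"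
    have lT: "?T \<in> linear_maps F (CL F ?G 2) ?Q"
      by (intro linear_maps_minus Q linear_maps_comp[OF \<Theta>(1) \<Gamma>] linear_maps_comp[OF X(1) coset_linear[OF TG B]])
    have a': "a \<in> carrier (CL F ?G 2)" using a by (simp add: rel_cycles_def)
    have cl: "\<Gamma> (\<Theta> a) \<in> carrier ?Q" "?B +>\<^bsub>CL F ?G 2\<^esub> X a \<in> carrier ?Q"
      using linear_mapsD(1)[OF \<Gamma>] linear_mapsD(1)[OF \<Theta>(1) a'] linear_mapsD(1)[OF X(1) a']
      by (auto intro: coset_in_quotient)
    have "?T a = \<zero>\<^bsub>?Q\<^esub>"
    proof (rule ideal_vanishes_on_CL_proj_kernel[OF G P Q lT _ a'])
      show "CL_proj F ?G ?P 2 a = \<zero>\<^bsub>CL F (quotient_alg ?G ?P) 2\<^esub>" using a by (simp add: rel_cycles_def)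
      fix xs assume xs: "xs \<in> tpow_words ?G 2" "set xs \<inter> ?P \<noteq> {}"
      then obtain u v where e: "xs = [u, v]" and u: "u \<in> carrier ?G" and v: "v \<in> carrier ?G"
        by (auto simp: tpow_words_2)
      have uv: "u \<in> ?P \<or> v \<in> ?P" using xs(2) e by auto
      have c: "i (fst u) \<in> carrier ?G" "j (snd u) \<in> carrier ?G" "i (fst v) \<in> carrier ?G" "j (snd v) \<in> carrier ?G"
        using ic jc pc rc u v by auto
      have "\<Gamma> (\<Theta> (tpow_pure F ?G [u, v])) = \<Gamma> (\<theta> (fst u) (snd v)) \<oplus>\<^bsub>?Q\<^esub> \<Gamma> (\<theta>' (snd u) (fst v))"
        using linear_mapsD(2)[OF \<Gamma>] \<theta>c \<theta>'c pc rc u v by (simp add: \<Theta>(2))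
      also have "\<dots> = (?B +>\<^bsub>CL F ?G 2\<^esub> tpow_pure F ?G [i (fst u), j (snd v)]) \<oplus>\<^bsub>?Q\<^esub>
          (?B +>\<^bsub>CL F ?G 2\<^esub> tpow_pure F ?G [j (snd u), i (fst v)])"
        using \<Gamma>\<theta>[of "fst u" "snd v"] \<Gamma>\<theta>'[of "fst v" "snd u"] uv pc rc u v by (auto simp: mem_Times_iff)
      also have "\<dots> = ?B +>\<^bsub>CL F ?G 2\<^esub> X (tpow_pure F ?G [u, v])"
        unfolding X(2)[OF u v] using tp c by (simp add: quotient_alg_add[OF TG B])
      finally have "\<Gamma> (\<Theta> (tpow_pure F ?G xs)) = ?B +>\<^bsub>CL F ?G 2\<^esub> X (tpow_pure F ?G xs)" by (simp add: e)
      moreover have "?B +>\<^bsub>CL F ?G 2\<^esub> X (tpow_pure F ?G xs) \<in> carrier ?Q"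
        by (intro coset_in_quotient linear_mapsD(1)[OF X(1)] tpow_pure_closed[OF G' xs(1)])
      ultimately show "?T (tpow_pure F ?G xs) = \<zero>\<^bsub>?Q\<^esub>" by (simp add: Q.minus_eq_zero_iff)
    qed
    then show ?thesis using cl Q.minus_eq_zero_iff by simp
  qed
  \<comment> \<open>For a word with an entry in the ideal, every term of its boundary contains a bracket that the universal pairings annihilate.\<close>
  have \<Theta>B: "\<Theta> a = \<zero>\<^bsub>?C\<^esub>" if a: "a \<in> ?B" for a
  proof -
    obtain c where c: "c \<in> carrier (CL F ?G 3)" "CL_proj F ?G ?P 3 c = \<zero>\<^bsub>CL F (quotient_alg ?G ?P) 3\<^esub>"
      and ac: "a = CL_boundary F ?G 3 c" using a by (auto simp: rel_chains_def)
    note d3 = CL_boundary[OF G, where n = 3, simplified]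
    have "\<Theta> (CL_boundary F ?G 3 c) = \<zero>\<^bsub>?C\<^esub>"
    proof (rule ideal_vanishes_on_CL_proj_kernel[OF G P C linear_maps_comp[OF d3(1) \<Theta>(1)] _ c])
      fix xs assume xs: "xs \<in> tpow_words ?G 3" "set xs \<inter> ?P \<noteq> {}"
      then obtain u v w where e: "xs = [u, v, w]" and u: "u \<in> carrier ?G" and v: "v \<in> carrier ?G"
        and w: "w \<in> carrier ?G" by (auto simp: tpow_words_3)
      have uvw: "u \<in> ?P \<or> v \<in> ?P \<or> w \<in> ?P" using xs(2) e by auto
      have fb: "fst (s \<otimes>\<^bsub>?G\<^esub> t) = fst s \<otimes>\<^bsub>L\<^esub> fst t" "snd (s \<otimes>\<^bsub>?G\<^esub> t) = snd s \<otimes>\<^bsub>M\<^esub> snd t" for s t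
        by (cases s; cases t; simp add: direct_sum_simps)+
      note comL = commutatorI[OF L N] and comM = commutatorI[OF M J]
        and comL' = commutatorI[OF L leibniz_ideal_carrier[OF L]] and comM' = commutatorI[OF M leibniz_ideal_carrier[OF M]]
      note ideal = leibniz_idealD(3,4)[OF N] leibniz_idealD(3,4)[OF J]
      have left: "\<Theta> (tpow_pure F ?G [s \<otimes>\<^bsub>?G\<^esub> t, x]) = \<zero>\<^bsub>?C\<^esub>"
        if s: "s \<in> carrier ?G" and t: "t \<in> carrier ?G" and x: "x \<in> carrier ?G" and stx: "s \<in> ?P \<or> t \<in> ?P \<or> x \<in> ?P" for s t x
      proof -
        have s1: "fst s \<in> carrier L" "snd s \<in> carrier M" "fst t \<in> carrier L" "snd t \<in> carrier M"
          "fst x \<in> carrier L" "snd x \<in> carrier M" using s t x by (auto simp: direct_sum_simps)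
        consider "fst s \<in> N \<and> snd s \<in> J \<or> fst t \<in> N \<and> snd t \<in> J" | "fst x \<in> N" "snd x \<in> J"
          using stx by (auto simp: mem_Times_iff)
        then have "\<theta> (fst s \<otimes>\<^bsub>L\<^esub> fst t) (snd x) = \<zero>\<^bsub>?C\<^esub> \<and> \<theta>' (snd s \<otimes>\<^bsub>M\<^esub> snd t) (fst x) = \<zero>\<^bsub>?C\<^esub>"
        proof cases
          case 1
          then show ?thesis
            using s1 comL comM ideal by (intro conjI \<theta>n(2) \<theta>'n(2)) auto
        next
          case 2
          then show ?thesis
            using s1 comL' comM' L.bracket_closed M.bracket_closed by (intro conjI \<theta>n(3) \<theta>'n(3)) auto
        qed
        then show ?thesis by (simp add: \<Theta>(2) s t x G.bracket_closed fb)
      qed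
      have right: "\<Theta> (tpow_pure F ?G [x, s \<otimes>\<^bsub>?G\<^esub> t]) = \<zero>\<^bsub>?C\<^esub>"
        if s: "s \<in> carrier ?G" and t: "t \<in> carrier ?G" and x: "x \<in> carrier ?G" and stx: "s \<in> ?P \<or> t \<in> ?P \<or> x \<in> ?P" for s t x
      proof -
        have s1: "fst s \<in> carrier L" "snd s \<in> carrier M" "fst t \<in> carrier L" "snd t \<in> carrier M"
          "fst x \<in> carrier L" "snd x \<in> carrier M" using s t x by (auto simp: direct_sum_simps)
        consider "fst s \<in> N \<and> snd s \<in> J \<or> fst t \<in> N \<and> snd t \<in> J" | "fst x \<in> N" "snd x \<in> J"
          using stx by (auto simp: mem_Times_iff)
        then have "\<theta> (fst x) (snd s \<otimes>\<^bsub>M\<^esub> snd t) = \<zero>\<^bsub>?C\<^esub> \<and> \<theta>' (snd x) (fst s \<otimes>\<^bsub>L\<^esub> fst t) = \<zero>\<^bsub>?C\<^esub>"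
        proof cases
          case 1
          then show ?thesis
            using s1 comL comM ideal by (intro conjI \<theta>n(3) \<theta>'n(3)) auto
        next
          case 2
          then show ?thesis
            using s1 comL' comM' L.bracket_closed M.bracket_closed by (intro conjI \<theta>n(2) \<theta>'n(2)) auto
        qed
        then show ?thesis by (simp add: \<Theta>(2) s t x G.bracket_closed fb)
      qed
      have t3: "tpow_pure F ?G [u \<otimes>\<^bsub>?G\<^esub> v, w] \<in> carrier (CL F ?G 2)" "tpow_pure F ?G [u \<otimes>\<^bsub>?G\<^esub> w, v] \<in> carrier (CL F ?G 2)"
        "tpow_pure F ?G [u, v \<otimes>\<^bsub>?G\<^esub> w] \<in> carrier (CL F ?G 2)"
        using tp G.bracket_closed u v w by auto
      have z: "\<Theta> (tpow_pure F ?G [u \<otimes>\<^bsub>?G\<^esub> v, w]) = \<zero>\<^bsub>?C\<^esub>" "\<Theta> (tpow_pure F ?G [u \<otimes>\<^bsub>?G\<^esub> w, v]) = \<zero>\<^bsub>?C\<^esub>"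
        "\<Theta> (tpow_pure F ?G [u, v \<otimes>\<^bsub>?G\<^esub> w]) = \<zero>\<^bsub>?C\<^esub>"
        using uvw by (intro left right u v w; blast)+
      show "\<Theta> (CL_boundary F ?G 3 (tpow_pure F ?G xs)) = \<zero>\<^bsub>?C\<^esub>"
        unfolding d3(2)[OF xs(1)] unfolding e boundary_word_3[OF G u v w]
        by (simp add: linear_maps_zero_neg(3)[OF \<Theta>(1) TG C] linear_mapsD(2)[OF \<Theta>(1)] t3 z C.minus_eq_zero_iff)
    qed
    then show ?thesis using ac by simp
  qed

  define \<kappa>1 where "\<kappa>1 = (\<lambda>a. rel_boundaries F L N +>\<^bsub>rel_cycle_space F L N\<^esub> a)"
  define \<kappa>2 where "\<kappa>2 = (\<lambda>a. rel_boundaries F M J +>\<^bsub>rel_cycle_space F M J\<^esub> a)"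
  note ZL = module_rel_cycle_space[OF L N] and ZM = module_rel_cycle_space[OF M J] and ZG = module_rel_cycle_space[OF G P]
  note BL = rel_boundaries_submodule_of_cycles[OF L N] and BM = rel_boundaries_submodule_of_cycles[OF M J]
  have k1: "\<kappa>1 \<in> linear_maps F (rel_cycle_space F L N) ?K1" and k2: "\<kappa>2 \<in> linear_maps F (rel_cycle_space F M J) ?K2"
    unfolding \<kappa>1_def \<kappa>2_def by (rule coset_linear[OF ZL BL] coset_linear[OF ZM BM])+
  have k1z: "\<kappa>1 a = \<zero>\<^bsub>?K1\<^esub> \<longleftrightarrow> a \<in> rel_boundaries F L N" if "a \<in> rel_cycles F L N" for a
    unfolding \<kappa>1_def quotient_alg_simps by (rule coset_eq_self_iff[OF ZL BL]) (use that in simp)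
  have k2z: "\<kappa>2 a = \<zero>\<^bsub>?K2\<^esub> \<longleftrightarrow> a \<in> rel_boundaries F M J" if "a \<in> rel_cycles F M J" for a
    unfolding \<kappa>2_def quotient_alg_simps by (rule coset_eq_self_iff[OF ZM BM]) (use that in simp)
  have K1: "module F ?K1" and K2: "module F ?K2" by (rule module_HL2_kernel[OF L N] module_HL2_kernel[OF M J])+
  interpret K1: module F ?K1 by (rule K1)
  interpret K2: module F ?K2 by (rule K2)
  have pZ: "p2 a \<in> rel_cycles F L N" and rZ: "r2 a \<in> rel_cycles F M J" if "a \<in> rel_cycles F ?G ?P" for a
    unfolding p2_def r2_def
    by (rule tpow_map_rel_cycles[OF G P L N p pN that] tpow_map_rel_cycles[OF G P M J r rJ that]; assumption)+
  have pB: "p2 a \<in> rel_boundaries F L N" and rB: "r2 a \<in> rel_boundaries F M J" if "a \<in> ?B" for a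
    unfolding p2_def r2_def
    by (rule tpow_map_rel_boundaries[OF G P L N p pN that] tpow_map_rel_boundaries[OF G P M J r rJ that]; assumption)+
  have iZ: "i2 a \<in> rel_cycles F ?G ?P" if "a \<in> rel_cycles F L N" for a
    unfolding i2_def by (rule tpow_map_rel_cycles[OF L N G P i iN that])
  have jZ: "j2 a \<in> rel_cycles F ?G ?P" if "a \<in> rel_cycles F M J" for a
    unfolding j2_def by (rule tpow_map_rel_cycles[OF M J G P j jJ that])
  have iB: "i2 a \<in> ?B" if "a \<in> rel_boundaries F L N" for a
    unfolding i2_def by (rule tpow_map_rel_boundaries[OF L N G P i iN that])
  have jB: "j2 a \<in> ?B" if "a \<in> rel_boundaries F M J" for a
    unfolding j2_def by (rule tpow_map_rel_boundaries[OF M J G P j jJ that])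
  have ZGsub: "rel_cycles F ?G ?P \<subseteq> carrier (CL F ?G 2)" by (auto simp: rel_cycles_def)
  let ?W = "?K1 \<boxplus> ?K2 \<boxplus> ?C"
  have W: "module F ?W" by (intro module_direct_sum K1 K2 C)
  \<comment> \<open>The isomorphism before passing to the quotient.\<close>
  define \<Phi> where "\<Phi> = (\<lambda>a. (\<kappa>1 (p2 a), (\<kappa>2 (r2 a), \<Theta> a)))"
  have lpZ: "p2 \<in> linear_maps F (rel_cycle_space F ?G ?P) (rel_cycle_space F L N)"
    and lrZ: "r2 \<in> linear_maps F (rel_cycle_space F ?G ?P) (rel_cycle_space F M J)"
    and l\<Theta>Z: "\<Theta> \<in> linear_maps F (rel_cycle_space F ?G ?P) ?C"
    using linear_mapsD[OF l2(2)] linear_mapsD[OF l2(4)] linear_mapsD[OF \<Theta>(1)] pZ rZ subsetD[OF ZGsub]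
    by (auto intro!: linear_mapsI)
  have \<Phi>: "\<Phi> \<in> linear_maps F (rel_cycle_space F ?G ?P) ?W"
    unfolding \<Phi>_def by (intro linear_maps_Pair linear_maps_comp[OF lpZ k1] linear_maps_comp[OF lrZ k2] l\<Theta>Z)
  show ?thesis
  proof (rule linear_iso_quotient[OF ZG W \<Phi>])
    show "?B \<subseteq> carrier (rel_cycle_space F ?G ?P)" using rel_boundaries_subset[OF G P] by simp
  next
    fix a assume "a \<in> carrier (rel_cycle_space F ?G ?P)"
    then have a: "a \<in> rel_cycles F ?G ?P" by simp
    then have a': "a \<in> carrier (CL F ?G 2)" using ZGsub by blast
    show "\<Phi> a = \<zero>\<^bsub>?W\<^esub> \<longleftrightarrow> a \<in> ?B"
    proof
      assume "a \<in> ?B"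
      then show "\<Phi> a = \<zero>\<^bsub>?W\<^esub>"
        using k1z[OF pZ[OF a]] k2z[OF rZ[OF a]] pB rB \<Theta>B by (simp add: \<Phi>_def direct_sum_simps)
    next
      assume "\<Phi> a = \<zero>\<^bsub>?W\<^esub>"
      then have z: "\<kappa>1 (p2 a) = \<zero>\<^bsub>?K1\<^esub>" "\<kappa>2 (r2 a) = \<zero>\<^bsub>?K2\<^esub>" "\<Theta> a = \<zero>\<^bsub>?C\<^esub>"
        by (auto simp: \<Phi>_def direct_sum_simps)
      have "i2 (p2 a) \<in> ?B" "j2 (r2 a) \<in> ?B"
        using z(1,2) k1z[OF pZ[OF a]] k2z[OF rZ[OF a]] iB jB by blast+
      moreover have "X a \<in> ?B"
      proof -
        have "?B +>\<^bsub>CL F ?G 2\<^esub> X a = ?B"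
          using cross[OF a] z(3) linear_maps_zero_neg(1)[OF \<Gamma> C Q] by (simp add: quotient_alg_simps)
        then show ?thesis using coset_eq_self_iff[OF TG B linear_mapsD(1)[OF X(1) a']] by simp
      qed
      ultimately show "a \<in> ?B" using decomp[OF a'] submoduleD(3)[OF B] by metis
    qed
  next
    define H where "H = \<Phi> ` carrier (rel_cycle_space F ?G ?P)"
    interpret ZG: module F "rel_cycle_space F ?G ?P" by (rule ZG)
    have H: "submodule H F ?W"
      unfolding H_def by (rule submodule_image[OF \<Phi> ZG W ZG.carrier_is_submodule])
    have f: "fst (i x) = x" "snd (i x) = \<zero>\<^bsub>M\<^esub>" "fst (j y) = \<zero>\<^bsub>L\<^esub>" "snd (j y) = y" for x y
      by (auto simp: i_def j_def)
    have z00: "tpow_pure F L [\<zero>\<^bsub>L\<^esub>, \<zero>\<^bsub>L\<^esub>] = \<zero>\<^bsub>CL F L 2\<^esub>" "tpow_pure F M [\<zero>\<^bsub>M\<^esub>, \<zero>\<^bsub>M\<^esub>] = \<zero>\<^bsub>CL F M 2\<^esub>"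
      by (rule tpow_pure_zero[OF L'] tpow_pure_zero[OF M']; simp add: mem_tpow_words)+
    have 0: "\<kappa>1 \<zero>\<^bsub>CL F L 2\<^esub> = \<zero>\<^bsub>?K1\<^esub>" "\<kappa>2 \<zero>\<^bsub>CL F M 2\<^esub> = \<zero>\<^bsub>?K2\<^esub>"
      using linear_maps_zero_neg(1)[OF k1 ZL K1] linear_maps_zero_neg(1)[OF k2 ZM K2] by simp_all
    have \<Phi>i: "\<Phi> (i2 a) = (\<kappa>1 a, (\<zero>\<^bsub>?K2\<^esub>, \<zero>\<^bsub>?C\<^esub>))" if a: "a \<in> rel_cycles F L N" for a
    proof -
      have a': "a \<in> carrier (CL F L 2)" using a by (simp add: rel_cycles_def)
      have "p2 (i2 a) = a"
        by (rule tpow_maps_eqI[OF L' TL linear_maps_comp[OF l2(1,2)] linear_maps_id _ a'])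
          (auto simp: tpow_words_2 i2 p2 ic f)
      moreover have "r2 (i2 a) = \<zero>\<^bsub>CL F M 2\<^esub>"
        by (rule tpow_maps_eqI[OF L' TM linear_maps_comp[OF l2(1,4)] linear_maps_zero[OF TM] _ a'])
          (auto simp: tpow_words_2 i2 r2 ic f z00)
      moreover have "\<Theta> (i2 a) = \<zero>\<^bsub>?C\<^esub>"
        by (rule tpow_maps_eqI[OF L' C linear_maps_comp[OF l2(1) \<Theta>(1)] linear_maps_zero[OF C] _ a'])
          (auto simp: tpow_words_2 i2 \<Theta>(2) ic f \<theta>00)
      ultimately show ?thesis by (simp add: \<Phi>_def 0)
    qed
    have \<Phi>j: "\<Phi> (j2 a) = (\<zero>\<^bsub>?K1\<^esub>, (\<kappa>2 a, \<zero>\<^bsub>?C\<^esub>))" if a: "a \<in> rel_cycles F M J" for a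
    proof -
      have a': "a \<in> carrier (CL F M 2)" using a by (simp add: rel_cycles_def)
      have "r2 (j2 a) = a"
        by (rule tpow_maps_eqI[OF M' TM linear_maps_comp[OF l2(3,4)] linear_maps_id _ a'])
          (auto simp: tpow_words_2 j2 r2 jc f)
      moreover have "p2 (j2 a) = \<zero>\<^bsub>CL F L 2\<^esub>"
        by (rule tpow_maps_eqI[OF M' TL linear_maps_comp[OF l2(3,2)] linear_maps_zero[OF TL] _ a'])
          (auto simp: tpow_words_2 j2 p2 jc f z00)
      moreover have "\<Theta> (j2 a) = \<zero>\<^bsub>?C\<^esub>"
        by (rule tpow_maps_eqI[OF M' C linear_maps_comp[OF l2(3) \<Theta>(1)] linear_maps_zero[OF C] _ a'])
          (auto simp: tpow_words_2 j2 \<Theta>(2) jc f \<theta>00)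
      ultimately show ?thesis by (simp add: \<Phi>_def 0)
    qed
    have \<iota>: "(\<lambda>c. (\<zero>\<^bsub>?K1\<^esub>, (\<zero>\<^bsub>?K2\<^esub>, c))) \<in> linear_maps F ?C ?W"
      by (intro linear_maps_Pair linear_maps_zero linear_maps_id K1 K2)
    \<comment> \<open>The cross term is reached by the cycles \<open>i x \<otimes> j y\<close> and \<open>j y \<otimes> i x\<close> with one factor in the ideal.\<close>
    have \<Phi>c: "carrier ?C \<subseteq> {c \<in> carrier ?C. (\<zero>\<^bsub>?K1\<^esub>, (\<zero>\<^bsub>?K2\<^esub>, c)) \<in> H}"
    proof (rule gen[OF submodule_preimage[OF \<iota> C W H]])
      fix x y assume xy: "x \<in> carrier L" "y \<in> carrier M" "x \<in> N \<or> y \<in> J"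
      have c: "i x \<in> carrier ?G" "j y \<in> carrier ?G" using xy ic jc by auto
      have P': "i x \<in> ?P \<or> j y \<in> ?P" using xy(3) iN jJ by blast
      have b: "i x \<otimes>\<^bsub>?G\<^esub> j y = \<zero>\<^bsub>?G\<^esub>" "j y \<otimes>\<^bsub>?G\<^esub> i x = \<zero>\<^bsub>?G\<^esub>"
        using xy by (auto simp: i_def j_def direct_sum_simps zL zM)
      have t0: "tpow_pure F ?G [\<zero>\<^bsub>?G\<^esub>] = \<zero>\<^bsub>CL F ?G 1\<^esub>"
        by (rule tpow_pure_zero[OF G']) (auto simp: mem_tpow_words)
      have cyc: "tpow_pure F ?G [u, v] \<in> rel_cycles F ?G ?P"
        if "u \<in> carrier ?G" "v \<in> carrier ?G" "u \<in> ?P \<or> v \<in> ?P" "u \<otimes>\<^bsub>?G\<^esub> v = \<zero>\<^bsub>?G\<^esub>" for u v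
      proof -
        have w: "[u, v] \<in> tpow_words ?G 2" using that by (simp add: mem_tpow_words)
        show ?thesis
          unfolding rel_cycles_def
          using CL_boundary(2)[OF G w] boundary_word_2[OF G that(1,2)] that(3,4) t0
            CL_proj_word_zero[OF G P w] tp[OF that(1,2)] by auto
      qed
      have z: "tpow_pure F L [x, \<zero>\<^bsub>L\<^esub>] = \<zero>\<^bsub>CL F L 2\<^esub>" "tpow_pure F L [\<zero>\<^bsub>L\<^esub>, x] = \<zero>\<^bsub>CL F L 2\<^esub>"
        "tpow_pure F M [y, \<zero>\<^bsub>M\<^esub>] = \<zero>\<^bsub>CL F M 2\<^esub>" "tpow_pure F M [\<zero>\<^bsub>M\<^esub>, y] = \<zero>\<^bsub>CL F M 2\<^esub>"
        using xy by (auto intro!: tpow_pure_zero[OF L'] tpow_pure_zero[OF M'] simp: mem_tpow_words)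
      have "\<Phi> (tpow_pure F ?G [i x, j y]) = (\<zero>\<^bsub>?K1\<^esub>, (\<zero>\<^bsub>?K2\<^esub>, \<theta> x y))"
        using \<theta>c[OF xy(1,2)] by (simp add: \<Phi>_def p2 r2 \<Theta>(2) c f z 0 \<theta>00)
      moreover have "\<Phi> (tpow_pure F ?G [j y, i x]) = (\<zero>\<^bsub>?K1\<^esub>, (\<zero>\<^bsub>?K2\<^esub>, \<theta>' y x))"
        using \<theta>'c[OF xy(2,1)] by (simp add: \<Phi>_def p2 r2 \<Theta>(2) c f z 0 \<theta>00)
      moreover have "\<Phi> (tpow_pure F ?G [i x, j y]) \<in> H" "\<Phi> (tpow_pure F ?G [j y, i x]) \<in> H"
        unfolding H_def using cyc[of "i x" "j y"] cyc[of "j y" "i x"] c P' b by auto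
      ultimately show "\<theta> x y \<in> {c \<in> carrier ?C. (\<zero>\<^bsub>?K1\<^esub>, (\<zero>\<^bsub>?K2\<^esub>, c)) \<in> H} \<and>
          \<theta>' y x \<in> {c \<in> carrier ?C. (\<zero>\<^bsub>?K1\<^esub>, (\<zero>\<^bsub>?K2\<^esub>, c)) \<in> H}"
        using \<theta>c[OF xy(1,2)] \<theta>'c[OF xy(2,1)] by simp
    qed
    have "k \<in> H" if kW: "k \<in> carrier ?W" for k
    proof -
      obtain k1 k2 c where k: "k = (k1, (k2, c))" and k1c: "k1 \<in> carrier ?K1" and k2c: "k2 \<in> carrier ?K2"
        and cc: "c \<in> carrier ?C" using kW by (auto simp: direct_sum_simps)
      obtain a b where a: "a \<in> rel_cycles F L N" "k1 = \<kappa>1 a" and b: "b \<in> rel_cycles F M J" "k2 = \<kappa>2 b"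
        using k1c k2c by (auto simp: quotient_alg_simps \<kappa>1_def \<kappa>2_def)
      have "\<Phi> (i2 a) \<in> H" "\<Phi> (j2 b) \<in> H" using iZ[OF a(1)] jZ[OF b(1)] by (auto simp: H_def)
      moreover have "(\<zero>\<^bsub>?K1\<^esub>, (\<zero>\<^bsub>?K2\<^esub>, c)) \<in> H" using \<Phi>c cc by blast
      ultimately have "(\<Phi> (i2 a) \<oplus>\<^bsub>?W\<^esub> \<Phi> (j2 b)) \<oplus>\<^bsub>?W\<^esub> (\<zero>\<^bsub>?K1\<^esub>, (\<zero>\<^bsub>?K2\<^esub>, c)) \<in> H"
        by (intro submoduleD(3)[OF H])
      moreover have "(\<Phi> (i2 a) \<oplus>\<^bsub>?W\<^esub> \<Phi> (j2 b)) \<oplus>\<^bsub>?W\<^esub> (\<zero>\<^bsub>?K1\<^esub>, (\<zero>\<^bsub>?K2\<^esub>, c)) = k"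
        unfolding \<Phi>i[OF a(1)] \<Phi>j[OF b(1)] k a(2)[symmetric] b(2)[symmetric]
        using k1c k2c cc by (simp add: direct_sum_simps)
      ultimately show ?thesis by simp
    qed
    then show "carrier ?W \<subseteq> \<Phi> ` carrier (rel_cycle_space F ?G ?P)" unfolding H_def by blast
  qed
qed

theorem corollary3p3:
  fixes F :: "('f, 'r) ring_scheme"
    and \<gg>\<^sub>1 :: "('f, 'a, 'm) module_scheme" and \<nn>\<^sub>1 :: "'a set"
    and \<gg>\<^sub>2 :: "('f, 'b, 'n) module_scheme" and \<nn>\<^sub>2 :: "'b set"
  assumes "leibniz_algebra F \<gg>\<^sub>1" and "leibniz_algebra F \<gg>\<^sub>2"
    and "leibniz_ideal F \<gg>\<^sub>1 \<nn>\<^sub>1" and "leibniz_ideal F \<gg>\<^sub>2 \<nn>\<^sub>2"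
  shows "leibniz_isomorphic F
    (HL_rel F 2 (\<gg>\<^sub>1 \<boxplus> \<gg>\<^sub>2) (\<nn>\<^sub>1 \<times> \<nn>\<^sub>2))
    (HL_rel F 2 \<gg>\<^sub>1 \<nn>\<^sub>1 \<boxplus> HL_rel F 2 \<gg>\<^sub>2 \<nn>\<^sub>2 \<boxplus>
      quotient_alg (cross_sum F \<gg>\<^sub>1 \<nn>\<^sub>1 \<gg>\<^sub>2 \<nn>\<^sub>2) (cross_subalgebra F \<gg>\<^sub>1 \<nn>\<^sub>1 \<gg>\<^sub>2 \<nn>\<^sub>2))"
proof -
  note pair1 = assms(1,3) and pair2 = assms(2,4)
  note pairs = assms(1,3,2,4)
  note G = leibniz_algebra_direct_sum[OF assms(1,2)] leibniz_ideal_direct_sum[OF assms]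
  have "linear_iso F (HL_rel F 2 (\<gg>\<^sub>1 \<boxplus> \<gg>\<^sub>2) (\<nn>\<^sub>1 \<times> \<nn>\<^sub>2)) (HL2_kernel F (\<gg>\<^sub>1 \<boxplus> \<gg>\<^sub>2) (\<nn>\<^sub>1 \<times> \<nn>\<^sub>2))"
    by (rule linear_iso_sym[OF module_HL2_kernel[OF G] HL_rel_2_iso_kernel[OF G]])
  moreover have "linear_iso F (HL2_kernel F (\<gg>\<^sub>1 \<boxplus> \<gg>\<^sub>2) (\<nn>\<^sub>1 \<times> \<nn>\<^sub>2))
      (HL2_kernel F \<gg>\<^sub>1 \<nn>\<^sub>1 \<boxplus> HL2_kernel F \<gg>\<^sub>2 \<nn>\<^sub>2 \<boxplus> cross_quotient F \<gg>\<^sub>1 \<nn>\<^sub>1 \<gg>\<^sub>2 \<nn>\<^sub>2)"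
    by (rule HL2_kernel_direct_sum[OF pairs])
  moreover have "linear_iso F
      (HL2_kernel F \<gg>\<^sub>1 \<nn>\<^sub>1 \<boxplus> HL2_kernel F \<gg>\<^sub>2 \<nn>\<^sub>2 \<boxplus> cross_quotient F \<gg>\<^sub>1 \<nn>\<^sub>1 \<gg>\<^sub>2 \<nn>\<^sub>2)
      (HL_rel F 2 \<gg>\<^sub>1 \<nn>\<^sub>1 \<boxplus> HL_rel F 2 \<gg>\<^sub>2 \<nn>\<^sub>2 \<boxplus> cross_quotient F \<gg>\<^sub>1 \<nn>\<^sub>1 \<gg>\<^sub>2 \<nn>\<^sub>2)"
    by (intro linear_iso_direct_sum linear_iso_refl HL_rel_2_iso_kernel pair1 pair2)
  ultimately have "linear_iso F (HL_rel F 2 (\<gg>\<^sub>1 \<boxplus> \<gg>\<^sub>2) (\<nn>\<^sub>1 \<times> \<nn>\<^sub>2))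
      (HL_rel F 2 \<gg>\<^sub>1 \<nn>\<^sub>1 \<boxplus> HL_rel F 2 \<gg>\<^sub>2 \<nn>\<^sub>2 \<boxplus> cross_quotient F \<gg>\<^sub>1 \<nn>\<^sub>1 \<gg>\<^sub>2 \<nn>\<^sub>2)"
    by (blast intro: linear_iso_trans)
  then show ?thesis
    by (intro leibniz_isomorphic_trivial_bracket trivial_bracket_direct_sum module_direct_sum
        module_HL_rel_2 trivial_bracket_HL_rel_2 G pair1 pair2
        module_cross_quotient[OF pairs] trivial_bracket_cross_quotient[OF pairs])
qed

end
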